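(* Let $0<q<1<p<\infty$, $r:=\frac{pq}{p-q}$, $p':=\frac{p}{p-1}$ and $0<\vartheta<\infty$. Let $v,w$ be weights and let $U$ be a $\vartheta$-regular kernel. Then the following assertions are equivalent: (i) There exists a constant $C\in(0,\infty)$ such that the inequality $$\left(\int_0^\infty\left(\int_0^t f(x)U(x,t)\,dx\right)^q w(t)\,dt\right)^{\frac1q}\le C\left(\int_0^\infty f^p(t)v(t)\,dt\right)^{\frac1p}\qquad( * )$$ holds for all $f\in\mathscr M_+$. (ii) Both conditions $$A_1^*:=\int_0^\infty\left(\int_t^\infty w(x)\,dx\right)^{\frac rp}w(t)\left(\int_0^t U^{p'}(z,t)v^{1-p'}(z)\,dz\right)^{\frac r{p'}}dt<\infty$$ and $$A_2^*:=\int_0^\infty\left(\int_t^\infty w(x)U^q(t,x)\,dx\right)^{\frac rp}w(t)\sup_{z\in(0,t]}U^q(z,t)\left(\int_0^z v^{1-p'}(s)\,ds\right)^{\frac r{p'}}dt<\infty$$ are satisfied. Moreover, if $C$ is the least constant such that $( * )$ holds for all $f\in\mathscr M_+$, then $$C^r\approx A_1^*+A_2^*.$$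
   Context: $\mathscr M_+$ denotes the set of all nonnegative Lebesgue measurable functions on $(0,\infty)$. A weight is a function $w\in\mathscr M_+$ such that $0<\int_0^t w(s)\,ds<\infty$ for all $t>0$. For $\vartheta>0$, a $\vartheta$-regular kernel is a measurable function $U:[0,\infty)^2\to[0,\infty)$ such that: (a) $U(x,y)$ is nonincreasing in $x$ and nondecreasing in $y$; (b) $U(x,z)\le\vartheta\,(U(x,y)+U(y,z))$ for all $0\le x<y<z<\infty$; (c) $U(0,y)>0$ for all $y>0$. For an exponent $\alpha$, $U^\alpha(x,y)$ means $(U(x,y))^\alpha$. $A\lesssim B$ means $A\le cB$ with a constant $c$ depending only on $p,q,\vartheta$ (in particular not on $v,w$); $A\approx B$ means $A\lesssim B$ and $B\lesssim A$. Values in $[0,\infty]$ are allowed, with the usual convention $0\cdot\infty=0$; $v^{1-p'}=\infty$ where $v=0$. *)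

theory Defs
  imports "HOL-Analysis.Analysis"
begin

text \<open>
  Functions on \<open>(0,\<infinity>)\<close> with values in \<open>[0,\<infinity>]\<close> are modelled as \<open>real \<Rightarrow> ennreal\<close>; their values
  outside \<open>(0,\<infinity>)\<close> are never used. Multiplication on \<^typ>\<open>ennreal\<close> satisfies \<open>0 * \<infinity> = 0\<close>.
\<close>

definition Mplus :: "(real \<Rightarrow> ennreal) set" where
  "Mplus = borel_measurable (lebesgue_on {0<..})"

text \<open>
  Real powers on \<open>[0,\<infinity>]\<close>: \<open>\<infinity>\<^sup>a = \<infinity>\<close> for \<open>a > 0\<close>, \<open>\<infinity>\<^sup>a = 0\<close> and \<open>0\<^sup>a = \<infinity>\<close> for \<open>a < 0\<close>.
\<close>

definition epow :: "ennreal \<Rightarrow> real \<Rightarrow> ennreal" where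
  "epow x a =
     (if a = 0 then 1
      else if x = \<infinity> then (if a > 0 then \<infinity> else 0)
      else if x = 0 then (if a > 0 then 0 else \<infinity>)
      else ennreal (enn2real x powr a))"

definition weight :: "(real \<Rightarrow> ennreal) \<Rightarrow> bool" where
  "weight w \<longleftrightarrow> w \<in> Mplus \<and>
     (\<forall>t>0. 0 < (\<integral>\<^sup>+s\<in>{0<..<t}. w s \<partial>lebesgue) \<and> (\<integral>\<^sup>+s\<in>{0<..<t}. w s \<partial>lebesgue) < \<infinity>)"

text \<open>Only the values of \<open>U\<close> on \<open>[0,\<infinity>)\<^sup>2\<close> matter.\<close>

definition regular_kernel :: "real \<Rightarrow> (real \<Rightarrow> real \<Rightarrow> real) \<Rightarrow> bool" where
  "regular_kernel \<theta> U \<longleftrightarrow>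
     (\<lambda>(x, y). U x y) \<in> borel_measurable (lebesgue_on ({0..} \<times> {0..})) \<and>
     (\<forall>x\<ge>0. \<forall>y\<ge>0. 0 \<le> U x y) \<and>
     (\<forall>x x' y. 0 \<le> x \<and> x \<le> x' \<and> 0 \<le> y \<longrightarrow> U x' y \<le> U x y) \<and>
     (\<forall>x y y'. 0 \<le> x \<and> 0 \<le> y \<and> y \<le> y' \<longrightarrow> U x y \<le> U x y') \<and>
     (\<forall>x y z. 0 \<le> x \<and> x < y \<and> y < z \<longrightarrow> U x z \<le> \<theta> * (U x y + U y z)) \<and>
     (\<forall>y>0. 0 < U 0 y)"

definition conj_exp :: "real \<Rightarrow> real" where
  "conj_exp p = p / (p - 1)"

definition r_exp :: "real \<Rightarrow> real \<Rightarrow> real" where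
  "r_exp p q = p * q / (p - q)"

definition hardy_ineq ::
  "real \<Rightarrow> real \<Rightarrow> (real \<Rightarrow> real \<Rightarrow> real) \<Rightarrow> (real \<Rightarrow> ennreal) \<Rightarrow> (real \<Rightarrow> ennreal) \<Rightarrow> ennreal \<Rightarrow> bool" where
  "hardy_ineq p q U v w C \<longleftrightarrow>
     (\<forall>f\<in>Mplus.
        epow (\<integral>\<^sup>+t\<in>{0<..}.
                (epow (\<integral>\<^sup>+x\<in>{0<..<t}. (f x * ennreal (U x t)) \<partial>lebesgue) q * w t) \<partial>lebesgue) (1 / q)
        \<le> C * epow (\<integral>\<^sup>+t\<in>{0<..}. (epow (f t) p * v t) \<partial>lebesgue) (1 / p))"

text \<open>
  The infimum is itself admissible whenever some constant is, so it is the least constant;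
  it is \<open>\<infinity>\<close> if no finite constant is admissible.
\<close>

definition best_const ::
  "real \<Rightarrow> real \<Rightarrow> (real \<Rightarrow> real \<Rightarrow> real) \<Rightarrow> (real \<Rightarrow> ennreal) \<Rightarrow> (real \<Rightarrow> ennreal) \<Rightarrow> ennreal" where
  "best_const p q U v w = Inf {C. hardy_ineq p q U v w C}"

definition A1_star ::
  "real \<Rightarrow> real \<Rightarrow> (real \<Rightarrow> real \<Rightarrow> real) \<Rightarrow> (real \<Rightarrow> ennreal) \<Rightarrow> (real \<Rightarrow> ennreal) \<Rightarrow> ennreal" where
  "A1_star p q U v w =
     (let r = r_exp p q; p' = conj_exp p in
      \<integral>\<^sup>+t\<in>{0<..}.
        (epow (\<integral>\<^sup>+x\<in>{t<..}. w x \<partial>lebesgue) (r / p) * w t *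
         epow (\<integral>\<^sup>+z\<in>{0<..<t}. (epow (ennreal (U z t)) p' * epow (v z) (1 - p')) \<partial>lebesgue) (r / p'))
      \<partial>lebesgue)"

definition A2_star ::
  "real \<Rightarrow> real \<Rightarrow> (real \<Rightarrow> real \<Rightarrow> real) \<Rightarrow> (real \<Rightarrow> ennreal) \<Rightarrow> (real \<Rightarrow> ennreal) \<Rightarrow> ennreal" where
  "A2_star p q U v w =
     (let r = r_exp p q; p' = conj_exp p in
      \<integral>\<^sup>+t\<in>{0<..}.
        (epow (\<integral>\<^sup>+x\<in>{t<..}. (w x * epow (ennreal (U t x)) q) \<partial>lebesgue) (r / p) * w t *
         (SUP z\<in>{0<..t}. epow (ennreal (U z t)) q *
            epow (\<integral>\<^sup>+s\<in>{0<..<z}. epow (v s) (1 - p') \<partial>lebesgue) (r / p')))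
      \<partial>lebesgue)"

end

theory Submission
  imports Defs
begin

text \<open>
  Truncating \<open>w\<close> to \<open>(0,N]\<close> we may assume that \<open>W(t) = \<integral>\<^sub>t\<^sup>\<infinity> w\<close> and
  \<open>\<omega>(t) = \<integral>\<^sub>t\<^sup>\<infinity> U\<^sup>q(t,x) w(x) dx\<close> are finite. Choose points \<open>0 = \<tau>\<^sub>0 < \<tau>\<^sub>1 < \<dots>\<close> along which \<open>W\<close> is at
  least halved, such that on every block \<open>(\<tau>\<^sub>n, \<tau>\<^sub>n\<^sub>+\<^sub>1]\<close> either \<open>W\<close> is exactly halved, or \<open>\<omega>\<close> varies only
  by a bounded factor but drops by this factor soon afterwards. With
  \<open>V(t) = \<integral>\<^sub>0\<^sup>t v\<^sup>1\<^sup>-\<^sup>p\<^sup>'\<close> and \<open>\<Phi>(t) = \<integral>\<^sub>0\<^sup>t U\<^sup>p\<^sup>'(z,t) v\<^sup>1\<^sup>-\<^sup>p\<^sup>'(z) dz\<close>, both the best constant and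
  \<open>A\<^sub>1\<^sup>* + A\<^sub>2\<^sup>*\<close> are compared with the two sums
  \<open>\<Sum> W(\<tau>\<^sub>n)\<^sup>r\<^sup>/\<^sup>q \<Phi>(\<tau>\<^sub>n)\<^sup>r\<^sup>/\<^sup>p\<^sup>'\<close> and \<open>\<Sum> \<omega>(\<tau>\<^sub>n)\<^sup>r\<^sup>/\<^sup>q V(\<tau>\<^sub>n)\<^sup>r\<^sup>/\<^sup>p\<^sup>'\<close>.
  For the upper bound the inner integral is split at the points \<open>\<tau>\<^sub>n\<close>, the kernel by its triangle
  inequality, and the \<open>q\<close>-th power by subadditivity; Hoelder's inequality then gives the two sums. The lower bound
  tests the inequality with superpositions of \<open>U\<^sup>p\<^sup>'\<^sup>-\<^sup>1(\<cdot>,\<tau>\<^sub>n) v\<^sup>1\<^sup>-\<^sup>p\<^sup>'\<close> and of \<open>v\<^sup>1\<^sup>-\<^sup>p\<^sup>'\<close>, restricted to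
  \<open>(0,\<tau>\<^sub>n]\<close>, with optimal coefficients.
\<close>

subsection \<open>Extended real powers\<close>

text \<open>The obstacle is that \<open>W\<close> and \<open>om\<close> decay at unrelated rates, so
  one dyadic sequence does not serve both. A block is closed either by exact halving of
  \<open>W\<close> or by comparability of \<open>om\<close> at its two ends; either way the part of
  the operator living inside the block is governed by quantities at its right end. The assumption q
  < 1 enters through subadditivity of the q-th power: earlier blocks are treated one at a time, and
  integrating over everything beyond a point reproduces \<open>W\<close> and \<open>om\<close>
  there. The triangle inequality leaves a remainder \<open>TH * om y\<close>; the drop factor
  \<open>a\<close> is chosen so that this remainder is at most half of the quantity being estimated.
  Bounded support of the weight gives \<open>om \<le> const * W\<close>, without which the choice of
  the next point could run away to infinity. Along the blocks \<open>W\<close> may fall much faster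
  than by halves, so the bound of \<open>A1\<close> by the best constant uses a second, exactly
  dyadic sequence. All constants depend only on p, q and the kernel constant, hence survive monotone
  convergence in N. The convention 0 times infinity = 0 is delicate in Hoelder's inequality, which
  is why the upper bound is run under finiteness of both sums.\<close>

lemma epow_ennreal: "0 < a \<Longrightarrow> 0 \<le> x \<Longrightarrow> epow (ennreal x) a = ennreal (x powr a)"
  by (auto simp: epow_def ennreal_eq_0_iff)

lemma epow_top [simp]: "0 < a \<Longrightarrow> epow top a = top"
  by (simp add: epow_def)

lemma epow_0 [simp]: "0 < a \<Longrightarrow> epow 0 a = 0"
  by (simp add: epow_def)

lemma epow_1 [simp]: "epow 1 a = 1"
  by (simp add: epow_def)

lemma epow_one [simp]: "epow x 1 = x"
  by (cases x) (auto simp: epow_def)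

lemma epow_eq_0_iff [simp]: "0 < a \<Longrightarrow> epow x a = 0 \<longleftrightarrow> x = 0"
  by (cases x) (auto simp: epow_ennreal ennreal_eq_0_iff)

lemma epow_eq_top_iff [simp]: "0 < a \<Longrightarrow> epow x a = top \<longleftrightarrow> x = top"
  by (cases x) (auto simp: epow_ennreal)

lemma epow_less_top: "0 < a \<Longrightarrow> x < top \<Longrightarrow> epow x a < top"
  by (metis epow_eq_top_iff top.not_eq_extremum)

lemma epow_mono: "0 < a \<Longrightarrow> x \<le> y \<Longrightarrow> epow x a \<le> epow y a"
  by (cases x; cases y) (auto simp: epow_ennreal top_unique intro!: ennreal_leI powr_mono2)

lemma epow_mult: "0 < a \<Longrightarrow> epow (x * y) a = epow x a * epow y a"
  by (cases x; cases y)
     (auto simp: epow_ennreal ennreal_mult[symmetric] powr_mult ennreal_top_mult ennreal_mult_top)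

lemma epow_add: "0 < a \<Longrightarrow> 0 < b \<Longrightarrow> epow x (a + b) = epow x a * epow x b"
  by (cases x) (auto simp: epow_ennreal ennreal_mult[symmetric] powr_add)

lemma epow_epow: "0 < a \<Longrightarrow> 0 < b \<Longrightarrow> epow (epow x a) b = epow x (a * b)"
  by (cases x) (auto simp: epow_ennreal powr_powr)

lemma epow_le_iff: "0 < a \<Longrightarrow> epow x a \<le> epow y a \<longleftrightarrow> x \<le> y"
  using epow_mono[of a x y] epow_mono[of "1/a" "epow x a" "epow y a"]
  by (auto simp: epow_epow)

lemma epow_le_swap: "0 < a \<Longrightarrow> epow x a \<le> y \<longleftrightarrow> x \<le> epow y (1 / a)"
  using epow_le_iff[of a x "epow y (1/a)"] by (simp add: epow_epow)

lemma measurable_epow [measurable]: "(\<lambda>x. epow x a) \<in> borel_measurable borel"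
  unfolding epow_def by measurable

lemma measurable_epow' [measurable (raw)]:
  assumes [measurable]: "f \<in> borel_measurable M"
  shows "(\<lambda>x. epow (f x) a) \<in> borel_measurable M"
  using measurable_compose[OF assms measurable_epow] .

text \<open>The power is an order isomorphism of [0,\<infinity>] whose inverse is the power
  1/a.\<close>

lemma epow_SUP:
  assumes "0 < a" "I \<noteq> {}"
  shows "epow (SUP i\<in>I. f i) a = (SUP i\<in>I. epow (f i) a)"
proof (rule antisym)
  have "f i \<le> epow (SUP i\<in>I. epow (f i) a) (1 / a)" if "i \<in> I" for i
    using assms that by (auto simp: epow_le_swap[symmetric] intro!: SUP_upper)
  then have "(SUP i\<in>I. f i) \<le> epow (SUP i\<in>I. epow (f i) a) (1 / a)"
    by (rule SUP_least)
  then show "epow (SUP i\<in>I. f i) a \<le> (SUP i\<in>I. epow (f i) a)"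
    using assms by (simp add: epow_le_swap)
qed (intro SUP_least epow_mono assms SUP_upper)

text \<open>After division by x + y both terms are fractions in [0,1] with sum 1, and z is at most
  its a-th power there.\<close>

lemma powr_subadd:
  fixes x y :: real
  assumes "0 < a" "a \<le> 1" "0 \<le> x" "0 \<le> y"
  shows "(x + y) powr a \<le> x powr a + y powr a"
proof (cases "x + y = 0")
  case False
  then have s: "0 < x + y" using assms by simp
  have *: "z / (x + y) \<le> (z / (x + y)) powr a" if "0 \<le> z" "z \<le> x + y" for z
    using powr_mono'[of a 1 "z / (x + y)"] assms that s by simp
  have "1 = x / (x + y) + y / (x + y)"
    using s by (simp add: add_divide_distrib[symmetric])
  also have "\<dots> \<le> (x / (x + y)) powr a + (y / (x + y)) powr a"
    by (intro add_mono *) (use assms in auto)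
  also have "\<dots> = (x powr a + y powr a) / (x + y) powr a"
    using assms s by (simp add: powr_divide add_divide_distrib)
  finally show ?thesis using s by (simp add: field_simps)
qed (use assms in auto)

lemma epow_subadd:
  assumes "0 < a" "a \<le> 1"
  shows "epow (x + y) a \<le> epow x a + epow y a"
  using assms powr_subadd[OF assms]
  by (cases x; cases y) (auto simp: epow_ennreal ennreal_plus[symmetric] simp del: ennreal_plus intro!: ennreal_leI)

lemma epow_subadd_sum:
  assumes "0 < a" "a \<le> 1"
  shows "epow (\<Sum>i\<in>I. f i) a \<le> (\<Sum>i\<in>I. epow (f i) a)"
proof (induction I rule: infinite_finite_induct)
  case (insert x F)
  then show ?case
    using epow_subadd[OF assms, of "f x" "sum f F"] by (auto intro: order_trans add_left_mono)
qed (use assms in auto)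

lemma epow_subadd_suminf:
  assumes "0 < a" "a \<le> 1"
  shows "epow (\<Sum>i. f i) a \<le> (\<Sum>i. epow (f i) a)"
proof -
  have "epow (\<Sum>i. f i) a = (SUP n. epow (\<Sum>i<n. f i) a)"
    using assms by (simp add: suminf_eq_SUP epow_SUP)
  also have "\<dots> \<le> (\<Sum>i. epow (f i) a)"
  proof (rule SUP_least)
    fix n
    have "epow (\<Sum>i<n. f i) a \<le> (\<Sum>i<n. epow (f i) a)"
      by (rule epow_subadd_sum[OF assms])
    also have "\<dots> \<le> (\<Sum>i. epow (f i) a)"
      by (rule sum_le_suminf) auto
    finally show "epow (\<Sum>i<n. f i) a \<le> (\<Sum>i. epow (f i) a)" .
  qed
  finally show ?thesis .
qed

text \<open>Substitute for subadditivity at exponents above 1, by way of x + y \<le> 2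
  max(x,y).\<close>

lemma epow_add_le:
  assumes "0 < a"
  shows "epow (x + y) a \<le> epow 2 a * (epow x a + epow y a)"
proof -
  have "epow (x + y) a \<le> epow (2 * max x y) a"
    using assms by (intro epow_mono) (auto simp: mult_2 max_def intro: add_mono)
  also have "\<dots> = epow 2 a * epow (max x y) a"
    using assms by (rule epow_mult)
  also have "epow (max x y) a \<le> epow x a + epow y a"
    by (auto simp: max_def)
  finally show ?thesis by (simp add: mult_left_mono)
qed

subsection \<open>Measurability of monotone functions\<close>

lemma antimono_measurable:
  fixes f :: "real \<Rightarrow> ennreal"
  assumes "antimono f" shows "f \<in> borel_measurable borel"
proof (rule borel_measurableI_greater)
  fix y
  have "is_interval {x. y < f x}"
    unfolding is_interval_1 using assms by (auto simp: antimono_def intro: less_le_trans)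
  then have "{x. y < f x} \<in> sets borel"
    by (rule real_interval_borel_measurable)
  then show "{x \<in> space borel. y < f x} \<in> sets borel" by simp
qed

subsection \<open>Hoelder's inequality\<close>

text \<open>Young's inequality rescaled so that for A and B equal to the integrals of the two powers
  the bracket integrates to 1/p + 1/p' = 1, leaving exactly the Hoelder bound.\<close>

lemma Young_ennreal:
  fixes x y :: ennreal and A B p p' :: real
  assumes p: "1 < p" "1 < p'" "1 / p + 1 / p' = 1" and AB: "0 < A" "0 < B"
  shows "x * y \<le> ennreal (A powr (1 / p) * B powr (1 / p')) *
           (ennreal (1 / (p * A)) * epow x p + ennreal (1 / (p' * B)) * epow y p')"
proof (cases "x = top \<or> y = top")
  case True
  have pos: "0 < A powr (1 / p) * B powr (1 / p')" "0 < p * A" "0 < p' * B"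
    using p AB by auto
  from True have "ennreal (A powr (1 / p) * B powr (1 / p')) *
           (ennreal (1 / (p * A)) * epow x p + ennreal (1 / (p' * B)) * epow y p') = top"
    using p pos by (auto simp: ennreal_mult_top ennreal_eq_0_iff not_le)
  then show ?thesis by (simp only: top_greatest)
next
  case False
  then obtain a b where xy: "x = ennreal a" "y = ennreal b" "0 \<le> a" "0 \<le> b"
    by (metis ennreal_cases)
  let ?a = "a / A powr (1 / p)" and ?b = "b / B powr (1 / p')"
  have "?a * ?b \<le> ?a powr p / p + ?b powr p' / p'"
    using xy p by (intro Youngs_inequality) auto
  also have "\<dots> = 1 / (p * A) * a powr p + 1 / (p' * B) * b powr p'"
    using xy p AB by (simp add: powr_divide powr_powr mult.commute)
  finally have "a * b \<le> A powr (1 / p) * B powr (1 / p') *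
      (1 / (p * A) * a powr p + 1 / (p' * B) * b powr p')"
    using AB by (simp add: field_simps)
  then have "ennreal (a * b) \<le> ennreal (A powr (1 / p) * B powr (1 / p') *
      (1 / (p * A) * a powr p + 1 / (p' * B) * b powr p'))"
    by (rule ennreal_leI)
  also have "\<dots> = ennreal (A powr (1 / p) * B powr (1 / p')) *
      (ennreal (1 / (p * A)) * ennreal (a powr p) + ennreal (1 / (p' * B)) * ennreal (b powr p'))"
    using p AB by (simp add: ennreal_mult[symmetric] ennreal_plus[symmetric] del: ennreal_plus)
  finally show ?thesis
    using p xy by (simp add: ennreal_mult epow_ennreal)
qed

lemma nn_integral_Hoelder:
  fixes p p' :: real
  assumes p: "1 < p" "1 < p'" "1 / p + 1 / p' = 1"
    and [measurable]: "f \<in> borel_measurable M" "g \<in> borel_measurable M"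
  shows "(\<integral>\<^sup>+x. f x * g x \<partial>M)
           \<le> epow (\<integral>\<^sup>+x. epow (f x) p \<partial>M) (1 / p) * epow (\<integral>\<^sup>+x. epow (g x) p' \<partial>M) (1 / p')"
    (is "?L \<le> epow ?A _ * epow ?B _")
proof -
  consider "?A = 0 \<or> ?B = 0" | "?A \<noteq> 0" "?B \<noteq> 0" "?A = top \<or> ?B = top"
    | A B where "0 < A" "0 < B" "?A = ennreal A" "?B = ennreal B"
    by (cases ?A; cases ?B) (auto simp: ennreal_eq_0_iff less_le)
  then show ?thesis
  proof cases
    case 1
    then have "(AE x in M. epow (f x) p = 0) \<or> (AE x in M. epow (g x) p' = 0)"
      using p by (simp add: nn_integral_0_iff_AE)
    then have "AE x in M. f x * g x = 0"
      using p by (auto elim!: eventually_mono)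
    then have "?L = (\<integral>\<^sup>+x. 0 \<partial>M)" by (rule nn_integral_cong_AE)
    then show ?thesis by simp
  next
    case 2
    then show ?thesis using p by (auto simp: ennreal_mult_top ennreal_top_mult)
  next
    case 3
    let ?c = "A powr (1 / p) * B powr (1 / p')"
    have "?L \<le> (\<integral>\<^sup>+x. ennreal ?c *
        (ennreal (1 / (p * A)) * epow (f x) p + ennreal (1 / (p' * B)) * epow (g x) p') \<partial>M)"
      by (intro nn_integral_mono Young_ennreal p 3)
    also have "\<dots> = ennreal ?c * (ennreal (1 / (p * A)) * ennreal A + ennreal (1 / (p' * B)) * ennreal B)"
      by (simp add: nn_integral_cmult nn_integral_add 3)
    also have "\<dots> = ennreal (?c * (1 / (p * A) * A + 1 / (p' * B) * B))"
      using p 3 by (simp add: ennreal_mult[symmetric] ennreal_plus[symmetric] del: ennreal_plus)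
    also have "1 / (p * A) * A + 1 / (p' * B) * B = 1"
      using p 3 by simp
    finally show ?thesis using p 3 by (simp add: epow_ennreal ennreal_mult)
  qed
qed

lemma suminf_Hoelder:
  fixes p p' :: real and f g :: "nat \<Rightarrow> ennreal"
  assumes p: "1 < p" "1 < p'" "1 / p + 1 / p' = 1"
  shows "(\<Sum>n. f n * g n) \<le> epow (\<Sum>n. epow (f n) p) (1 / p) * epow (\<Sum>n. epow (g n) p') (1 / p')"
  using nn_integral_Hoelder[OF p, of f "count_space UNIV" g]
  by (simp add: nn_integral_count_space_nat)

lemma suminf_Hoelder_powr:
  fixes a b :: real and f g :: "nat \<Rightarrow> ennreal"
  assumes p: "0 < a" "0 < b" "a + b = 1"
  shows "(\<Sum>n. epow (f n) a * epow (g n) b) \<le> epow (\<Sum>n. f n) a * epow (\<Sum>n. g n) b"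
  using suminf_Hoelder[of "1 / a" "1 / b" "\<lambda>n. epow (f n) a" "\<lambda>n. epow (g n) b"] assms
  by (simp add: epow_epow)

text \<open>
  The weights \<open>b\<^sub>n\<close> with \<open>b\<^sub>n\<^sup>p\<^sup>-\<^sup>q = Y\<^sub>n P\<^sub>n\<^sup>q\<^sup>-\<^sup>1\<close> are extremal.
\<close>

lemma extremal_weights:
  fixes p q D :: real and Y P :: "nat \<Rightarrow> real"
  assumes q: "0 < q" "q < 1" "1 < p" and D: "0 \<le> D"
    and Y: "\<And>n. 0 \<le> Y n" and P: "\<And>n. 0 \<le> P n"
    and ineq: "\<And>b. (\<And>n. 0 \<le> b n) \<Longrightarrow>
        (\<Sum>n<N. b n powr q * (Y n * P n powr q)) \<le> D * (\<Sum>n<N. b n powr p * P n) powr (q / p)"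
  shows "(\<Sum>n<N. Y n powr (p / (p - q)) * P n powr (q * (p - 1) / (p - q))) \<le> D powr (p / (p - q))"
proof -
  define b where "b n = Y n powr (1 / (p - q)) * P n powr ((q - 1) / (p - q))" for n
  define H where "H = (\<Sum>n<N. Y n powr (p / (p - q)) * P n powr (q * (p - 1) / (p - q)))"
  have pq: "0 < p - q" using q by simp
  have b1: "b n powr q * (Y n * P n powr q) = Y n powr (p / (p - q)) * P n powr (q * (p - 1) / (p - q))" for n
  proof (cases "Y n = 0 \<or> P n = 0")
    case False
    then have pos: "0 < Y n" "0 < P n" using Y[of n] P[of n] by auto
    have e1: "q / (p - q) + 1 = p / (p - q)" using pq by (simp add: field_simps)
    have e2: "(q - 1) * q / (p - q) + q = q * (p - 1) / (p - q)" using pq by (simp add: field_simps)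
    have "b n powr q * (Y n * P n powr q) =
       (Y n powr (q / (p - q)) * Y n powr 1) * (P n powr ((q - 1) * q / (p - q)) * P n powr q)"
      using pos by (simp add: b_def powr_mult powr_powr)
    then show ?thesis by (simp only: powr_add[symmetric] e1 e2)
  qed (use q pq in auto)
  have b2: "b n powr p * P n = Y n powr (p / (p - q)) * P n powr (q * (p - 1) / (p - q))" for n
  proof (cases "Y n = 0 \<or> P n = 0")
    case False
    then have pos: "0 < Y n" "0 < P n" using Y[of n] P[of n] by auto
    have e2: "(q - 1) * p / (p - q) + 1 = q * (p - 1) / (p - q)" using pq by (simp add: field_simps)
    have "b n powr p * P n =
       Y n powr (p / (p - q)) * (P n powr ((q - 1) * p / (p - q)) * P n powr 1)"
      using pos by (simp add: b_def powr_mult powr_powr)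
    then show ?thesis by (simp only: powr_add[symmetric] e2)
  qed (use q pq in \<open>auto simp: b_def\<close>)
  \<comment> \<open>For the chosen weights both sums in the hypothesis collapse to the same
    \<open>H\<close>; dividing by its power q/p leaves the claim.\<close>
  have "H \<le> D * H powr (q / p)"
    using ineq[of b] unfolding b1 b2 H_def by (auto simp: b_def)
  moreover have "0 \<le> H" unfolding H_def by (intro sum_nonneg) auto
  ultimately have "H powr (1 - q / p) \<le> D" if "H \<noteq> 0"
    using that by (simp add: powr_diff divide_le_eq)
  then have "(H powr (1 - q / p)) powr (p / (p - q)) \<le> D powr (p / (p - q))" if "H \<noteq> 0"
    using that pq q by (intro powr_mono2) auto
  moreover have "(1 - q / p) * (p / (p - q)) = 1" using q pq by (simp add: field_simps)
  ultimately have "H \<le> D powr (p / (p - q))"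
    using \<open>0 \<le> H\<close> by (cases "H = 0") (auto simp: powr_powr)
  then show ?thesis unfolding H_def .
qed

subsection \<open>Integrals over subsets of the line\<close>

lemma borel_measurable_imp_lebesgue:
  fixes f :: "real \<Rightarrow> ennreal"
  assumes "f \<in> borel_measurable borel" shows "f \<in> borel_measurable lebesgue"
  using assms by (intro measurable_completion) simp

lemma antimono_lebesgue:
  fixes f :: "real \<Rightarrow> ennreal"
  assumes "\<And>x y. x \<le> y \<Longrightarrow> f y \<le> f x" shows "f \<in> borel_measurable lebesgue"
  using assms by (intro borel_measurable_imp_lebesgue antimono_measurable) (auto simp: antimono_def)

lemma mono_lebesgue:
  fixes f :: "real \<Rightarrow> ennreal"
  assumes "\<And>x y. x \<le> y \<Longrightarrow> f x \<le> f y" shows "f \<in> borel_measurable lebesgue"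
proof -
  have "(\<lambda>x. f (- x)) \<in> borel_measurable borel"
    using assms by (intro antimono_measurable) (auto simp: antimono_def)
  then have "(\<lambda>x. f (- (- x))) \<in> borel_measurable borel"
    by measurable
  then show ?thesis by (intro borel_measurable_imp_lebesgue) simp
qed

lemma interval_sets_lebesgue [measurable, simp]:
  fixes a b :: real
  shows "{a<..} \<in> sets lebesgue" "{a..} \<in> sets lebesgue" "{..a} \<in> sets lebesgue" "{..<a} \<in> sets lebesgue"
    "{a<..b} \<in> sets lebesgue" "{a<..<b} \<in> sets lebesgue" "{a..b} \<in> sets lebesgue" "{a..<b} \<in> sets lebesgue"
    "{a} \<in> sets lebesgue"
  by (auto intro!: sets_completionI_sets)

lemma set_nn_integral_mono2:
  assumes "A \<subseteq> B" "\<And>x. x \<in> A \<Longrightarrow> f x \<le> g x"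
  shows "(\<integral>\<^sup>+x\<in>A. f x \<partial>M) \<le> (\<integral>\<^sup>+x\<in>B. g x \<partial>M)"
  using assms by (intro nn_integral_mono) (auto simp: indicator_def)

lemma set_nn_integral_const:
  assumes "A \<in> sets M" shows "(\<integral>\<^sup>+x\<in>A. c \<partial>M) = c * emeasure M A"
  using assms by (simp add: nn_integral_cmult_indicator)

lemma set_nn_integral_cmult:
  assumes [measurable]: "A \<in> sets M" "f \<in> borel_measurable M"
  shows "(\<integral>\<^sup>+x\<in>A. (c * f x) \<partial>M) = c * (\<integral>\<^sup>+x\<in>A. f x \<partial>M)"
  by (simp add: nn_integral_cmult mult.assoc)

lemma set_nn_integral_multc:
  assumes [measurable]: "A \<in> sets M" "f \<in> borel_measurable M"
  shows "(\<integral>\<^sup>+x\<in>A. (f x * c) \<partial>M) = (\<integral>\<^sup>+x\<in>A. f x \<partial>M) * c"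
  using set_nn_integral_cmult[OF assms, of c] by (simp add: mult.commute)

lemma set_nn_integral_add:
  assumes [measurable]: "A \<in> sets M" "f \<in> borel_measurable M" "g \<in> borel_measurable M"
  shows "(\<integral>\<^sup>+x\<in>A. (f x + g x) \<partial>M) = (\<integral>\<^sup>+x\<in>A. f x \<partial>M) + (\<integral>\<^sup>+x\<in>A. g x \<partial>M)"
  by (simp add: nn_integral_add distrib_right)

lemma set_nn_integral_le_const:
  assumes "A \<in> sets M" "\<And>x. x \<in> A \<Longrightarrow> f x \<le> c"
  shows "(\<integral>\<^sup>+x\<in>A. f x \<partial>M) \<le> c * emeasure M A"
proof -
  have "(\<integral>\<^sup>+x\<in>A. f x \<partial>M) \<le> (\<integral>\<^sup>+x\<in>A. c \<partial>M)"
    by (rule set_nn_integral_mono2) (use assms in auto)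
  then show ?thesis using assms by (simp add: set_nn_integral_const)
qed

lemma set_nn_integral_ge_const:
  assumes "A \<in> sets M" "\<And>x. x \<in> A \<Longrightarrow> c \<le> f x"
  shows "c * emeasure M A \<le> (\<integral>\<^sup>+x\<in>A. f x \<partial>M)"
proof -
  have "(\<integral>\<^sup>+x\<in>A. c \<partial>M) \<le> (\<integral>\<^sup>+x\<in>A. f x \<partial>M)"
    by (rule set_nn_integral_mono2) (use assms in auto)
  then show ?thesis using assms by (simp add: set_nn_integral_const)
qed

lemma set_nn_integral_split:
  fixes f :: "real \<Rightarrow> ennreal"
  assumes [measurable_cong]: "sets M = sets lebesgue" and [measurable]: "f \<in> borel_measurable M" and "a \<le> b"
  shows "(\<integral>\<^sup>+x\<in>{a<..}. f x \<partial>M) = (\<integral>\<^sup>+x\<in>{a<..b}. f x \<partial>M) + (\<integral>\<^sup>+x\<in>{b<..}. f x \<partial>M)"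
proof -
  have "{a<..} = {a<..b} \<union> {b<..}" "{a<..b} \<inter> {b<..} = {}" using assms by auto
  then show ?thesis
    using nn_integral_disjoint_pair[of f M "{a<..b}" "{b<..}"] assms by auto
qed

lemma set_nn_integral_split_Ioc:
  fixes f :: "real \<Rightarrow> ennreal"
  assumes [measurable_cong]: "sets M = sets lebesgue" and [measurable]: "f \<in> borel_measurable M"
    and "a \<le> b" "b \<le> c"
  shows "(\<integral>\<^sup>+x\<in>{a<..c}. f x \<partial>M) = (\<integral>\<^sup>+x\<in>{a<..b}. f x \<partial>M) + (\<integral>\<^sup>+x\<in>{b<..c}. f x \<partial>M)"
proof -
  have "{a<..c} = {a<..b} \<union> {b<..c}" "{a<..b} \<inter> {b<..c} = {}" using assms by auto
  then show ?thesis
    using nn_integral_disjoint_pair[of f M "{a<..b}" "{b<..c}"] assms by auto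
qed

subsection \<open>The operator for a finite weight of bounded support\<close>

text \<open>
  The measure \<open>\<mu>\<close> stands for \<open>w(t) dt\<close>, where \<open>w\<close> vanishes outside \<open>(0,N]\<close>.
\<close>

locale hardy_core =
  fixes p q th N :: real and k :: "real \<Rightarrow> real \<Rightarrow> ennreal" and v :: "real \<Rightarrow> ennreal"
    and \<mu> :: "real measure"
  assumes q_pos: "0 < q" and q_less: "q < 1" and p_gr: "1 < p" and th_pos: "0 < th"
    and sets_mu [measurable_cong]: "sets \<mu> = sets lebesgue"
    and mu_atom: "\<And>x. emeasure \<mu> {x} = 0"
    and mu_neg: "emeasure \<mu> {..0} = 0"
    and mu_pos: "0 < emeasure \<mu> {0<..}"
    and mu_fin: "emeasure \<mu> {0<..} < top"
    and mu_supp: "emeasure \<mu> {N<..} = 0"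
    and k_fin: "\<And>x y. k x y < top"
    and k_anti: "\<And>x x' y. x \<le> x' \<Longrightarrow> k x' y \<le> k x y"
    and k_mono: "\<And>x y y'. y \<le> y' \<Longrightarrow> k x y \<le> k x y'"
    and k_tri: "\<And>x y z. 0 \<le> x \<Longrightarrow> x < y \<Longrightarrow> y < z \<Longrightarrow> k x z \<le> ennreal th * (k x y + k y z)"
    and v_meas [measurable]: "v \<in> borel_measurable lebesgue"
begin

text \<open>
  The exponents are \<open>pc = p'\<close>, \<open>rq = r/q\<close>, \<open>rp = r/p\<close>, \<open>rpc = r/p'\<close>, and \<open>sg = v\<^sup>1\<^sup>-\<^sup>p\<^sup>'\<close>; the functions \<open>om\<close> and \<open>Ph\<close>
  are \<open>\<omega>\<close> and \<open>\<Phi>\<close> of the introduction.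
\<close>

definition "pc = p / (p - 1)"
definition "rq = p / (p - q)"
definition "rp = q / (p - q)"
definition "rpc = q * (p - 1) / (p - q)"
definition "W t = emeasure \<mu> {t<..}"
definition "om t = (\<integral>\<^sup>+x\<in>{t<..}. epow (k t x) q \<partial>\<mu>)"
definition "sg x = epow (v x) (1 - pc)"
definition "V z = (\<integral>\<^sup>+s\<in>{0<..z}. sg s \<partial>lebesgue)"
definition "Ph t = (\<integral>\<^sup>+z\<in>{0<..t}. (epow (k z t) pc * sg z) \<partial>lebesgue)"
definition "S t = (SUP z\<in>{0<..t}. epow (k z t) q * epow (V z) rpc)"
definition "A1 = (\<integral>\<^sup>+t. epow (W t) rp * epow (Ph t) rpc \<partial>\<mu>)"
definition "A2 = (\<integral>\<^sup>+t. epow (om t) rp * S t \<partial>\<mu>)"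
definition "Tf f t = (\<integral>\<^sup>+x\<in>{0<..t}. (f x * k x t) \<partial>lebesgue)"
definition "TH = th powr q"
text \<open>\<open>2 * TH \<le> a\<close> allows a remainder \<open>TH * om y\<close> to be absorbed
  once \<open>om\<close> has dropped by the factor \<open>a\<close>; \<open>2 \<le> a\<close> merges
  the resulting factors, as in \<open>4 + a \<le> 3 * a\<close>.\<close>

definition "a = 2 + 2 * TH"
text \<open>\<open>3 * a\<close> is the constant of \<open>om_bound\<close>; the outer 3 comes from
  passing to the largest of three summands before raising to the power \<open>rq\<close>.\<close>

definition "Kq = epow (3 * ennreal (3 * a)) rq"
text \<open>Sum of the geometric series with ratio (1/2)^q.\<close>

definition "L = ennreal (1 / (1 - (1 / 2) powr q))"
definition "K1 = 2 + L * ennreal a + epow (ennreal (1 + th)) q"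
definition "TM = epow (ennreal (1 + th)) q"
definition "K5 = 2 * epow (ennreal a) rp * epow 2 rq"
definition "K6 = TM * (epow 2 rq + 1) + 2 * epow (ennreal a) rq"

lemma exponents: "0 < pc" "1 < pc" "0 < rq" "1 < rq" "0 < rp" "0 < rpc" "0 < p" "0 < p - q"
  using q_pos q_less p_gr by (auto simp: pc_def rq_def rp_def rpc_def field_simps)

text \<open>The homogeneity that lets a q-th power of the kernel raised to \<open>rq\<close> be read
  as its p'-th power raised to \<open>rpc\<close>; \<open>kernel_weight_le\<close> rests on
  it.\<close>

lemma pc_rpc: "pc * rpc = q * rq"
  using q_pos q_less p_gr by (simp add: pc_def rq_def rpc_def)

lemma rq_eq: "rq = 1 + rp" and pc_eq: "1 / p + 1 / pc = 1"
  and rq_inv: "q / p + 1 / rq = 1" and rpc_eq: "rpc * (1 / rq) = q / pc"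
  using q_pos q_less p_gr by (simp_all add: pc_def rq_def rp_def rpc_def field_simps)

lemma TH_pos: "0 < TH" and a_pos: "0 < a" and a_ge: "2 \<le> a" "2 * TH \<le> a"
  using th_pos by (auto simp: TH_def a_def intro!: add_pos_nonneg)

lemma k_meas [measurable]: "(\<lambda>x. k x t) \<in> borel_measurable lebesgue" "k t \<in> borel_measurable lebesgue"
  using k_anti k_mono by (auto intro: antimono_lebesgue mono_lebesgue)

lemma sets_mu_simp [simp]: "sets \<mu> = sets lebesgue" by (rule sets_mu)

lemma borel_measurable_mu [simp]: "borel_measurable \<mu> = borel_measurable lebesgue"
  by (rule measurable_cong_sets) (simp_all add: sets_mu)

lemma W_anti: "x \<le> y \<Longrightarrow> W y \<le> W x"
  unfolding W_def by (intro emeasure_mono) auto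

lemma W_fin: "W x < top"
proof -
  have "W x \<le> emeasure \<mu> ({..0} \<union> {0<..})"
    unfolding W_def by (intro emeasure_mono) auto
  also have "\<dots> \<le> emeasure \<mu> {..0} + emeasure \<mu> {0<..}"
    by (rule emeasure_subadditive) auto
  finally show ?thesis using mu_neg mu_fin by (simp add: le_less_trans)
qed

lemma W_N: "N \<le> t \<Longrightarrow> W t = 0"
  using W_anti[of N t] mu_supp by (simp add: W_def)

lemma om_anti: "x \<le> y \<Longrightarrow> om y \<le> om x"
  unfolding om_def using q_pos by (intro set_nn_integral_mono2 epow_mono k_anti) auto

text \<open>Almost every point for \<mu> lies at or below \<open>N\<close>, where the kernel is at
  most \<open>k 0 N\<close>. This yields finiteness of \<open>om\<close> and, in
  \<open>next_point\<close>, keeps \<open>W\<close> away from 0.\<close>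

lemma om_le_W: "0 \<le> t \<Longrightarrow> om t \<le> epow (k 0 N) q * W t"
proof -
  assume t: "0 \<le> t"
  have "AE x in \<mu>. x \<notin> {N<..}"
    using mu_supp by (intro AE_not_in) (auto simp: null_sets_def)
  then have "AE x in \<mu>. epow (k t x) q * indicator {t<..} x \<le> epow (k 0 N) q * indicator {t<..} x"
  proof eventually_elim
    case (elim x)
    then have "k t x \<le> k 0 N" using k_anti[OF t, of x] k_mono[of x N 0] by auto
    then show ?case using q_pos by (auto simp: indicator_def intro: epow_mono)
  qed
  then have "om t \<le> (\<integral>\<^sup>+x\<in>{t<..}. epow (k 0 N) q \<partial>\<mu>)"
    unfolding om_def by (rule nn_integral_mono_AE)
  then show ?thesis by (simp add: set_nn_integral_const W_def)
qed

lemma om_fin: "0 \<le> t \<Longrightarrow> om t < top"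
  using om_le_W[of t] k_fin[of 0 N] W_fin[of t] q_pos
  by (simp add: le_less_trans ennreal_mult_less_top epow_less_top)

lemma W_meas [measurable]: "W \<in> borel_measurable lebesgue"
  by (intro antimono_lebesgue W_anti)

lemma om_meas [measurable]: "om \<in> borel_measurable lebesgue"
  by (intro antimono_lebesgue om_anti)

lemma V_mono: "x \<le> y \<Longrightarrow> V x \<le> V y"
  unfolding V_def by (intro set_nn_integral_mono2) auto

lemma Ph_mono: "x \<le> y \<Longrightarrow> Ph x \<le> Ph y"
  unfolding Ph_def using exponents
  by (intro set_nn_integral_mono2 mult_right_mono epow_mono k_mono) auto

lemma S_mono: "x \<le> y \<Longrightarrow> S x \<le> S y"
  unfolding S_def using q_pos by (intro SUP_mono) (fastforce intro!: mult_right_mono epow_mono k_mono)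

lemma Tf_mono: "x \<le> y \<Longrightarrow> Tf f x \<le> Tf f y"
  unfolding Tf_def by (intro set_nn_integral_mono2 mult_left_mono k_mono) auto

lemma V_meas [measurable]: "V \<in> borel_measurable lebesgue"
  by (intro mono_lebesgue V_mono)

lemma Ph_meas [measurable]: "Ph \<in> borel_measurable lebesgue"
  by (intro mono_lebesgue Ph_mono)

lemma S_meas [measurable]: "S \<in> borel_measurable lebesgue"
  by (intro mono_lebesgue S_mono)

lemma Tf_meas [measurable]: "Tf f \<in> borel_measurable lebesgue"
  by (intro mono_lebesgue Tf_mono)

lemma sg_meas [measurable]: "sg \<in> borel_measurable lebesgue"
  unfolding sg_def by measurable

lemma V_le_Ph: "z \<le> t \<Longrightarrow> epow (k z t) pc * V z \<le> Ph t"
proof -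
  assume "z \<le> t"
  have "epow (k z t) pc * V z = (\<integral>\<^sup>+s\<in>{0<..z}. (epow (k z t) pc * sg s) \<partial>lebesgue)"
    unfolding V_def by (simp add: set_nn_integral_cmult)
  also have "\<dots> \<le> Ph t"
    unfolding Ph_def using exponents \<open>z \<le> t\<close>
    by (intro set_nn_integral_mono2 mult_right_mono epow_mono k_anti) auto
  finally show ?thesis .
qed

text \<open>\<open>W\<close> is continuous because \<mu> is finite on tails and has no atoms. The
  level is attained at the supremum \<open>s\<close> of the points with \<open>c \<le> W t\<close>:
  tails shrinking to the closed half-line at \<open>s\<close> give \<open>c \<le> W s\<close>, tails
  growing to the open one give the converse.\<close>

lemma W_IVT:
  assumes "0 < c" "c \<le> W b"
  obtains t where "b \<le> t" "W t = c"
proof -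
  define B where "B = {t. b \<le> t \<and> c \<le> W t}"
  define s where "s = Sup B"
  have bB: "b \<in> B" using assms by (simp add: B_def)
  have "t \<le> N" if "t \<in> B" for t
    using that W_N[of t] assms by (cases "t \<le> N") (auto simp: B_def)
  then have bdd: "bdd_above B" by (auto simp: bdd_above_def)
  have bs: "b \<le> s" unfolding s_def by (rule cSup_upper[OF bB bdd])
  have "c \<le> emeasure \<mu> {s - 1 / (real n + 1)<..}" for n
  proof -
    have "\<exists>t\<in>B. s - 1 / (real n + 1) < t"
      unfolding s_def by (rule less_cSupD) (use bB in auto)
    then obtain x where "x \<in> B" "s - 1 / (real n + 1) < x" by blast
    then show ?thesis
      using W_anti[of "s - 1 / (real n + 1)" x] by (auto simp: B_def W_def)
  qed
  then have "c \<le> (INF n. emeasure \<mu> {s - 1 / (real n + 1)<..})"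
    by (rule INF_greatest)
  also have "\<dots> = emeasure \<mu> (\<Inter>n. {s - 1 / (real n + 1)<..})"
  proof (rule INF_emeasure_decseq)
    show "decseq (\<lambda>n. {s - 1 / (real n + 1)<..})"
      by (auto simp: decseq_def frac_le elim!: le_less_trans[rotated])
    show "emeasure \<mu> {s - 1 / (real n + 1)<..} \<noteq> \<infinity>" for n
      using W_fin unfolding W_def by (simp add: less_top)
  qed auto
  also have "(\<Inter>n. {s - 1 / (real n + 1)<..}) = {s..}"
  proof (intro antisym subsetI)
    fix x assume x: "x \<in> (\<Inter>n. {s - 1 / (real n + 1)<..})"
    show "x \<in> {s..}"
    proof (rule ccontr)
      assume "x \<notin> {s..}"
      then have "0 < s - x" by simp
      then obtain n where "inverse (real (Suc n)) < s - x" using reals_Archimedean by blast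
      then have "s - 1 / (real n + 1) > x" by (simp add: inverse_eq_divide add.commute algebra_simps)
      then show False using x by (auto dest!: spec[of _ n])
    qed
  next
    fix x assume "x \<in> {s..}"
    then have "s - 1 / (real n + 1) < x" for n by (intro less_le_trans[of _ s x]) auto
    then show "x \<in> (\<Inter>n. {s - 1 / (real n + 1)<..})" by simp
  qed
  also have "{s..} = {s} \<union> {s<..}" by auto
  also have "emeasure \<mu> ({s} \<union> {s<..}) \<le> emeasure \<mu> {s} + emeasure \<mu> {s<..}"
    by (rule emeasure_subadditive) auto
  finally have ge: "c \<le> W s" using mu_atom by (simp add: W_def)
  have "W s = emeasure \<mu> (\<Union>n. {s + 1 / (real n + 1)<..})"
  proof -
    have "(\<Union>n. {s + 1 / (real n + 1)<..}) = {s<..}"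
    proof (intro antisym subsetI)
      fix x assume "x \<in> {s<..}"
      then have "0 < x - s" by simp
      then obtain n where "inverse (real (Suc n)) < x - s" using reals_Archimedean by blast
      then have "s + 1 / (real n + 1) < x" by (simp add: inverse_eq_divide add.commute algebra_simps)
      then show "x \<in> (\<Union>n. {s + 1 / (real n + 1)<..})" by auto
    next
      fix x assume "x \<in> (\<Union>n. {s + 1 / (real n + 1)<..})"
      then obtain n where "s + 1 / (real n + 1) < x" by auto
      moreover have "s < s + 1 / (real n + 1)" by simp
      ultimately show "x \<in> {s<..}" unfolding greaterThan_iff by (rule less_trans[rotated])
    qed
    then show ?thesis by (simp add: W_def)
  qed
  also have "\<dots> = (SUP n. emeasure \<mu> {s + 1 / (real n + 1)<..})"
    by (rule SUP_emeasure_incseq[symmetric]) (auto simp: incseq_def frac_le intro: le_less_trans)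
  also have "\<dots> \<le> c"
  proof (rule SUP_least)
    fix n
    have "s < s + 1 / (real n + 1)" by simp
    then have "s + 1 / (real n + 1) \<notin> B"
      using cSup_upper[OF _ bdd] unfolding s_def[symmetric] by force
    then show "emeasure \<mu> {s + 1 / (real n + 1)<..} \<le> c"
      using bs \<open>s < _\<close> unfolding B_def W_def by auto
  qed
  finally show thesis using ge bs that[of s] by auto
qed

text \<open>For t beyond y the kernel is split at y. The three terms are the local part, the tail of
  the weight seen through \<open>k x y\<close>, and a remainder meant to be absorbed.\<close>

lemma om_step:
  assumes "0 \<le> x" "x < y"
  shows "om x \<le> (\<integral>\<^sup>+t\<in>{x<..y}. epow (k x t) q \<partial>\<mu>) + ennreal TH * (epow (k x y) q * W y + om y)"
proof -
  have "om x = (\<integral>\<^sup>+t\<in>{x<..y}. epow (k x t) q \<partial>\<mu>) + (\<integral>\<^sup>+t\<in>{y<..}. epow (k x t) q \<partial>\<mu>)"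
    unfolding om_def using assms sets_mu by (intro set_nn_integral_split) auto
  also have "(\<integral>\<^sup>+t\<in>{y<..}. epow (k x t) q \<partial>\<mu>)
      \<le> (\<integral>\<^sup>+t\<in>{y<..}. (ennreal TH * (epow (k x y) q + epow (k y t) q)) \<partial>\<mu>)"
  proof (intro set_nn_integral_mono2 order_refl)
    fix t assume "t \<in> {y<..}"
    then have "epow (k x t) q \<le> epow (ennreal th * (k x y + k y t)) q"
      using assms q_pos by (intro epow_mono k_tri) auto
    also have "\<dots> = ennreal TH * epow (k x y + k y t) q"
      using q_pos th_pos by (simp add: epow_mult epow_ennreal TH_def)
    also have "\<dots> \<le> ennreal TH * (epow (k x y) q + epow (k y t) q)"
      using q_pos q_less by (intro mult_left_mono epow_subadd) auto
    finally show "epow (k x t) q \<le> ennreal TH * (epow (k x y) q + epow (k y t) q)" .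
  qed
  also have "\<dots> = ennreal TH * (epow (k x y) q * W y + om y)"
    unfolding om_def W_def by (simp add: set_nn_integral_cmult set_nn_integral_add set_nn_integral_const)
  finally show ?thesis by (simp add: add_left_mono)
qed

lemma om_init:
  assumes "x \<le> y"
  shows "(\<integral>\<^sup>+t\<in>{x<..y}. epow (k x t) q \<partial>\<mu>) \<le> epow (k x y) q * W x"
proof -
  have "(\<integral>\<^sup>+t\<in>{x<..y}. epow (k x t) q \<partial>\<mu>) \<le> epow (k x y) q * emeasure \<mu> {x<..y}"
    using q_pos by (intro set_nn_integral_le_const epow_mono k_mono) auto
  also have "\<dots> \<le> epow (k x y) q * W x"
    unfolding W_def by (intro mult_left_mono emeasure_mono) auto
  finally show ?thesis .
qed

text \<open>
  If halving \<open>W\<close> does not make \<open>om\<close> drop by the factor \<open>a\<close>, the next point is chosen just before such a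
  drop. As \<open>om\<close> need not be continuous, the drop is guaranteed only where \<open>W\<close> has been halved once more.
\<close>

lemma next_point:
  assumes t: "0 \<le> t" "0 < W t"
  shows "\<exists>t'>t. 0 < W t' \<and> 2 * W t' \<le> W t \<and>
    (W t = 2 * W t' \<and> ennreal a * om t' \<le> om t \<or>
     om t \<le> ennreal a * om t' \<and> (\<forall>y. 2 * W y \<le> W t' \<longrightarrow> ennreal a * om y \<le> om t))"
proof -
  have half: "0 < W x / 2 \<and> W x / 2 < W x \<and> 2 * (W x / 2) = W x" if "0 < W x" for x
    using that W_fin[of x] by (cases "W x") (auto simp: divide_ennreal ennreal_mult[symmetric] ennreal_less_iff
        simp flip: ennreal_numeral)
  obtain t1 where t1: "t \<le> t1" "W t1 = W t / 2"
    using W_IVT[OF _ less_imp_le, of "W t / 2" t] half[OF t(2)] by blast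
  have t1': "t < t1" "0 < W t1" "W t = 2 * W t1"
    using t1 half[OF t(2)] by (auto simp: le_less)
  show ?thesis
  proof (cases "ennreal a * om t1 \<le> om t")
    case True
    then show ?thesis using t1' by (intro exI[of _ t1]) auto
  next
    case False
    define Y where "Y = {y. t1 \<le> y \<and> om t < ennreal a * om y}"
    have t1Y: "t1 \<in> Y" using False by (simp add: Y_def)
    \<comment> \<open>On \<open>Y\<close> the positive number \<open>om t\<close> is below a fixed
      multiple of \<open>W\<close>, so \<open>m > 0\<close> and some \<open>y \<in> Y\<close> has
      \<open>W y < 2 * m\<close>. A point where \<open>W\<close> is at most half of
      \<open>W y\<close> then lies below \<open>m\<close>, hence outside \<open>Y\<close>: there
      \<open>om\<close> has dropped.\<close>
    define m where "m = (INF y\<in>Y. W y)"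
    have m_le: "m \<le> W y" if "y \<in> Y" for y using that unfolding m_def by (rule INF_lower)
    have m_fin: "m < top" using m_le[OF t1Y] W_fin[of t1] by (rule le_less_trans)
    define c where "c = ennreal a * epow (k 0 N) q"
    have c_fin: "c < top" unfolding c_def using k_fin q_pos by (simp add: ennreal_mult_less_top epow_less_top)
    have om_lt: "om t < c * W y" if "y \<in> Y" for y
    proof -
      have "om t < ennreal a * om y" using that by (simp add: Y_def)
      also have "\<dots> \<le> ennreal a * (epow (k 0 N) q * W y)"
        using that t t1' by (intro mult_left_mono om_le_W) (auto simp: Y_def)
      finally show ?thesis by (simp add: c_def mult.assoc)
    qed
    have om_pos: "0 < om t"
    proof (rule ccontr)
      assume "\<not> 0 < om t"
      then have "om t1 = 0" using om_anti[of t t1] t1' by simp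
      then show False using False by simp
    qed
    have "0 < m"
    proof (rule ccontr)
      assume "\<not> 0 < m"
      then have "m = 0" by simp
      have "0 < c" using om_lt[OF t1Y] by (cases "c = 0") (auto simp: zero_less_iff_neq_zero)
      then have "om t / c \<le> W y" if "y \<in> Y" for y
        using om_lt[OF that] by (intro divide_le_posI_ennreal) (auto simp: mult.commute)
      then have "om t / c \<le> m" unfolding m_def by (rule INF_greatest)
      then show False using \<open>m = 0\<close> om_pos c_fin by auto
    qed
    then have "m < 2 * m" using m_fin
      by (cases m) (auto simp: ennreal_mult[symmetric] ennreal_less_iff simp flip: ennreal_numeral)
    then obtain y where y: "y \<in> Y" "W y < 2 * m" unfolding m_def by (metis INF_less_iff)
    have "0 < W y" using m_le[OF y(1)] \<open>0 < m\<close> by (rule less_le_trans[rotated])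
    have "ennreal a * om y' \<le> om t" if y': "2 * W y' \<le> W y" for y'
    proof (rule ccontr)
      assume neg: "\<not> ennreal a * om y' \<le> om t"
      have "W y < 2 * W y"
        using half[OF \<open>0 < W y\<close>] \<open>0 < W y\<close> W_fin[of y]
        by (cases "W y") (auto simp: ennreal_mult[symmetric] ennreal_less_iff simp flip: ennreal_numeral)
      then have "W y' < W y"
        using y' mult_left_mono[of "W y" "W y'" 2] by (meson leD le_less_linear order_trans zero_le)
      then have "y \<le> y'" using W_anti[of y' y] by (meson leD le_cases)
      then have "y' \<in> Y" using neg y by (auto simp: Y_def)
      then have "2 * m \<le> 2 * W y'" by (intro mult_left_mono m_le) auto
      also have "\<dots> \<le> W y" by (rule y')
      finally show False using y(2) by simp
    qed
    moreover have "t < y" "om t \<le> ennreal a * om y" using y t1' by (auto simp: Y_def)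
    moreover have "2 * W y \<le> W t"
      using y t1' W_anti[of t1 y] by (auto simp: Y_def intro: mult_left_mono)
    ultimately show ?thesis using \<open>0 < W y\<close> by (intro exI[of _ y]) auto
  qed
qed

end

context hardy_core begin

subsection \<open>Lower bounds from test functions\<close>

text \<open>The inequality raised to the power q: \<open>D\<close> stands for C^q.\<close>

definition hardy_bound :: "real \<Rightarrow> bool" where
  "hardy_bound D \<longleftrightarrow> 0 \<le> D \<and> (\<forall>f\<in>borel_measurable lebesgue.
     (\<integral>\<^sup>+t. epow (Tf f t) q \<partial>\<mu>) \<le> ennreal D * epow (\<integral>\<^sup>+x\<in>{0<..}. (epow (f x) p * v x) \<partial>lebesgue) (q / p))"

text \<open>Equality holds where 0 < v < \<infinity>, because (1 - p')(p - 1) = -1. At v = 0 and v =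
  \<infinity> the product is 0 by convention, hence only an inequality.\<close>

lemma sg_power: "epow (sg x) (p - 1) * v x \<le> 1"
proof -
  have e: "(1 - pc) * (p - 1) = -1" and n: "1 - pc < 0"
    using p_gr by (auto simp: pc_def field_simps)
  show ?thesis
  proof (cases "v x")
    case (real y)
    show ?thesis
    proof (cases "y = 0")
      case False
      then have "sg x = ennreal (y powr (1 - pc))"
        using real n by (auto simp: sg_def epow_def ennreal_eq_0_iff)
      then have "epow (sg x) (p - 1) = ennreal (y powr -1)"
        using p_gr by (simp add: epow_ennreal powr_powr e)
      then show ?thesis using real False by (simp add: ennreal_mult[symmetric] powr_minus)
    qed (use real in simp)
  qed (use n p_gr in \<open>simp add: sg_def epow_def\<close>)
qed

lemma truncated_sg_power: "epow (min (sg x) c) p * v x \<le> min (sg x) c"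
proof -
  have "epow (min (sg x) c) p = min (sg x) c * epow (min (sg x) c) (p - 1)"
    using epow_add[of 1 "p - 1" "min (sg x) c"] p_gr by simp
  then have "epow (min (sg x) c) p * v x = min (sg x) c * (epow (min (sg x) c) (p - 1) * v x)"
    by (simp add: mult.assoc)
  also have "\<dots> \<le> min (sg x) c * (epow (sg x) (p - 1) * v x)"
    using p_gr by (intro mult_left_mono mult_right_mono epow_mono) auto
  also have "\<dots> \<le> min (sg x) c * 1"
    by (intro mult_left_mono sg_power) auto
  finally show ?thesis by simp
qed

text \<open>The \<open>g n\<close> are superposed in the l^p sense, so the weighted p-norm on the
  right is additive although supports overlap, while the superposition still dominates each
  \<open>b n * g n\<close>. The sets \<open>E n\<close> cover a point at most twice, which produces
  the 2 in \<open>2 * D\<close>.\<close>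

lemma test_functions:
  fixes M :: nat
  assumes hardy: "hardy_bound D"
    and [measurable]: "\<And>n. g n \<in> borel_measurable lebesgue" "\<And>n. E n \<in> sets lebesgue"
    and P: "\<And>n. 0 \<le> P n" "\<And>n. (\<integral>\<^sup>+x\<in>{0<..}. (epow (g n x) p * v x) \<partial>lebesgue) \<le> ennreal (P n)"
    and E: "\<And>t. (\<Sum>n<M. indicator (E n) t :: ennreal) \<le> 2"
    and Y: "\<And>n. 0 \<le> Y n" "\<And>n. ennreal (Y n * P n powr q) \<le> (\<integral>\<^sup>+t\<in>E n. epow (Tf (g n) t) q \<partial>\<mu>)"
  shows "(\<Sum>n<M. Y n powr rq * P n powr rpc) \<le> (2 * D) powr rq"
  unfolding rq_def rpc_def
proof (rule extremal_weights[where Y = Y and P = P, OF q_pos q_less p_gr _ Y(1) P(1)])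
  have D: "0 \<le> D" using hardy by (simp add: hardy_bound_def)
  then show "0 \<le> 2 * D" by simp
  fix b :: "nat \<Rightarrow> real" assume b: "\<And>n. 0 \<le> b n"
  define f where "f x = epow (\<Sum>n<M. epow (ennreal (b n) * g n x) p) (1 / p)" for x
  have [measurable]: "f \<in> borel_measurable lebesgue" unfolding f_def by measurable
  have f_ge: "ennreal (b n) * g n x \<le> f x" if "n < M" for n x
  proof -
    have "epow (ennreal (b n) * g n x) p \<le> (\<Sum>n<M. epow (ennreal (b n) * g n x) p)"
      using that by (intro member_le_sum) auto
    then show ?thesis using exponents unfolding f_def by (simp add: epow_le_swap)
  qed
  have f_int: "(\<integral>\<^sup>+x\<in>{0<..}. (epow (f x) p * v x) \<partial>lebesgue) \<le> ennreal (\<Sum>n<M. b n powr p * P n)"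
  proof -
    have "(\<integral>\<^sup>+x\<in>{0<..}. (epow (f x) p * v x) \<partial>lebesgue)
        = (\<integral>\<^sup>+x. (\<Sum>n<M. ennreal (b n powr p) * (epow (g n x) p * v x * indicator {0<..} x)) \<partial>lebesgue)"
      unfolding f_def using exponents b
      by (intro nn_integral_cong) (simp add: epow_epow epow_mult epow_ennreal sum_distrib_right mult.assoc)
    also have "\<dots> = (\<Sum>n<M. ennreal (b n powr p) * (\<integral>\<^sup>+x\<in>{0<..}. (epow (g n x) p * v x) \<partial>lebesgue))"
      by (simp add: nn_integral_sum nn_integral_cmult)
    also have "\<dots> \<le> (\<Sum>n<M. ennreal (b n powr p) * ennreal (P n))"
      by (intro sum_mono mult_left_mono P) auto
    also have "\<dots> = ennreal (\<Sum>n<M. b n powr p * P n)"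
      using P by (simp add: ennreal_mult[symmetric] sum_ennreal)
    finally show ?thesis .
  qed
  have "ennreal (\<Sum>n<M. b n powr q * (Y n * P n powr q)) = (\<Sum>n<M. ennreal (b n powr q) * ennreal (Y n * P n powr q))"
    using Y P by (simp add: ennreal_mult[symmetric] sum_ennreal)
  also have "\<dots> \<le> (\<Sum>n<M. ennreal (b n powr q) * (\<integral>\<^sup>+t\<in>E n. epow (Tf (g n) t) q \<partial>\<mu>))"
    by (intro sum_mono mult_left_mono Y) auto
  also have "\<dots> = (\<Sum>n<M. \<integral>\<^sup>+t\<in>E n. epow (ennreal (b n) * Tf (g n) t) q \<partial>\<mu>)"
    using b q_pos by (intro sum.cong refl) (simp add: epow_mult epow_ennreal set_nn_integral_cmult)
  also have "\<dots> \<le> (\<Sum>n<M. \<integral>\<^sup>+t\<in>E n. epow (Tf f t) q \<partial>\<mu>)"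
  proof (intro sum_mono set_nn_integral_mono2 epow_mono q_pos order_refl)
    fix n t assume "n \<in> {..<M}"
    have "ennreal (b n) * Tf (g n) t = (\<integral>\<^sup>+x\<in>{0<..t}. (ennreal (b n) * (g n x * k x t)) \<partial>lebesgue)"
      unfolding Tf_def by (simp add: set_nn_integral_cmult)
    also have "\<dots> \<le> Tf f t"
      unfolding Tf_def using f_ge[of n] \<open>n \<in> {..<M}\<close>
      by (intro set_nn_integral_mono2 order_refl) (simp add: mult.assoc[symmetric] mult_right_mono)
    finally show "ennreal (b n) * Tf (g n) t \<le> Tf f t" .
  qed
  also have "\<dots> = (\<integral>\<^sup>+t. epow (Tf f t) q * (\<Sum>n<M. indicator (E n) t) \<partial>\<mu>)"
    by (simp add: nn_integral_sum[symmetric] sum_distrib_left)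
  also have "\<dots> \<le> (\<integral>\<^sup>+t. epow (Tf f t) q * 2 \<partial>\<mu>)"
    by (intro nn_integral_mono mult_left_mono E) auto
  also have "\<dots> = 2 * (\<integral>\<^sup>+t. epow (Tf f t) q \<partial>\<mu>)"
    by (subst nn_integral_multc) (simp_all add: mult.commute)
  also have "\<dots> \<le> 2 * (ennreal D * epow (\<integral>\<^sup>+x\<in>{0<..}. (epow (f x) p * v x) \<partial>lebesgue) (q / p))"
    using hardy by (intro mult_left_mono) (auto simp: hardy_bound_def)
  also have "\<dots> \<le> 2 * (ennreal D * epow (ennreal (\<Sum>n<M. b n powr p * P n)) (q / p))"
    using q_pos p_gr by (intro mult_left_mono epow_mono f_int) auto
  also have "\<dots> = ennreal (2 * D * (\<Sum>n<M. b n powr p * P n) powr (q / p))"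
    using D q_pos p_gr P by (simp add: epow_ennreal sum_nonneg ennreal_mult[symmetric] mult.assoc flip: ennreal_numeral)
  finally show "(\<Sum>n<M. b n powr q * (Y n * P n powr q)) \<le> 2 * D * (\<Sum>n<M. b n powr p * P n) powr (q / p)"
    using D by (simp add: ennreal_le_iff)
qed

text \<open>
  The density \<open>sg\<close> may fail to be locally integrable; it is truncated at height \<open>K\<close>, and \<open>K \<rightarrow> \<infinity>\<close> at the end.
\<close>

lemma test_sum:
  fixes M :: nat
  assumes hardy: "hardy_bound D"
    and [measurable]: "\<And>n. \<kappa> n \<in> borel_measurable lebesgue" "\<And>n. \<rho> n \<in> borel_measurable lebesgue"
      "\<And>n. E n \<in> sets lebesgue"
    and \<kappa>: "\<And>n x. 0 < x \<Longrightarrow> \<kappa> n x \<le> B n" "\<And>n. B n < top"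
    and E: "\<And>t. (\<Sum>n<M. indicator (E n) t :: ennreal) \<le> 2"
    and \<rho>: "\<And>n x t. 0 < x \<Longrightarrow> x \<le> s n \<Longrightarrow> t \<in> E n \<Longrightarrow> s n \<le> t \<and> \<rho> n t * \<kappa> n x \<le> k x t"
    and Y_fin: "\<And>n. (\<integral>\<^sup>+t\<in>E n. epow (\<rho> n t) q \<partial>\<mu>) < top"
  shows "(\<Sum>n<M. epow (\<integral>\<^sup>+t\<in>E n. epow (\<rho> n t) q \<partial>\<mu>) rq *
           epow (\<integral>\<^sup>+x\<in>{0<..s n}. (epow (\<kappa> n x) pc * sg x) \<partial>lebesgue) rpc) \<le> ennreal ((2 * D) powr rq)"
proof -
  define Y where "Y n = (\<integral>\<^sup>+t\<in>E n. epow (\<rho> n t) q \<partial>\<mu>)" for n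
  define P where "P K n = (\<integral>\<^sup>+x\<in>{0<..s n}. (epow (\<kappa> n x) pc * min (sg x) (of_nat K)) \<partial>lebesgue)" for K n
  have P_fin: "P K n < top" for K n
  proof -
    have "P K n \<le> epow (B n) pc * of_nat K * emeasure lebesgue {0<..s n}"
      unfolding P_def
    proof (rule set_nn_integral_le_const)
      fix x assume "x \<in> {0<..s n}"
      then show "epow (\<kappa> n x) pc * min (sg x) (of_nat K) \<le> epow (B n) pc * of_nat K"
        using exponents \<kappa>(1)[of x n] by (intro mult_mono epow_mono) auto
    qed simp
    also have "emeasure lebesgue {0<..s n} = ennreal (max 0 (s n))"
      by (cases "0 \<le> s n") auto
    also have "epow (B n) pc * of_nat K * ennreal (max 0 (s n)) < top"
      using epow_less_top[OF exponents(1) \<kappa>(2)[of n]] of_nat_less_top[of K]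
      by (simp add: ennreal_mult_less_top)
    finally show ?thesis .
  qed
  have "(\<Sum>n<M. epow (Y n) rq * epow (P K n) rpc) \<le> ennreal ((2 * D) powr rq)" for K
  proof -
    define y where "y n = enn2real (Y n)" for n
    define r where "r n = enn2real (P K n)" for n
    have y: "Y n = ennreal (y n)" "0 \<le> y n" and r: "P K n = ennreal (r n)" "0 \<le> r n" for n
      using Y_fin P_fin by (auto simp: y_def r_def Y_def)
    \<comment> \<open>Hoelder's extremal for pairing with \<open>\<kappa> n\<close>, truncated at
      height \<open>K\<close>: since (p' - 1) p = p', its weighted p-norm to the power p and its
      pairing with \<open>\<kappa> n\<close> are both controlled by the same
      \<open>P K n\<close>.\<close>
    define g where "g n x = epow (\<kappa> n x) (pc - 1) * min (sg x) (of_nat K) * indicator {0<..s n} x" for n x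
    have [measurable]: "g n \<in> borel_measurable lebesgue" for n unfolding g_def by measurable
    have "(\<Sum>n<M. y n powr rq * r n powr rpc) \<le> (2 * D) powr rq"
    proof (rule test_functions[OF hardy, of g E])
      show "(\<integral>\<^sup>+x\<in>{0<..}. (epow (g n x) p * v x) \<partial>lebesgue) \<le> ennreal (r n)" for n
        unfolding r(1)[symmetric] P_def
      proof (intro nn_integral_mono)
        fix x
        have e: "(pc - 1) * p = pc" using p_gr by (simp add: pc_def field_simps)
        have "epow (\<kappa> n x) pc * (epow (min (sg x) (of_nat K)) p * v x)
            \<le> epow (\<kappa> n x) pc * min (sg x) (of_nat K)"
          by (intro mult_left_mono truncated_sg_power) auto
        then show "epow (g n x) p * v x * indicator {0<..} x
          \<le> epow (\<kappa> n x) pc * min (sg x) (of_nat K) * indicator {0<..s n} x"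
          using exponents by (simp add: g_def epow_mult epow_epow e indicator_def mult.assoc)
      qed
      show "ennreal (y n * r n powr q) \<le> (\<integral>\<^sup>+t\<in>E n. epow (Tf (g n) t) q \<partial>\<mu>)" for n
      proof -
        have "ennreal (y n * r n powr q) = (\<integral>\<^sup>+t\<in>E n. (epow (P K n) q * epow (\<rho> n t) q) \<partial>\<mu>)"
        proof -
          have "(\<integral>\<^sup>+t\<in>E n. (epow (P K n) q * epow (\<rho> n t) q) \<partial>\<mu>) = epow (P K n) q * Y n"
            unfolding Y_def by (rule set_nn_integral_cmult) simp_all
          then show ?thesis
            using y[of n] r[of n] q_pos by (simp add: ennreal_mult epow_ennreal mult.commute)
        qed
        also have "\<dots> \<le> (\<integral>\<^sup>+t\<in>E n. epow (Tf (g n) t) q \<partial>\<mu>)"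
        proof (intro set_nn_integral_mono2 order_refl)
          fix t assume t: "t \<in> E n"
          have "P K n * \<rho> n t = (\<integral>\<^sup>+x\<in>{0<..s n}. (epow (\<kappa> n x) pc * min (sg x) (of_nat K) * \<rho> n t) \<partial>lebesgue)"
            unfolding P_def by (simp add: set_nn_integral_multc)
          also have "\<dots> \<le> Tf (g n) t"
            unfolding Tf_def
          proof (intro nn_integral_mono)
            fix x
            have "epow (\<kappa> n x) pc = epow (\<kappa> n x) (pc - 1) * \<kappa> n x"
              using epow_add[of "pc - 1" 1 "\<kappa> n x"] exponents by simp
            moreover have "epow (\<kappa> n x) (pc - 1) * min (sg x) (of_nat K) * (\<rho> n t * \<kappa> n x)
                \<le> epow (\<kappa> n x) (pc - 1) * min (sg x) (of_nat K) * k x t" if "0 < x" "x \<le> s n"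
              using \<rho>[OF that t] by (intro mult_left_mono) auto
            ultimately show "epow (\<kappa> n x) pc * min (sg x) (of_nat K) * \<rho> n t * indicator {0<..s n} x
               \<le> g n x * k x t * indicator {0<..t} x"
              using \<rho>[of x n t] t by (auto simp: g_def indicator_def ac_simps)
          qed
          finally show "epow (P K n) q * epow (\<rho> n t) q \<le> epow (Tf (g n) t) q"
            using q_pos by (simp add: epow_mult[symmetric] epow_mono)
        qed
        finally show ?thesis .
      qed
    qed (use E y r in auto)
    then have "ennreal (\<Sum>n<M. y n powr rq * r n powr rpc) \<le> ennreal ((2 * D) powr rq)"
      by (rule ennreal_leI)
    then show ?thesis
      using y r exponents by (simp add: epow_ennreal ennreal_mult[symmetric] sum_ennreal)
  qed
  note K_bound = this
  have P_SUP: "(SUP K. P K n) = (\<integral>\<^sup>+x\<in>{0<..s n}. (epow (\<kappa> n x) pc * sg x) \<partial>lebesgue)" for n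
  proof -
    have "(SUP K. P K n) = (\<integral>\<^sup>+x. (SUP K. epow (\<kappa> n x) pc * min (sg x) (of_nat K) * indicator {0<..s n} x) \<partial>lebesgue)"
      unfolding P_def
      by (intro nn_integral_monotone_convergence_SUP[symmetric])
         (auto simp: incseq_def le_fun_def indicator_def intro!: mult_left_mono min.mono)
    also have "\<dots> = (\<integral>\<^sup>+x\<in>{0<..s n}. (epow (\<kappa> n x) pc * sg x) \<partial>lebesgue)"
    proof (intro nn_integral_cong)
      fix x
      have "(SUP K. min (sg x) (of_nat K)) = sg x"
        using inf_SUP[of "sg x" of_nat UNIV] by (simp add: inf_min ennreal_SUP_of_nat_eq_top)
      then show "(SUP K. epow (\<kappa> n x) pc * min (sg x) (of_nat K) * indicator {0<..s n} x)
          = epow (\<kappa> n x) pc * sg x * indicator {0<..s n} x"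
        by (simp add: SUP_mult_left_ennreal[symmetric] SUP_mult_right_ennreal[symmetric])
    qed
    finally show ?thesis .
  qed
  from K_bound have "(SUP K. \<Sum>n<M. epow (Y n) rq * epow (P K n) rpc) \<le> ennreal ((2 * D) powr rq)"
    by (rule SUP_least)
  also have "(SUP K. \<Sum>n<M. epow (Y n) rq * epow (P K n) rpc) = (\<Sum>n<M. SUP K. epow (Y n) rq * epow (P K n) rpc)"
  proof (rule ennreal_SUP_sum)
    show "incseq (\<lambda>K. epow (Y n) rq * epow (P K n) rpc)" for n
      unfolding P_def using exponents
      by (intro incseq_SucI mult_left_mono epow_mono set_nn_integral_mono2 min.mono) (auto simp: order.refl)
  qed
  also have "\<dots> = (\<Sum>n<M. epow (Y n) rq * epow (SUP K. P K n) rpc)"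
    using exponents by (simp add: SUP_mult_left_ennreal epow_SUP)
  finally show ?thesis unfolding Y_def P_SUP .
qed

end

subsection \<open>Sequences along which the tail of the weight is halved\<close>

locale halving = hardy_core +
  fixes \<tau> :: "nat \<Rightarrow> real"
  assumes tau_0: "\<tau> 0 = 0"
    and tau_less: "\<And>n. \<tau> n < \<tau> (Suc n)"
    and W_tau_pos: "\<And>n. 0 < W (\<tau> n)"
    and W_tau_half: "\<And>n. 2 * W (\<tau> (Suc n)) \<le> W (\<tau> n)"
begin

definition "q1 n = epow (W (\<tau> n)) rq * epow (Ph (\<tau> n)) rpc"
definition "q2 n = epow (om (\<tau> n)) rq * epow (V (\<tau> n)) rpc"

lemma tau_mono: "m \<le> n \<Longrightarrow> \<tau> m \<le> \<tau> n"
  using lift_Suc_mono_le[of \<tau>] tau_less by (simp add: less_imp_le)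

lemma tau_nonneg: "0 \<le> \<tau> n"
  using tau_mono[of 0 n] by (simp add: tau_0)

lemma tau_Ioc_unique: "t \<in> {\<tau> m<..\<tau> (Suc m)} \<Longrightarrow> t \<in> {\<tau> n<..\<tau> (Suc n)} \<Longrightarrow> m = n"
  using tau_mono[of "Suc m" n] tau_mono[of "Suc n" m] by (cases m n rule: linorder_cases) auto

lemma tau_disjoint: "disjoint_family (\<lambda>n. {\<tau> n<..\<tau> (Suc n)})"
  unfolding disjoint_family_on_def using tau_Ioc_unique by blast

lemma W_tau_le: "2 ^ n * W (\<tau> n) \<le> W 0"
proof (induction n)
  case (Suc n)
  have "2 ^ Suc n * W (\<tau> (Suc n)) = 2 ^ n * (2 * W (\<tau> (Suc n)))" by (simp add: ac_simps)
  also have "\<dots> \<le> 2 ^ n * W (\<tau> n)" by (intro mult_left_mono W_tau_half) auto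
  finally show ?case using Suc by simp
qed (simp add: tau_0)

text \<open>The points may accumulate at a finite limit; geometric decay of \<open>W\<close> along
  them leaves no mass beyond it, so the blocks exhaust \<mu>.\<close>

lemma tail_null: "emeasure \<mu> (\<Inter>n. {\<tau> n<..}) = 0"
proof (rule ccontr)
  define x where "x = emeasure \<mu> (\<Inter>n. {\<tau> n<..})"
  assume "emeasure \<mu> (\<Inter>n. {\<tau> n<..}) \<noteq> 0"
  then have "0 < x" by (simp add: x_def zero_less_iff_neq_zero)
  have x_le: "of_nat n * x \<le> W 0" for n
  proof -
    have "x \<le> W (\<tau> n)" unfolding x_def W_def by (intro emeasure_mono) auto
    moreover have "(of_nat n :: ennreal) \<le> 2 ^ n"
      using of_nat_mono[of n "2 ^ n", where 'a = ennreal] by (simp add: less_imp_le)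
    ultimately have "of_nat n * x \<le> 2 ^ n * W (\<tau> n)" by (intro mult_mono) auto
    then show ?thesis using W_tau_le[of n] by simp
  qed
  have "top * x \<le> W 0"
    unfolding ennreal_SUP_of_nat_eq_top[symmetric] SUP_mult_right_ennreal
    by (rule SUP_least) (rule x_le)
  then show False using \<open>0 < x\<close> W_fin[of 0] by (auto simp: ennreal_top_mult top_unique zero_less_iff_neq_zero)
qed

lemma AE_tau: "AE t in \<mu>. t \<in> (\<Union>n. {\<tau> n<..\<tau> (Suc n)})"
proof -
  have "AE t in \<mu>. t \<notin> {..0}" "AE t in \<mu>. t \<notin> (\<Inter>n. {\<tau> n<..})"
    using mu_neg tail_null by (intro AE_not_in; simp add: null_sets_def)+
  then show ?thesis
  proof eventually_elim
    case (elim t)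
    then obtain n where n: "t \<le> \<tau> n" by (auto simp: not_less)
    define m where "m = (LEAST n. t \<le> \<tau> n)"
    have m: "t \<le> \<tau> m" unfolding m_def using n by (rule LeastI)
    have "m \<noteq> 0" using m elim by (auto simp: tau_0 intro: ccontr)
    then obtain l where l: "m = Suc l" by (cases m) auto
    then have "\<not> t \<le> \<tau> l" using not_less_Least[of l "\<lambda>n. t \<le> \<tau> n"] unfolding m_def by simp
    then show ?case using m l by (auto intro!: exI[of _ l])
  qed
qed

lemma integral_partition:
  assumes [measurable]: "f \<in> borel_measurable lebesgue"
  shows "(\<integral>\<^sup>+t. f t \<partial>\<mu>) = (\<Sum>n. \<integral>\<^sup>+t\<in>{\<tau> n<..\<tau> (Suc n)}. f t \<partial>\<mu>)"
proof -
  have "(\<integral>\<^sup>+t. f t \<partial>\<mu>) = (\<integral>\<^sup>+t. (\<Sum>n. f t * indicator {\<tau> n<..\<tau> (Suc n)} t) \<partial>\<mu>)"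
    using AE_tau
  proof (intro nn_integral_cong_AE, eventually_elim)
    case (elim t)
    have "(\<Sum>n. indicator {\<tau> n<..\<tau> (Suc n)} t :: ennreal) = indicator (\<Union>n. {\<tau> n<..\<tau> (Suc n)}) t"
      by (rule suminf_indicator[OF tau_disjoint])
    then show ?case using elim by simp
  qed
  also have "\<dots> = (\<Sum>n. \<integral>\<^sup>+t\<in>{\<tau> n<..\<tau> (Suc n)}. f t \<partial>\<mu>)"
    by (rule nn_integral_suminf) simp
  finally show ?thesis .
qed

lemma integral_partition_double:
  assumes [measurable]: "f \<in> borel_measurable lebesgue"
  shows "(\<Sum>n. \<integral>\<^sup>+t\<in>{\<tau> n<..\<tau> (n + 2)}. f t \<partial>\<mu>) \<le> 2 * (\<integral>\<^sup>+t. f t \<partial>\<mu>)"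
proof -
  have "(\<Sum>n. \<integral>\<^sup>+t\<in>{\<tau> n<..\<tau> (n + 2)}. f t \<partial>\<mu>) =
     (\<Sum>n. (\<integral>\<^sup>+t\<in>{\<tau> n<..\<tau> (Suc n)}. f t \<partial>\<mu>) + (\<integral>\<^sup>+t\<in>{\<tau> (Suc n)<..\<tau> (Suc (Suc n))}. f t \<partial>\<mu>))"
    using tau_less by (intro suminf_cong) (simp add: set_nn_integral_split_Ioc[of _ _ _ "\<tau> (Suc _)"] less_imp_le)
  also have "\<dots> = (\<Sum>n. \<integral>\<^sup>+t\<in>{\<tau> n<..\<tau> (Suc n)}. f t \<partial>\<mu>)
     + (\<Sum>n. \<integral>\<^sup>+t\<in>{\<tau> (Suc n)<..\<tau> (Suc (Suc n))}. f t \<partial>\<mu>)"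
    by (rule suminf_add[symmetric]) auto
  also have "(\<Sum>n. \<integral>\<^sup>+t\<in>{\<tau> (Suc n)<..\<tau> (Suc (Suc n))}. f t \<partial>\<mu>)
     \<le> (\<Sum>n. \<integral>\<^sup>+t\<in>{\<tau> n<..\<tau> (Suc n)}. f t \<partial>\<mu>)"
    using suminf_offset[of "\<lambda>n. \<integral>\<^sup>+t\<in>{\<tau> n<..\<tau> (Suc n)}. f t \<partial>\<mu>" 1] by simp
  finally show ?thesis unfolding integral_partition[OF assms] by (simp add: mult_2 add_left_mono)
qed

lemma W_half_Ioc: "W (\<tau> n) \<le> 2 * emeasure \<mu> {\<tau> n<..\<tau> (Suc n)}"
proof -
  have "W (\<tau> n) = emeasure \<mu> {\<tau> n<..\<tau> (Suc n)} + W (\<tau> (Suc n))"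
    using set_nn_integral_split[OF sets_mu, of "\<lambda>_. 1" "\<tau> n" "\<tau> (Suc n)"] tau_less[of n]
    by (simp add: W_def)
  moreover have "2 * W (\<tau> (Suc n)) \<le> W (\<tau> n)" by (rule W_tau_half)
  moreover have "W (\<tau> n) < top" "W (\<tau> (Suc n)) < top" by (rule W_fin)+
  ultimately show ?thesis
    by (cases "emeasure \<mu> {\<tau> n<..\<tau> (Suc n)}"; cases "W (\<tau> (Suc n))")
       (auto simp: ennreal_mult[symmetric] ennreal_plus[symmetric] simp del: ennreal_plus simp flip: ennreal_numeral)
qed

text \<open>Up to the point \<open>t\<close> where \<open>W\<close> has halved, the block has mass
  \<open>W t\<close>, while \<open>W\<close> stays above \<open>W t\<close> and \<open>Ph\<close>
  above its initial value. The mass supplies the missing factor in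
  \<open>rq = 1 + rp\<close>.\<close>

lemma q1_le_A1: "(\<Sum>n. q1 n) \<le> epow 2 rq * A1"
proof -
  have "q1 n \<le> epow 2 rq * (\<integral>\<^sup>+t\<in>{\<tau> n<..\<tau> (Suc n)}. (epow (W t) rp * epow (Ph t) rpc) \<partial>\<mu>)" for n
  proof -
    have half: "0 < W (\<tau> n) / 2" "W (\<tau> n) / 2 \<le> W (\<tau> n)" "2 * (W (\<tau> n) / 2) = W (\<tau> n)"
      using W_tau_pos[of n] W_fin[of "\<tau> n"]
      by (cases "W (\<tau> n)"; auto simp: divide_ennreal ennreal_mult[symmetric] ennreal_less_iff intro!: ennreal_leI
        simp flip: ennreal_numeral)+
    obtain t' where t': "\<tau> n \<le> t'" "W t' = W (\<tau> n) / 2"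
      using W_IVT[OF half(1,2)] by blast
    \<comment> \<open>If \<open>t'\<close> lies beyond the block, \<open>W\<close> already has the
      value \<open>W t'\<close> at \<open>\<tau> (Suc n)\<close>, so the cut does not change
      it.\<close>
    define t where "t = min t' (\<tau> (Suc n))"
    have Wt: "W (\<tau> n) = 2 * W t" and t: "\<tau> n \<le> t" "t \<le> \<tau> (Suc n)"
    proof -
      show "\<tau> n \<le> t" "t \<le> \<tau> (Suc n)" using t' tau_less[of n] by (auto simp: t_def)
      have "2 * W t' \<le> 2 * W t" by (intro mult_left_mono W_anti) (auto simp: t_def)
      moreover have "2 * W t \<le> W (\<tau> n)"
        using t' half(3) W_tau_half[of n] by (auto simp: t_def min_def)
      ultimately show "W (\<tau> n) = 2 * W t" using t' half(3) by auto
    qed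
    have split: "W (\<tau> n) = emeasure \<mu> {\<tau> n<..t} + W t"
      using set_nn_integral_split[OF sets_mu, of "\<lambda>_. 1" "\<tau> n" t] t by (simp add: W_def)
    have em: "emeasure \<mu> {\<tau> n<..t} = W t"
      using split W_fin[of t] unfolding Wt by (auto simp: mult_2 add.commute)
    have "q1 n = epow 2 rq * (epow (W t) rp * epow (Ph (\<tau> n)) rpc * emeasure \<mu> {\<tau> n<..t})"
      using epow_add[of 1 rp "W t"] exponents
      unfolding q1_def Wt em by (simp add: epow_mult rq_eq ac_simps)
    also have "\<dots> \<le> epow 2 rq * (\<integral>\<^sup>+s\<in>{\<tau> n<..t}. (epow (W s) rp * epow (Ph s) rpc) \<partial>\<mu>)"
      using exponents
      by (intro mult_left_mono set_nn_integral_ge_const mult_mono epow_mono W_anti Ph_mono) auto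
    also have "\<dots> \<le> epow 2 rq * (\<integral>\<^sup>+s\<in>{\<tau> n<..\<tau> (Suc n)}. (epow (W s) rp * epow (Ph s) rpc) \<partial>\<mu>)"
      using t by (intro mult_left_mono set_nn_integral_mono2) auto
    finally show ?thesis .
  qed
  then have "(\<Sum>n. q1 n) \<le> (\<Sum>n. epow 2 rq * (\<integral>\<^sup>+t\<in>{\<tau> n<..\<tau> (Suc n)}. (epow (W t) rp * epow (Ph t) rpc) \<partial>\<mu>))"
    by (intro suminf_le) auto
  then show ?thesis unfolding A1_def by (subst integral_partition) auto
qed

text \<open>\<open>test_sum\<close> with \<kappa> the kernel frozen at second argument
  \<open>\<tau> n\<close> and \<rho> = 1: on the block after \<open>\<tau> n\<close> the kernel is
  at least this frozen one.\<close>

lemma q1_le_hardy: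
  assumes "hardy_bound D"
  shows "(\<Sum>n. q1 n) \<le> epow 2 rq * ennreal ((2 * D) powr rq)"
proof -
  have "(\<Sum>n<M. q1 n) \<le> epow 2 rq * ennreal ((2 * D) powr rq)" for M
  proof -
    have "(\<Sum>n<M. q1 n) \<le> (\<Sum>n<M. epow 2 rq * (epow (emeasure \<mu> {\<tau> n<..\<tau> (Suc n)}) rq * epow (Ph (\<tau> n)) rpc))"
    proof (intro sum_mono)
      fix n
      have "epow (W (\<tau> n)) rq \<le> epow (2 * emeasure \<mu> {\<tau> n<..\<tau> (Suc n)}) rq"
        using exponents by (intro epow_mono W_half_Ioc) auto
      then show "q1 n \<le> epow 2 rq * (epow (emeasure \<mu> {\<tau> n<..\<tau> (Suc n)}) rq * epow (Ph (\<tau> n)) rpc)"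
        using exponents unfolding q1_def by (simp add: epow_mult mult.assoc[symmetric] mult_right_mono)
    qed
    also have "\<dots> = epow 2 rq * (\<Sum>n<M. epow (emeasure \<mu> {\<tau> n<..\<tau> (Suc n)}) rq * epow (Ph (\<tau> n)) rpc)"
      by (simp add: sum_distrib_left)
    also have "(\<Sum>n<M. epow (emeasure \<mu> {\<tau> n<..\<tau> (Suc n)}) rq * epow (Ph (\<tau> n)) rpc) \<le> ennreal ((2 * D) powr rq)"
    proof -
      have "(\<Sum>n<M. indicator {\<tau> n<..\<tau> (Suc n)} t :: ennreal) \<le> 2" for t
      proof -
        have "(\<Sum>n<M. indicator {\<tau> n<..\<tau> (Suc n)} t :: ennreal) \<le> (\<Sum>n. indicator {\<tau> n<..\<tau> (Suc n)} t)"
          by (rule sum_le_suminf) auto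
        also have "\<dots> = indicator (\<Union>n. {\<tau> n<..\<tau> (Suc n)}) t"
          by (rule suminf_indicator[OF tau_disjoint])
        also have "\<dots> \<le> 2" by (auto simp: indicator_def)
        finally show ?thesis .
      qed
      moreover have "emeasure \<mu> {\<tau> n<..\<tau> (Suc n)} < top" for n
        using W_fin[of "\<tau> n"] unfolding W_def by (rule le_less_trans[rotated]) (auto intro!: emeasure_mono)
      ultimately show ?thesis
        using test_sum[OF assms, of "\<lambda>n x. k x (\<tau> n)" "\<lambda>n t. 1" "\<lambda>n. {\<tau> n<..\<tau> (Suc n)}" "\<lambda>n. k 0 (\<tau> n)" M \<tau>]
          by (simp add: Ph_def k_fin k_anti k_mono)
    qed
    finally show ?thesis by (simp add: mult_left_mono)
  qed
  then show ?thesis unfolding suminf_eq_SUP by (rule SUP_least)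
qed

end

subsection \<open>Dyadic level sets\<close>

lemma half_power_ennreal: "(1 / 2 :: ennreal) ^ i = ennreal ((1 / 2) ^ i)"
proof -
  have half: "(1 / 2 :: ennreal) = ennreal (1 / 2)"
    using divide_ennreal[of 1 2] by simp
  show ?thesis unfolding half by (rule ennreal_power) simp
qed

lemma half_powr_less_one:
  fixes q :: real
  assumes "0 < q" shows "(1 / 2) powr q < 1"
  using powr_less_mono2[of q "1 / 2" 1] assms by simp

lemma dyadic_level:
  fixes y h :: ennreal
  assumes "0 < y" "y \<le> h" "h < top"
  obtains i :: nat where "(1 / 2) ^ Suc i * h < y" "y \<le> (1 / 2) ^ i * h"
proof -
  obtain y' h' where r: "y = ennreal y'" "h = ennreal h'" "0 \<le> y'" "0 \<le> h'"
    using assms by (metis ennreal_cases le_less_trans less_irrefl)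
  have y': "0 < y'" "y' \<le> h'" using assms r by (auto simp: ennreal_less_zero_iff)
  have half: "(1 / 2 :: ennreal) ^ i * h = ennreal ((1 / 2) ^ i * h')" for i
    using r by (simp only: half_power_ennreal) (simp add: ennreal_mult)
  have "\<exists>i. (1 / 2 :: real) ^ i < y' / h'"
    using y' by (intro real_arch_pow_inv) auto
  then have ex: "\<exists>i. (1 / 2 :: real) ^ i * h' < y'"
    using y' by (auto simp: field_simps)
  define m where "m = (LEAST i. (1 / 2 :: real) ^ i * h' < y')"
  have m: "(1 / 2) ^ m * h' < y'" unfolding m_def using ex by (rule LeastI_ex)
  have "m \<noteq> 0" using m y' by (auto intro: ccontr)
  then obtain i where i: "m = Suc i" by (cases m) auto
  then have "\<not> (1 / 2) ^ i * h' < y'" using not_less_Least[of i "\<lambda>i. (1 / 2 :: real) ^ i * h' < y'"]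
    unfolding m_def by simp
  then have "y \<le> (1 / 2) ^ i * h" unfolding half r(1) by (intro ennreal_leI) simp
  moreover have "(1 / 2) ^ Suc i * h < y"
    unfolding half r(1) using m i y' by (intro ennreal_lessI) (auto simp del: power_Suc)
  ultimately show thesis by (rule that[rotated])
qed

lemma sum_dyadic: "(\<Sum>i. (1 / 2 :: ennreal) ^ i) = 2"
proof -
  have "(\<Sum>i. (1 / 2 :: ennreal) ^ i) = (\<Sum>i. ennreal ((1 / 2) ^ i))"
    by (simp only: half_power_ennreal)
  also have "\<dots> = ennreal (\<Sum>i. (1 / 2) ^ i)"
    by (intro suminf_ennreal2) (auto intro: summable_geometric)
  finally show ?thesis by (simp add: suminf_geometric)
qed

lemma sum_dyadic_powr:
  fixes q :: real
  assumes "0 < q"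
  shows "(\<Sum>i. epow ((1 / 2) ^ i) q) = ennreal (1 / (1 - (1 / 2) powr q))"
proof -
  have lt: "(1 / 2 :: real) powr q < 1" by (rule half_powr_less_one[OF assms])
  have "epow ((1 / 2) ^ i) q = ennreal (((1 / 2) powr q) ^ i)" for i
    using assms unfolding half_power_ennreal by (simp add: epow_ennreal powr_realpow[symmetric] powr_powr mult.commute)
  then have "(\<Sum>i. epow ((1 / 2) ^ i) q) = ennreal (\<Sum>i. ((1 / 2) powr q) ^ i)"
    using lt by (simp only:) (intro suminf_ennreal2, auto intro: summable_geometric)
  then show ?thesis using lt by (simp add: suminf_geometric)
qed

text \<open>\<open>F\<close> is nondecreasing, so the sublevel set is an initial piece of the
  interval. If it misses its supremum \<open>s\<close>, it is exhausted by the intervals up to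
  \<open>u n < s\<close>, on each of which the integral is at most \<open>c\<close>.\<close>

lemma integral_sublevel_le:
  fixes f :: "real \<Rightarrow> ennreal" and a b :: real
  assumes [measurable]: "f \<in> borel_measurable lebesgue"
  defines "F \<equiv> \<lambda>x. \<integral>\<^sup>+y\<in>{a<..x}. f y \<partial>lebesgue"
  shows "(\<integral>\<^sup>+x\<in>{x\<in>{a<..b}. F x \<le> c}. f x \<partial>lebesgue) \<le> c"
proof -
  define D where "D = {x\<in>{a<..b}. F x \<le> c}"
  have F_mono: "F x \<le> F y" if "x \<le> y" for x y
    unfolding F_def using that by (intro set_nn_integral_mono2) auto
  show ?thesis
  proof (cases "D = {}")
    case True
    then show ?thesis unfolding D_def[symmetric] by simp
  next
    case False
    have bdd: "bdd_above D" unfolding D_def by (intro bdd_aboveI[of _ b]) auto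
    define s where "s = Sup D"
    have as: "a < s"
      using False cSup_upper[OF _ bdd] unfolding s_def D_def by force
    show ?thesis
    proof (cases "s \<in> D")
      case True
      have "D \<subseteq> {a<..s}" using cSup_upper[OF _ bdd] by (auto simp: s_def D_def)
      then have "(\<integral>\<^sup>+x\<in>D. f x \<partial>lebesgue) \<le> F s" unfolding F_def by (intro set_nn_integral_mono2) auto
      also have "\<dots> \<le> c" using True by (simp add: D_def)
      finally show ?thesis unfolding D_def .
    next
      case False
      define u where "u n = s - (s - a) / (real n + 1)" for n
      have u: "u n < s" for n using as by (simp add: u_def)
      have u_mono: "u m \<le> u n" if "m \<le> n" for m n
        using that as unfolding u_def by (intro diff_left_mono divide_left_mono) auto
      have Fu: "F (u n) \<le> c" for n
      proof -
        obtain d where "d \<in> D" "u n < d"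
          using u[of n] \<open>D \<noteq> {}\<close> unfolding s_def by (meson less_cSupD)
        then show ?thesis using F_mono[of "u n" d] by (auto simp: D_def)
      qed
      have D_sub: "D \<subseteq> (\<Union>n. {a<..u n})"
      proof
        fix x assume x: "x \<in> D"
        then have "x < s" using False cSup_upper[OF x bdd] by (auto simp: s_def le_less)
        obtain n where n: "(s - a) / (s - x) < real n" using reals_Archimedean2 by blast
        then have "(s - a) / (real n + 1) < s - x"
          using \<open>x < s\<close> as by (simp add: field_simps)
        then have "x \<le> u n" by (simp add: u_def)
        then show "x \<in> (\<Union>n. {a<..u n})" using x by (auto simp: D_def)
      qed
      have "(\<integral>\<^sup>+x\<in>D. f x \<partial>lebesgue) \<le> (\<integral>\<^sup>+x. (SUP n. f x * indicator {a<..u n} x) \<partial>lebesgue)"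
      proof (intro nn_integral_mono)
        fix x
        show "f x * indicator D x \<le> (SUP n. f x * indicator {a<..u n} x)"
        proof (cases "x \<in> D")
          case True
          then obtain n where "x \<in> {a<..u n}" using D_sub by blast
          then show ?thesis by (intro SUP_upper2[of n]) (auto simp: indicator_def)
        qed simp
      qed
      also have "\<dots> = (SUP n. F (u n))"
        unfolding F_def
        by (intro nn_integral_monotone_convergence_SUP)
           (auto simp: incseq_def le_fun_def indicator_def dest: u_mono)
      also have "\<dots> \<le> c" by (intro SUP_least Fu)
      finally show ?thesis unfolding D_def .
    qed
  qed
qed

section \<open>Local estimates beyond a point \<open>b\<close> in terms of
  \<open>om b\<close>\<close>

context hardy_core begin

text \<open>Serves the degenerate case in which the bound is 0 times a possibly infinite factor,
  hence 0.\<close>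

lemma om_zero_AE:
  assumes "om b = 0" shows "AE t in \<mu>. b < t \<longrightarrow> k b t = 0"
proof -
  have "AE t in \<mu>. epow (k b t) q * indicator {b<..} t = 0"
    using assms unfolding om_def by (subst (asm) nn_integral_0_iff_AE) auto
  then show ?thesis using q_pos by (auto elim!: eventually_mono simp: indicator_def)
qed

text \<open>Each level contributes \<open>om\<close> at its left end, which is at most
  \<open>om b\<close>. The closed half-lines here differ from the open ones in \<open>om\<close> by
  a single point, null for \<mu>.\<close>

lemma level_integral:
  fixes c :: "nat \<Rightarrow> ennreal" and x :: "nat \<Rightarrow> real"
  assumes "\<And>i. b \<le> x i"
  shows "(\<integral>\<^sup>+t. (\<Sum>i. c i * (epow (k (x i) t) q * indicator {x i..} t)) \<partial>\<mu>) \<le> (\<Sum>i. c i) * om b"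
proof -
  have "(\<integral>\<^sup>+t. (\<Sum>i. c i * (epow (k (x i) t) q * indicator {x i..} t)) \<partial>\<mu>)
      = (\<Sum>i. c i * (\<integral>\<^sup>+t\<in>{x i..}. epow (k (x i) t) q \<partial>\<mu>))"
    by (subst nn_integral_suminf) (simp_all add: nn_integral_cmult)
  also have "\<dots> \<le> (\<Sum>i. c i * om b)"
  proof (intro suminf_le mult_left_mono)
    fix i
    have "AE t in \<mu>. t \<notin> {x i}" using mu_atom by (intro AE_not_in) (auto simp: null_sets_def)
    then have "(\<integral>\<^sup>+t\<in>{x i..}. epow (k (x i) t) q \<partial>\<mu>) = om (x i)"
      unfolding om_def by (intro nn_integral_cong_AE) (auto elim!: eventually_mono simp: indicator_def)
    then show "(\<integral>\<^sup>+t\<in>{x i..}. epow (k (x i) t) q \<partial>\<mu>) \<le> om b"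
      using om_anti[OF assms] by simp
  qed auto
  finally show ?thesis by simp
qed

text \<open>
  On the dyadic level sets of \<open>x \<mapsto> \<integral>\<^sub>b\<^sup>x f\<close> the kernel is replaced by its value at the left end; subadditivity of the
  \<open>q\<close>-th power turns the sum over the levels into a geometric series.
\<close>

lemma local_operator_bound:
  assumes [measurable]: "f \<in> borel_measurable lebesgue"
  shows "(\<integral>\<^sup>+t\<in>{b<..d}. epow (\<integral>\<^sup>+x\<in>{b<..t}. (f x * k x t) \<partial>lebesgue) q \<partial>\<mu>)
    \<le> ennreal (1 / (1 - (1 / 2) powr q)) * epow (\<integral>\<^sup>+x\<in>{b<..d}. f x \<partial>lebesgue) q * om b"
proof -
  define F where "F x = (\<integral>\<^sup>+y\<in>{b<..x}. f y \<partial>lebesgue)" for x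
  have F_mono: "F x \<le> F y" if "x \<le> y" for x y
    unfolding F_def using that by (intro set_nn_integral_mono2) auto
  have [measurable]: "F \<in> borel_measurable lebesgue" by (intro mono_lebesgue F_mono)
  have L_pos: "0 < ennreal (1 / (1 - (1 / 2) powr q))"
    using half_powr_less_one[OF q_pos] by simp
  consider "om b = 0" | "om b \<noteq> 0" "F d = top" | "F d < top"
    by (cases "F d") auto
  then show ?thesis
  proof cases
    case 1
    have "(\<integral>\<^sup>+t\<in>{b<..d}. epow (\<integral>\<^sup>+x\<in>{b<..t}. (f x * k x t) \<partial>lebesgue) q \<partial>\<mu>) = (\<integral>\<^sup>+t. 0 \<partial>\<mu>)"
      using om_zero_AE[OF 1]
    proof (intro nn_integral_cong_AE, eventually_elim)
      case (elim t)
      have "(\<integral>\<^sup>+x\<in>{b<..t}. (f x * k x t) \<partial>lebesgue) \<le> (\<integral>\<^sup>+x\<in>{b<..t}. 0 \<partial>lebesgue)" if "b < t"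
      proof (intro set_nn_integral_mono2 order_refl)
        fix x assume "x \<in> {b<..t}"
        then have "k x t \<le> k b t" by (intro k_anti) auto
        then show "f x * k x t \<le> 0" using elim that by simp
      qed
      then show ?case using q_pos by (simp add: indicator_def)
    qed
    then show ?thesis by simp
  next
    case 2
    then have "ennreal (1 / (1 - (1 / 2) powr q)) * epow (F d) q * om b = top"
      using q_pos L_pos by (simp add: ennreal_mult_top ennreal_top_mult zero_less_iff_neq_zero)
    then show ?thesis unfolding F_def by simp
  next
    case 3
    define lv where "lv i = {x\<in>{b<..d}. (1 / 2) ^ Suc i * F d < F x \<and> F x \<le> (1 / 2) ^ i * F d}" for i
    define x where "x i = (if lv i = {} then b else Inf (lv i))" for i
    have [measurable]: "lv i \<in> sets lebesgue" for i unfolding lv_def by measurable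
    have bdd: "bdd_below (lv i)" for i by (intro bdd_belowI[of _ b]) (auto simp: lv_def)
    have x_ge: "b \<le> x i" for i
      unfolding x_def by (auto intro!: cInf_greatest simp: lv_def)
    have x_le: "x i \<le> y" if "y \<in> lv i" for y i
      using that cInf_lower[OF that bdd] by (auto simp: x_def)
    have mass: "(\<integral>\<^sup>+y\<in>lv i. f y \<partial>lebesgue) \<le> (1 / 2) ^ i * F d" for i
    proof -
      have "(\<integral>\<^sup>+y\<in>lv i. f y \<partial>lebesgue) \<le> (\<integral>\<^sup>+y\<in>{x\<in>{b<..d}. F x \<le> (1 / 2) ^ i * F d}. f y \<partial>lebesgue)"
        by (intro set_nn_integral_mono2) (auto simp: lv_def)
      also have "\<dots> \<le> (1 / 2) ^ i * F d"
        unfolding F_def by (rule integral_sublevel_le) simp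
      finally show ?thesis .
    qed
    \<comment> \<open>Points with \<open>F y = 0\<close> belong to no dyadic level; the sublevel
      bound with c = 0 shows that \<open>f\<close> vanishes almost everywhere there.\<close>
    have "(\<integral>\<^sup>+y\<in>{x\<in>{b<..d}. F x \<le> 0}. f y \<partial>lebesgue) \<le> 0"
      unfolding F_def by (rule integral_sublevel_le) simp
    then have AE0: "AE y in lebesgue. f y * indicator {x\<in>{b<..d}. F x \<le> 0} y = 0"
      by (subst (asm) le_zero_eq, subst (asm) nn_integral_0_iff_AE) auto
    have pointwise: "(\<integral>\<^sup>+y\<in>{b<..t}. (f y * k y t) \<partial>lebesgue)
      \<le> (\<Sum>i. (1 / 2) ^ i * F d * (k (x i) t * indicator {x i..} t))" if t: "t \<in> {b<..d}" for t
    proof -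
      have "(\<integral>\<^sup>+y\<in>{b<..t}. (f y * k y t) \<partial>lebesgue)
         \<le> (\<integral>\<^sup>+y. (\<Sum>i. f y * indicator (lv i) y * (k (x i) t * indicator {x i..} t)) \<partial>lebesgue)"
        using AE0
      proof (intro nn_integral_mono_AE, eventually_elim)
        case (elim y)
        show ?case
        proof (cases "y \<in> {b<..t} \<and> f y \<noteq> 0")
          case True
          then have y: "y \<in> {b<..d}" "0 < F y" using elim t by (auto simp: indicator_def zero_less_iff_neq_zero split: if_splits)
          then obtain i where "(1 / 2) ^ Suc i * F d < F y" "F y \<le> (1 / 2) ^ i * F d"
            using dyadic_level[of "F y" "F d"] F_mono[of y d] 3 by auto
          then have i: "y \<in> lv i" using y by (simp add: lv_def)
          have "f y * k y t * indicator {b<..t} y \<le> f y * indicator (lv i) y * (k (x i) t * indicator {x i..} t)"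
            using True i x_le[OF i] k_anti[OF x_le[OF i], of t] by (auto simp: indicator_def intro!: mult_left_mono)
          also have "\<dots> = (\<Sum>j\<in>{i}. f y * indicator (lv j) y * (k (x j) t * indicator {x j..} t))" by simp
          also have "\<dots> \<le> (\<Sum>i. f y * indicator (lv i) y * (k (x i) t * indicator {x i..} t))"
            by (intro sum_le_suminf) auto
          finally show ?thesis .
        qed (auto simp: indicator_def)
      qed
      also have "\<dots> = (\<Sum>i. (\<integral>\<^sup>+y\<in>lv i. f y \<partial>lebesgue) * (k (x i) t * indicator {x i..} t))"
        by (subst nn_integral_suminf) (simp_all add: nn_integral_multc)
      also have "\<dots> \<le> (\<Sum>i. (1 / 2) ^ i * F d * (k (x i) t * indicator {x i..} t))"
        by (intro suminf_le mult_right_mono mass) auto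
      finally show ?thesis .
    qed
    have "(\<integral>\<^sup>+t\<in>{b<..d}. epow (\<integral>\<^sup>+x\<in>{b<..t}. (f x * k x t) \<partial>lebesgue) q \<partial>\<mu>)
      \<le> (\<integral>\<^sup>+t. (\<Sum>i. epow ((1 / 2) ^ i * F d) q * (epow (k (x i) t) q * indicator {x i..} t)) \<partial>\<mu>)"
    proof (intro nn_integral_mono)
      fix t
      have "epow (\<integral>\<^sup>+x\<in>{b<..t}. (f x * k x t) \<partial>lebesgue) q
         \<le> (\<Sum>i. epow ((1 / 2) ^ i * F d) q * (epow (k (x i) t) q * indicator {x i..} t))" if t: "t \<in> {b<..d}"
      proof -
        have "epow (\<integral>\<^sup>+x\<in>{b<..t}. (f x * k x t) \<partial>lebesgue) q
          \<le> epow (\<Sum>i. (1 / 2) ^ i * F d * (k (x i) t * indicator {x i..} t)) q"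
          using q_pos by (intro epow_mono pointwise t)
        also have "\<dots> \<le> (\<Sum>i. epow ((1 / 2) ^ i * F d * (k (x i) t * indicator {x i..} t)) q)"
          using q_pos q_less by (intro epow_subadd_suminf) auto
        also have "\<dots> = (\<Sum>i. epow ((1 / 2) ^ i * F d) q * (epow (k (x i) t) q * indicator {x i..} t))"
          using q_pos by (intro suminf_cong) (simp add: epow_mult indicator_def)
        finally show ?thesis .
      qed
      then show "epow (\<integral>\<^sup>+x\<in>{b<..t}. (f x * k x t) \<partial>lebesgue) q * indicator {b<..d} t
         \<le> (\<Sum>i. epow ((1 / 2) ^ i * F d) q * (epow (k (x i) t) q * indicator {x i..} t))"
        by (simp add: indicator_def)
    qed
    also have "\<dots> \<le> (\<Sum>i. epow ((1 / 2) ^ i * F d) q) * om b"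
      by (rule level_integral[OF x_ge])
    also have "(\<Sum>i. epow ((1 / 2) ^ i * F d) q) = ennreal (1 / (1 - (1 / 2) powr q)) * epow (F d) q"
      using q_pos by (simp add: epow_mult sum_dyadic_powr)
    finally show ?thesis by (simp add: F_def)
  qed
qed

text \<open>The dyadic levels of \<open>H\<close> replace those of the integral: every z with
  \<open>H z > 0\<close> lies in one level, so the supremum is below the sum over all levels. The
  levels enter to the first power, and their series sums to 2.\<close>

lemma local_sup_bound:
  fixes H :: "real \<Rightarrow> ennreal"
  assumes H_mono: "\<And>x y. x \<le> y \<Longrightarrow> H x \<le> H y"
  shows "(\<integral>\<^sup>+t\<in>{b<..d}. (SUP z\<in>{b<..t}. epow (k z t) q * H z) \<partial>\<mu>) \<le> 2 * H d * om b"
proof -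
  consider "om b = 0" | "om b \<noteq> 0" "H d = top" | "H d < top"
    by (cases "H d") auto
  then show ?thesis
  proof cases
    case 1
    have "(\<integral>\<^sup>+t\<in>{b<..d}. (SUP z\<in>{b<..t}. epow (k z t) q * H z) \<partial>\<mu>) = (\<integral>\<^sup>+t. 0 \<partial>\<mu>)"
      using om_zero_AE[OF 1]
    proof (intro nn_integral_cong_AE, eventually_elim)
      case (elim t)
      have "(SUP z\<in>{b<..t}. epow (k z t) q * H z) \<le> 0" if "b < t"
      proof (intro SUP_least)
        fix z assume "z \<in> {b<..t}"
        then have "k z t \<le> k b t" by (intro k_anti) auto
        then show "epow (k z t) q * H z \<le> 0" using elim that q_pos by simp
      qed
      then show ?case by (simp add: indicator_def)
    qed
    then show ?thesis by simp
  next
    case 2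
    then show ?thesis by (simp add: ennreal_mult_top ennreal_top_mult)
  next
    case 3
    define lv where "lv i = {x\<in>{b<..d}. (1 / 2) ^ Suc i * H d < H x \<and> H x \<le> (1 / 2) ^ i * H d}" for i
    define x where "x i = (if lv i = {} then b else Inf (lv i))" for i
    have bdd: "bdd_below (lv i)" for i by (intro bdd_belowI[of _ b]) (auto simp: lv_def)
    have x_ge: "b \<le> x i" for i
      unfolding x_def by (auto intro!: cInf_greatest simp: lv_def)
    have x_le: "x i \<le> y" if "y \<in> lv i" for y i
      using that cInf_lower[OF that bdd] by (auto simp: x_def)
    have "(\<integral>\<^sup>+t\<in>{b<..d}. (SUP z\<in>{b<..t}. epow (k z t) q * H z) \<partial>\<mu>)
      \<le> (\<integral>\<^sup>+t. (\<Sum>i. (1 / 2) ^ i * H d * (epow (k (x i) t) q * indicator {x i..} t)) \<partial>\<mu>)"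
    proof (intro nn_integral_mono)
      fix t
      have "(SUP z\<in>{b<..t}. epow (k z t) q * H z)
         \<le> (\<Sum>i. (1 / 2) ^ i * H d * (epow (k (x i) t) q * indicator {x i..} t))" if t: "t \<in> {b<..d}"
      proof (intro SUP_least)
        fix z assume z: "z \<in> {b<..t}"
        show "epow (k z t) q * H z \<le> (\<Sum>i. (1 / 2) ^ i * H d * (epow (k (x i) t) q * indicator {x i..} t))"
        proof (cases "H z = 0")
          case False
          then obtain i where i: "(1 / 2) ^ Suc i * H d < H z" "H z \<le> (1 / 2) ^ i * H d"
            using dyadic_level[of "H z" "H d"] H_mono[of z d] z t 3 by (auto simp: zero_less_iff_neq_zero)
          then have zi: "z \<in> lv i" using z t by (simp add: lv_def)
          have "H z * epow (k z t) q \<le> (1 / 2) ^ i * H d * epow (k (x i) t) q"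
            using i q_pos by (intro mult_mono epow_mono k_anti x_le[OF zi]) auto
          also have "\<dots> = (\<Sum>j\<in>{i}. (1 / 2) ^ j * H d * (epow (k (x j) t) q * indicator {x j..} t))"
            using x_le[OF zi] z by simp
          also have "\<dots> \<le> (\<Sum>i. (1 / 2) ^ i * H d * (epow (k (x i) t) q * indicator {x i..} t))"
            by (intro sum_le_suminf) auto
          finally show ?thesis by (simp add: mult.commute)
        qed simp
      qed
      then show "(SUP z\<in>{b<..t}. epow (k z t) q * H z) * indicator {b<..d} t
         \<le> (\<Sum>i. (1 / 2) ^ i * H d * (epow (k (x i) t) q * indicator {x i..} t))"
        by (simp add: indicator_def)
    qed
    also have "\<dots> \<le> (\<Sum>i. (1 / 2) ^ i * H d) * om b"
      by (rule level_integral[OF x_ge])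
    finally show ?thesis by (simp add: sum_dyadic)
  qed
qed

end

subsection \<open>Blocks on which the weight or the kernel average is nearly constant\<close>

text \<open>The largest summand carries at least a third of the sum. The first form keeps
  \<open>A\<close> linear, which is the shape of the integrand of \<open>A2\<close>; the second,
  fully raised form is the one that test functions control.\<close>

lemma epow_le_three:
  assumes x: "x \<le> c * (A + B + D)" and s: "1 < s" and c: "1 \<le> c"
  shows "epow x s \<le> epow (3 * c) s * (epow x (s - 1) * A + epow B s + epow D s)"
    and "epow x s \<le> epow (3 * c) s * (epow A s + epow B s + epow D s)"
proof -
  consider "x \<le> 3 * c * A" | "x \<le> 3 * c * B" | "x \<le> 3 * c * D"
  proof -
    define m where "m = max A (max B D)"
    have "A + B + D \<le> m + m + m" by (intro add_mono) (auto simp: m_def le_max_iff_disj)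
    also have "\<dots> = (2 + 1) * m" by (simp only: distrib_right mult_2 mult_1)
    also have "\<dots> = 3 * m" by simp
    finally have "x \<le> c * (3 * m)" using x by (meson mult_left_mono order_trans zero_le)
    then have "x \<le> 3 * c * m" by (simp add: ac_simps)
    moreover have "m = A \<or> m = B \<or> m = D" by (auto simp: m_def max_def)
    ultimately show thesis using that by auto
  qed
  note cases = this
  have c3: "1 \<le> 3 * c"
    using mult_mono[of 1 3 1 c] c by simp
  have c_pow: "3 * c \<le> epow (3 * c) s"
  proof -
    have "3 * c * 1 \<le> 3 * c * epow (3 * c) (s - 1)"
      using epow_mono[of "s - 1" 1 "3 * c"] s c3 by (intro mult_left_mono) auto
    then show ?thesis using epow_add[of 1 "s - 1" "3 * c"] s by simp
  qed
  have x_pow: "epow x s = epow x (s - 1) * x"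
    using epow_add[of "s - 1" 1 x] s by simp
  show "epow x s \<le> epow (3 * c) s * (epow x (s - 1) * A + epow B s + epow D s)"
    using cases
  proof cases
    case 1
    have "epow x s \<le> epow x (s - 1) * (3 * c * A)" unfolding x_pow using 1 by (intro mult_left_mono) auto
    also have "\<dots> = 3 * c * (epow x (s - 1) * A)" by (simp add: ac_simps)
    also have "\<dots> \<le> epow (3 * c) s * (epow x (s - 1) * A + epow B s + epow D s)"
      by (intro mult_mono c_pow) (auto simp: add.assoc)
    finally show ?thesis .
  next
    case 2
    then have "epow x s \<le> epow (3 * c) s * epow B s"
      using s epow_mono[of s x "3 * c * B"] by (simp add: epow_mult)
    also have "\<dots> \<le> epow (3 * c) s * (epow x (s - 1) * A + epow B s + epow D s)"
      by (intro mult_left_mono) (auto intro: add_increasing add_increasing2)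
    finally show ?thesis .
  next
    case 3
    then have "epow x s \<le> epow (3 * c) s * epow D s"
      using s epow_mono[of s x "3 * c * D"] by (simp add: epow_mult)
    also have "\<dots> \<le> epow (3 * c) s * (epow x (s - 1) * A + epow B s + epow D s)"
      by (intro mult_left_mono) (auto intro: add_increasing add_increasing2)
    finally show ?thesis .
  qed
  have le: "epow (3 * c) s * epow y s \<le> epow (3 * c) s * (epow A s + epow B s + epow D s)"
    if "y = A \<or> y = B \<or> y = D" for y
    using that by (intro mult_left_mono) (auto intro: add_increasing add_increasing2)
  show "epow x s \<le> epow (3 * c) s * (epow A s + epow B s + epow D s)"
    using cases
  proof cases
    case 1
    then show ?thesis
      using s epow_mono[of s x "3 * c * A"] le[of A] by (simp add: epow_mult)
  next
    case 2
    then show ?thesis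
      using s epow_mono[of s x "3 * c * B"] le[of B] by (simp add: epow_mult)
  next
    case 3
    then show ?thesis
      using s epow_mono[of s x "3 * c * D"] le[of D] by (simp add: epow_mult)
  qed
qed

text \<open>In the doubled inequality the \<open>z\<close> term is at most 2hz \<le> cz \<le> x and
  cancels one copy of x; finiteness of x permits the cancellation.\<close>

lemma absorb_half:
  fixes x j y z :: ennreal and h c :: real
  assumes "x < top" "x \<le> j + ennreal h * (y + z)" "ennreal c * z \<le> x" "2 * h \<le> c" "0 < h"
  shows "x \<le> 2 * j + ennreal c * y"
proof (cases "j = top \<or> y = top")
  case True
  then show ?thesis using assms by (auto simp: ennreal_mult_top)
next
  case False
  have "2 * ennreal h * z \<le> x"
  proof -
    have "2 * ennreal h = ennreal (2 * h)" using assms by (simp add: ennreal_mult)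
    also have "\<dots> \<le> ennreal c" using assms by (intro ennreal_leI) auto
    finally have "2 * ennreal h * z \<le> ennreal c * z" by (rule mult_right_mono) simp
    then show ?thesis using assms by simp
  qed
  have "x + x = 2 * x" by (simp add: mult_2)
  also have "\<dots> \<le> 2 * (j + ennreal h * (y + z))" using assms by (intro mult_left_mono) auto
  also have "\<dots> = 2 * ennreal h * z + (2 * j + 2 * ennreal h * y)" by (simp add: algebra_simps)
  also have "\<dots> \<le> x + (2 * j + ennreal (2 * h) * y)"
    using \<open>2 * ennreal h * z \<le> x\<close> assms by (intro add_mono) (auto simp: ennreal_mult)
  also have "\<dots> \<le> x + (2 * j + ennreal c * y)"
    using assms by (intro add_left_mono mult_right_mono ennreal_leI) auto
  finally show ?thesis using assms by (auto simp: ennreal_add_left_cancel_le)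
qed

text \<open>The drop in the second alternative is used at \<open>\<tau> (n + 2)\<close>, where
  \<open>W\<close> is at most half of \<open>W (\<tau> (Suc n))\<close>.\<close>

locale hardy_blocks = halving +
  assumes tau_type: "\<And>n. W (\<tau> n) = 2 * W (\<tau> (Suc n)) \<and> ennreal a * om (\<tau> (Suc n)) \<le> om (\<tau> n) \<or>
     om (\<tau> n) \<le> ennreal a * om (\<tau> (Suc n)) \<and>
       (\<forall>y. 2 * W y \<le> W (\<tau> (Suc n)) \<longrightarrow> ennreal a * om y \<le> om (\<tau> n))"

context hardy_core begin

lemma blocks_exist: "\<exists>\<tau>. hardy_blocks p q th N k v \<mu> \<tau>"
proof -
  have W0: "0 < W 0" using mu_pos by (simp add: W_def)
  have "\<exists>\<tau>. \<forall>n. (0 \<le> \<tau> n \<and> 0 < W (\<tau> n) \<and> (n = 0 \<longrightarrow> \<tau> n = 0)) \<and>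
    (\<tau> n < \<tau> (Suc n) \<and> 2 * W (\<tau> (Suc n)) \<le> W (\<tau> n) \<and>
     (W (\<tau> n) = 2 * W (\<tau> (Suc n)) \<and> ennreal a * om (\<tau> (Suc n)) \<le> om (\<tau> n) \<or>
     om (\<tau> n) \<le> ennreal a * om (\<tau> (Suc n)) \<and>
       (\<forall>y. 2 * W y \<le> W (\<tau> (Suc n)) \<longrightarrow> ennreal a * om y \<le> om (\<tau> n))))"
  proof (intro dependent_nat_choice)
    show "\<exists>x. 0 \<le> x \<and> 0 < W x \<and> ((0::nat) = 0 \<longrightarrow> x = 0)" using W0 by auto
  next
    fix x and n :: nat
    assume "0 \<le> x \<and> 0 < W x \<and> (n = 0 \<longrightarrow> x = 0)"
    then have x: "0 \<le> x" "0 < W x" by auto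
    obtain y where y: "x < y" "0 < W y" "2 * W y \<le> W x"
      "W x = 2 * W y \<and> ennreal a * om y \<le> om x \<or>
       om x \<le> ennreal a * om y \<and> (\<forall>z. 2 * W z \<le> W y \<longrightarrow> ennreal a * om z \<le> om x)"
      using next_point[OF x] by blast
    then have "0 \<le> y" using x by simp
    with y show "\<exists>y. (0 \<le> y \<and> 0 < W y \<and> (Suc n = 0 \<longrightarrow> y = 0)) \<and> x < y \<and> 2 * W y \<le> W x \<and>
     (W x = 2 * W y \<and> ennreal a * om y \<le> om x \<or>
     om x \<le> ennreal a * om y \<and> (\<forall>z. 2 * W z \<le> W y \<longrightarrow> ennreal a * om z \<le> om x))"
      by (intro exI[of _ y] conjI) (assumption | simp)+
  qed
  then obtain \<tau> where "\<forall>n. (0 \<le> \<tau> n \<and> 0 < W (\<tau> n) \<and> (n = 0 \<longrightarrow> \<tau> n = 0)) \<and>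
    (\<tau> n < \<tau> (Suc n) \<and> 2 * W (\<tau> (Suc n)) \<le> W (\<tau> n) \<and>
     (W (\<tau> n) = 2 * W (\<tau> (Suc n)) \<and> ennreal a * om (\<tau> (Suc n)) \<le> om (\<tau> n) \<or>
     om (\<tau> n) \<le> ennreal a * om (\<tau> (Suc n)) \<and>
       (\<forall>y. 2 * W y \<le> W (\<tau> (Suc n)) \<longrightarrow> ennreal a * om y \<le> om (\<tau> n))))" by blast
  then have "hardy_blocks p q th N k v \<mu> \<tau>" by unfold_locales simp_all
  then show ?thesis by (intro exI)
qed

lemma W_half_point:
  assumes "0 < W t" shows "\<exists>t'>t. W t = 2 * W t' \<and> 0 < W t'"
proof -
  have half: "0 < W t / 2" "W t / 2 < W t" "2 * (W t / 2) = W t"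
    using assms W_fin[of t]
    by (cases "W t"; auto simp: divide_ennreal ennreal_mult[symmetric] ennreal_less_iff simp flip: ennreal_numeral)+
  obtain t1 where "t \<le> t1" "W t1 = W t / 2"
    using W_IVT[OF half(1) less_imp_le[OF half(2)]] by blast
  then show ?thesis using half by (intro exI[of _ t1]) (auto simp: le_less)
qed

text \<open>Used only to bound \<open>A1\<close> from above, where values of \<open>W\<close> at the
  left end of a block must be exchanged for those at the right end.\<close>

lemma dyadic_halving_exists: "\<exists>\<tau>. halving p q th N k v \<mu> \<tau> \<and> (\<forall>n. W (\<tau> n) = 2 * W (\<tau> (Suc n)))"
proof -
  have W0: "0 < W 0" using mu_pos by (simp add: W_def)
  have "\<exists>\<tau>. \<forall>n. (0 < W (\<tau> n) \<and> (n = 0 \<longrightarrow> \<tau> n = 0)) \<and>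
    (\<tau> n < \<tau> (Suc n) \<and> W (\<tau> n) = 2 * W (\<tau> (Suc n)))"
  proof (intro dependent_nat_choice)
    show "\<exists>x. 0 < W x \<and> ((0::nat) = 0 \<longrightarrow> x = 0)" using W0 by auto
  next
    fix x and n :: nat
    assume "0 < W x \<and> (n = 0 \<longrightarrow> x = 0)"
    then show "\<exists>y. (0 < W y \<and> (Suc n = 0 \<longrightarrow> y = 0)) \<and> x < y \<and> W x = 2 * W y"
      using W_half_point[of x] by auto
  qed
  then obtain \<tau> where t: "\<forall>n. (0 < W (\<tau> n) \<and> (n = 0 \<longrightarrow> \<tau> n = 0)) \<and>
    (\<tau> n < \<tau> (Suc n) \<and> W (\<tau> n) = 2 * W (\<tau> (Suc n)))" by blast
  have t': "\<tau> 0 = 0" "\<tau> n < \<tau> (Suc n)" "0 < W (\<tau> n)" "2 * W (\<tau> (Suc n)) \<le> W (\<tau> n)"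
    "W (\<tau> n) = 2 * W (\<tau> (Suc n))" for n
    using spec[OF t, of n] spec[OF t, of 0] by (auto simp only: order_refl)
  have "halving p q th N k v \<mu> \<tau>" by unfold_locales (rule t')+
  moreover have "\<forall>n. W (\<tau> n) = 2 * W (\<tau> (Suc n))" by (intro allI t'(5))
  ultimately show ?thesis by (intro exI conjI)
qed

text \<open>By \<open>pc_rpc\<close> the kernel factor and \<open>V z\<close> combine to
  \<open>epow (k z t) pc * V z\<close>, a part of \<open>Ph t\<close>. Mixed terms of kernel, weight
  and \<open>V\<close> are charged to \<open>q1\<close> in this way.\<close>

lemma kernel_weight_le:
  assumes "z \<le> t"
  shows "epow (epow (k z t) q * W t) rq * epow (V z) rpc \<le> epow (W t) rq * epow (Ph t) rpc"
proof -
  have "epow (epow (k z t) q * W t) rq * epow (V z) rpc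
      = epow (W t) rq * (epow (k z t) (q * rq) * epow (V z) rpc)"
    using exponents q_pos by (simp add: epow_mult epow_epow ac_simps)
  also have "epow (k z t) (q * rq) * epow (V z) rpc = epow (epow (k z t) pc * V z) rpc"
    using exponents by (simp add: epow_mult epow_epow pc_rpc)
  also have "\<dots> \<le> epow (Ph t) rpc"
    using exponents by (intro epow_mono V_le_Ph assms) auto
  finally show ?thesis by (simp add: mult_left_mono)
qed

end

section \<open>Control of \<open>q2\<close> by integrals over two consecutive blocks\<close>

context hardy_blocks begin

definition "J n = (\<integral>\<^sup>+t\<in>{\<tau> n<..\<tau> (n + 2)}. epow (k (\<tau> n) t) q \<partial>\<mu>)"
text \<open>The part of \<open>J n\<close> where \<open>om\<close> is still comparable with its
  value at \<open>\<tau> n\<close>, so that its power can be moved under the integral; two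
  comparable blocks in a row cost \<open>a * a\<close>.\<close>

definition "JG n = (\<integral>\<^sup>+t\<in>{t\<in>{\<tau> n<..\<tau> (n + 2)}. om (\<tau> n) \<le> ennreal (a * a) * om t}. epow (k (\<tau> n) t) q \<partial>\<mu>)"
definition "X n i = epow (k (\<tau> n) (\<tau> (n + i))) q * W (\<tau> (n + i))"

lemma JG_le: "JG n \<le> J n"
  unfolding JG_def J_def by (intro set_nn_integral_mono2) auto

lemma om_tau_fin: "om (\<tau> n) < top"
  by (intro om_fin tau_nonneg)

text \<open>If \<open>W\<close> halves, the local part is at most the kernel at the right end times
  twice the tail there, and the drop of \<open>om\<close> absorbs the remainder. Otherwise the drop
  is available only at \<open>\<tau> (n + 2)\<close>, so the local part \<open>J n\<close> over two
  blocks stays.\<close>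

lemma om_bound: "om (\<tau> n) \<le> ennreal (3 * a) * (JG n + X n 1 + X n 2)"
  using tau_type[of n]
proof (elim disjE conjE)
  assume n: "W (\<tau> n) = 2 * W (\<tau> (Suc n))" "ennreal a * om (\<tau> (Suc n)) \<le> om (\<tau> n)"
  have "om (\<tau> n) \<le> 2 * X n 1 + ennreal TH * (X n 1 + om (\<tau> (Suc n)))"
  proof -
    have "(\<integral>\<^sup>+t\<in>{\<tau> n<..\<tau> (Suc n)}. epow (k (\<tau> n) t) q \<partial>\<mu>) \<le> 2 * X n 1"
      using om_init[of "\<tau> n" "\<tau> (Suc n)"] tau_less[of n] n by (simp add: X_def ac_simps less_imp_le)
    then show ?thesis
      using om_step[OF tau_nonneg tau_less, of n] by (auto simp: X_def intro: order_trans add_right_mono)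
  qed
  then have "om (\<tau> n) \<le> 2 * (2 * X n 1) + ennreal a * X n 1"
    using om_tau_fin n a_ge TH_pos by (intro absorb_half[of _ "2 * X n 1" TH "X n 1" "om (\<tau> (Suc n))" a]) auto
  also have "\<dots> = ennreal (4 + a) * X n 1"
    using a_pos by (simp add: distrib_right mult.assoc[symmetric])
  also have "\<dots> \<le> ennreal (3 * a) * (JG n + X n 1 + X n 2)"
    using a_ge by (intro mult_mono ennreal_leI) (auto intro: add_increasing add_increasing2)
  finally show ?thesis .
next
  assume n: "om (\<tau> n) \<le> ennreal a * om (\<tau> (Suc n))"
    "\<forall>y. 2 * W y \<le> W (\<tau> (Suc n)) \<longrightarrow> ennreal a * om y \<le> om (\<tau> n)"
  have less: "\<tau> n < \<tau> (n + 2)" using tau_less[of n] tau_less[of "Suc n"] by simp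
  have aa: "ennreal (a * a) = ennreal a * ennreal a" using a_pos by (simp add: ennreal_mult)
  have "om (\<tau> n) \<le> J n + ennreal TH * (X n 2 + om (\<tau> (n + 2)))"
    using om_step[OF tau_nonneg less] by (simp add: J_def X_def)
  then have "om (\<tau> n) \<le> 2 * J n + ennreal a * X n 2"
    using om_tau_fin n(2) W_tau_half[of "Suc n"] a_ge TH_pos
    by (intro absorb_half[of _ "J n" TH "X n 2" "om (\<tau> (n + 2))" a]) auto
  \<comment> \<open>On the first block \<open>om\<close> is comparable with its value at
    \<open>\<tau> n\<close>. Only the second can leave the set defining \<open>JG\<close>; then
    \<open>W\<close> halves on it and its integral is charged to \<open>X n 2\<close>.\<close>
  also have "J n \<le> JG n + 2 * X n 2"
    using tau_type[of "Suc n"]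
  proof (elim disjE conjE)
    assume n2: "W (\<tau> (Suc n)) = 2 * W (\<tau> (Suc (Suc n)))"
    have "J n = (\<integral>\<^sup>+t\<in>{\<tau> n<..\<tau> (Suc n)}. epow (k (\<tau> n) t) q \<partial>\<mu>) + (\<integral>\<^sup>+t\<in>{\<tau> (Suc n)<..\<tau> (n + 2)}. epow (k (\<tau> n) t) q \<partial>\<mu>)"
      unfolding J_def using tau_less by (intro set_nn_integral_split_Ioc) (auto simp: less_imp_le)
    also have "\<dots> \<le> JG n + 2 * X n 2"
    proof (rule add_mono)
      show "(\<integral>\<^sup>+t\<in>{\<tau> n<..\<tau> (Suc n)}. epow (k (\<tau> n) t) q \<partial>\<mu>) \<le> JG n"
        unfolding JG_def
      proof (intro set_nn_integral_mono2 order_refl subsetI)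
        fix t assume t: "t \<in> {\<tau> n<..\<tau> (Suc n)}"
        have "om (\<tau> n) \<le> ennreal a * om t"
          using t by (intro order_trans[OF n(1)] mult_left_mono om_anti) auto
        also have "\<dots> \<le> ennreal (a * a) * om t"
          using a_ge by (intro mult_right_mono ennreal_leI) auto
        finally show "t \<in> {t \<in> {\<tau> n<..\<tau> (n + 2)}. om (\<tau> n) \<le> ennreal (a * a) * om t}"
          using t tau_less[of "Suc n"] by auto
      qed
      have "(\<integral>\<^sup>+t\<in>{\<tau> (Suc n)<..\<tau> (n + 2)}. epow (k (\<tau> n) t) q \<partial>\<mu>)
          \<le> epow (k (\<tau> n) (\<tau> (n + 2))) q * emeasure \<mu> {\<tau> (Suc n)<..\<tau> (n + 2)}"
        using q_pos by (intro set_nn_integral_le_const epow_mono k_mono) auto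
      also have "\<dots> \<le> epow (k (\<tau> n) (\<tau> (n + 2))) q * W (\<tau> (Suc n))"
        unfolding W_def by (intro mult_left_mono emeasure_mono) auto
      also have "\<dots> = 2 * X n 2" using n2 by (simp add: X_def ac_simps)
      finally show "(\<integral>\<^sup>+t\<in>{\<tau> (Suc n)<..\<tau> (n + 2)}. epow (k (\<tau> n) t) q \<partial>\<mu>) \<le> 2 * X n 2" .
    qed
    finally show ?thesis .
  next
    assume n2: "om (\<tau> (Suc n)) \<le> ennreal a * om (\<tau> (Suc (Suc n)))"
    have "J n \<le> JG n"
      unfolding J_def JG_def
    proof (intro set_nn_integral_mono2 order_refl subsetI)
      fix t assume t: "t \<in> {\<tau> n<..\<tau> (n + 2)}"
      have "om (\<tau> n) \<le> ennreal a * (ennreal a * om (\<tau> (Suc (Suc n))))"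
        using n2 by (intro order_trans[OF n(1)] mult_left_mono) auto
      also have "\<dots> \<le> ennreal a * (ennreal a * om t)"
        using t by (intro mult_left_mono om_anti) auto
      finally show "t \<in> {t \<in> {\<tau> n<..\<tau> (n + 2)}. om (\<tau> n) \<le> ennreal (a * a) * om t}"
        using t by (simp add: aa mult.assoc)
    qed
    then show ?thesis by (intro add_increasing2) auto
  qed
  finally have "om (\<tau> n) \<le> 2 * (JG n + 2 * X n 2) + ennreal a * X n 2"
    by (simp add: add_right_mono mult_left_mono)
  also have "\<dots> = 2 * JG n + ennreal (4 + a) * X n 2"
    using a_pos by (simp add: distrib_right distrib_left mult.assoc[symmetric] add.assoc)
  also have "\<dots> \<le> ennreal (3 * a) * JG n + ennreal (3 * a) * X n 2"
  proof (intro add_mono mult_right_mono)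
    show "ennreal (4 + a) \<le> ennreal (3 * a)" using a_ge by (intro ennreal_leI) simp
    have "ennreal 2 \<le> ennreal (3 * a)" using a_ge by (intro ennreal_leI) simp
    then show "2 \<le> ennreal (3 * a)" by simp
  qed auto
  also have "\<dots> \<le> ennreal (3 * a) * (JG n + X n 1 + X n 2)"
    by (simp add: distrib_left add_right_mono add_increasing2)
  finally show ?thesis .
qed


lemma X_le_q1: "epow (X n i) rq * epow (V (\<tau> n)) rpc \<le> q1 (n + i)"
  unfolding X_def q1_def by (intro kernel_weight_le tau_mono) simp

lemma q2_bounds:
  shows "q2 n \<le> Kq * (epow (om (\<tau> n)) rp * JG n * epow (V (\<tau> n)) rpc + q1 (n + 1) + q1 (n + 2))"
    and "q2 n \<le> Kq * (epow (J n) rq * epow (V (\<tau> n)) rpc + q1 (n + 1) + q1 (n + 2))"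
proof -
  have c: "1 \<le> ennreal (3 * a)" using a_ge by simp
  have rp: "rq - 1 = rp" using rq_eq by simp
  have om_J: "om (\<tau> n) \<le> ennreal (3 * a) * (J n + X n 1 + X n 2)"
    by (rule order_trans[OF om_bound]) (intro mult_left_mono add_right_mono JG_le zero_le)
  have "q2 n \<le> Kq * (epow (om (\<tau> n)) rp * JG n + epow (X n 1) rq + epow (X n 2) rq) * epow (V (\<tau> n)) rpc"
    unfolding q2_def Kq_def using epow_le_three(1)[OF om_bound exponents(4) c, of n]
    by (intro mult_right_mono) (auto simp: rp)
  also have "\<dots> \<le> Kq * (epow (om (\<tau> n)) rp * JG n * epow (V (\<tau> n)) rpc + q1 (n + 1) + q1 (n + 2))"
    unfolding mult.assoc[of Kq] distrib_right by (intro mult_left_mono add_mono X_le_q1) auto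
  finally show "q2 n \<le> Kq * (epow (om (\<tau> n)) rp * JG n * epow (V (\<tau> n)) rpc + q1 (n + 1) + q1 (n + 2))" .
  have "q2 n \<le> Kq * (epow (J n) rq + epow (X n 1) rq + epow (X n 2) rq) * epow (V (\<tau> n)) rpc"
    unfolding q2_def Kq_def using epow_le_three(2)[OF om_J exponents(4) c]
    by (intro mult_right_mono) auto
  also have "\<dots> \<le> Kq * (epow (J n) rq * epow (V (\<tau> n)) rpc + q1 (n + 1) + q1 (n + 2))"
    unfolding mult.assoc[of Kq] distrib_right by (intro mult_left_mono add_mono X_le_q1) auto
  finally show "q2 n \<le> Kq * (epow (J n) rq * epow (V (\<tau> n)) rpc + q1 (n + 1) + q1 (n + 2))" .
qed

lemma suminf_q2_le:
  assumes "\<And>n. q2 n \<le> Kq * (y n + q1 (n + 1) + q1 (n + 2))"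
  shows "(\<Sum>n. q2 n) \<le> Kq * ((\<Sum>n. y n) + 2 * (\<Sum>n. q1 n))"
proof -
  have offset: "(\<Sum>n. q1 (n + i)) \<le> (\<Sum>n. q1 n)" for i
  proof -
    have "(\<Sum>n. q1 n) = (\<Sum>n. q1 (n + i)) + (\<Sum>n<i. q1 n)"
      by (rule suminf_offset) simp
    then show ?thesis by (simp only: add_increasing2 zero_le order_refl)
  qed
  have "(\<Sum>n. q2 n) \<le> (\<Sum>n. Kq * (y n + q1 (n + 1) + q1 (n + 2)))"
    by (intro suminf_le assms) auto
  also have "\<dots> = Kq * ((\<Sum>n. y n) + (\<Sum>n. q1 (n + 1)) + (\<Sum>n. q1 (n + 2)))"
    by (simp add: suminf_add[symmetric])
  also have "\<dots> \<le> Kq * ((\<Sum>n. y n) + (\<Sum>n. q1 n) + (\<Sum>n. q1 n))"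
    by (intro mult_left_mono add_mono offset) auto
  finally show ?thesis by (simp add: mult_2 add.assoc)
qed

lemma q2_le_A: "(\<Sum>n. q2 n) \<le> Kq * (2 * epow (ennreal (a * a)) rp * A2 + 2 * (epow 2 rq * A1))"
proof -
  have "epow (om (\<tau> n)) rp * JG n * epow (V (\<tau> n)) rpc
    \<le> epow (ennreal (a * a)) rp * (\<integral>\<^sup>+t\<in>{\<tau> n<..\<tau> (n + 2)}. (epow (om t) rp * S t) \<partial>\<mu>)" for n
  proof -
    have [measurable]: "{t\<in>{\<tau> n<..\<tau> (n + 2)}. om (\<tau> n) \<le> ennreal (a * a) * om t} \<in> sets lebesgue"
      by measurable
    have "epow (om (\<tau> n)) rp * JG n * epow (V (\<tau> n)) rpc = epow (om (\<tau> n)) rp * epow (V (\<tau> n)) rpc * JG n"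
      by (simp only: ac_simps)
    also have "\<dots> =
      (\<integral>\<^sup>+t\<in>{t\<in>{\<tau> n<..\<tau> (n + 2)}. om (\<tau> n) \<le> ennreal (a * a) * om t}.
        (epow (om (\<tau> n)) rp * epow (V (\<tau> n)) rpc * epow (k (\<tau> n) t) q) \<partial>\<mu>)"
      unfolding JG_def by (rule set_nn_integral_cmult[symmetric]) (simp_all only: sets_mu borel_measurable_mu, measurable)
    also have "\<dots> \<le> (\<integral>\<^sup>+t\<in>{\<tau> n<..\<tau> (n + 2)}. (epow (ennreal (a * a)) rp * (epow (om t) rp * S t)) \<partial>\<mu>)"
    proof (intro set_nn_integral_mono2)
      fix t assume t: "t \<in> {t\<in>{\<tau> n<..\<tau> (n + 2)}. om (\<tau> n) \<le> ennreal (a * a) * om t}"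
      \<comment> \<open>\<open>\<tau> n\<close> competes in the supremum \<open>S t\<close> unless
        it is 0, in which case \<open>V\<close> vanishes.\<close>
      have "epow (k (\<tau> n) t) q * epow (V (\<tau> n)) rpc \<le> S t"
      proof (cases "\<tau> n = 0")
        case True
        then show ?thesis using exponents by (simp add: V_def)
      next
        case False
        then have "\<tau> n \<in> {0<..t}" using t tau_nonneg[of n] by auto
        then show ?thesis unfolding S_def by (rule SUP_upper)
      qed
      moreover have "epow (om (\<tau> n)) rp \<le> epow (ennreal (a * a)) rp * epow (om t) rp"
        using t exponents by (simp add: epow_mult[symmetric] epow_mono)
      ultimately have "epow (om (\<tau> n)) rp * (epow (k (\<tau> n) t) q * epow (V (\<tau> n)) rpc)
         \<le> epow (ennreal (a * a)) rp * epow (om t) rp * S t"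
        by (intro mult_mono) auto
      then show "epow (om (\<tau> n)) rp * epow (V (\<tau> n)) rpc * epow (k (\<tau> n) t) q
         \<le> epow (ennreal (a * a)) rp * (epow (om t) rp * S t)" by (simp add: ac_simps)
    qed auto
    also have "\<dots> = epow (ennreal (a * a)) rp * (\<integral>\<^sup>+t\<in>{\<tau> n<..\<tau> (n + 2)}. (epow (om t) rp * S t) \<partial>\<mu>)"
      by (rule set_nn_integral_cmult) auto
    finally show ?thesis .
  qed
  then have "(\<Sum>n. epow (om (\<tau> n)) rp * JG n * epow (V (\<tau> n)) rpc)
     \<le> (\<Sum>n. epow (ennreal (a * a)) rp * (\<integral>\<^sup>+t\<in>{\<tau> n<..\<tau> (n + 2)}. (epow (om t) rp * S t) \<partial>\<mu>))"
    by (intro suminf_le) auto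
  also have "\<dots> \<le> epow (ennreal (a * a)) rp * (2 * A2)"
    unfolding A2_def ennreal_suminf_cmult by (intro mult_left_mono integral_partition_double) auto
  finally have "(\<Sum>n. epow (om (\<tau> n)) rp * JG n * epow (V (\<tau> n)) rpc) \<le> 2 * epow (ennreal (a * a)) rp * A2"
    by (simp add: ac_simps)
  then show ?thesis
    using suminf_q2_le[OF q2_bounds(1)] q1_le_A1
    by (meson order_trans mult_left_mono add_mono zero_le)
qed

end

subsection \<open>Upper bound for the operator\<close>

context hardy_core begin

text \<open>The kernel inequality is given for strict order only. When y coincides with an endpoint,
  one summand is \<open>k x z\<close> itself, and \<open>1 + th\<close> covers this case
  too.\<close>

lemma k_tri': 
  assumes "0 \<le> x" "x \<le> y" "y \<le> z" "x < z"
  shows "k x z \<le> ennreal (1 + th) * (k x y + k y z)"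
proof -
  consider "x = y" | "y = z" | "x < y" "y < z" using assms by linarith
  then show ?thesis
  proof cases
    case 3
    then have "k x z \<le> ennreal th * (k x y + k y z)" using assms by (intro k_tri) auto
    also have "\<dots> \<le> ennreal (1 + th) * (k x y + k y z)" using th_pos by (intro mult_right_mono ennreal_leI) auto
    finally show ?thesis .
  next
    case 1
    have "1 * k x z \<le> ennreal (1 + th) * (k x y + k y z)"
      unfolding 1 using th_pos by (intro mult_mono) (auto intro: add_increasing)
    then show ?thesis by simp
  next
    case 2
    have "1 * k x z \<le> ennreal (1 + th) * (k x y + k y z)"
      unfolding 2 using th_pos by (intro mult_mono) (auto intro: add_increasing2)
    then show ?thesis by simp
  qed
qed

text \<open>
  The finiteness assumption is essential: where \<open>v = 0\<close> we have \<open>sg = \<infinity>\<close>, and the right-hand side could be \<open>0 * \<infinity> = 0\<close>.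
\<close>

lemma weighted_Hoelder:
  assumes [measurable]: "f \<in> borel_measurable lebesgue" "\<kappa> \<in> borel_measurable lebesgue" "A \<in> sets lebesgue"
    and v_fin: "AE x in lebesgue. x \<in> A \<longrightarrow> v x < top"
    and fin: "(\<integral>\<^sup>+x\<in>A. (epow (\<kappa> x) pc * sg x) \<partial>lebesgue) < top"
  shows "(\<integral>\<^sup>+x\<in>A. (f x * \<kappa> x) \<partial>lebesgue) \<le> epow (\<integral>\<^sup>+x\<in>A. (epow (f x) p * v x) \<partial>lebesgue) (1 / p)
     * epow (\<integral>\<^sup>+x\<in>A. (epow (\<kappa> x) pc * sg x) \<partial>lebesgue) (1 / pc)"
proof -
  have "AE x in lebesgue. epow (\<kappa> x) pc * sg x * indicator A x \<noteq> \<infinity>"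
    using fin by (intro nn_integral_noteq_infinite) (auto simp: less_top)
  then have "AE x in lebesgue. f x * \<kappa> x * indicator A x \<le>
     (f x * epow (v x) (1 / p) * indicator A x) * (\<kappa> x * epow (sg x) (1 / pc) * indicator A x)"
    using v_fin
  proof eventually_elim
    case (elim x)
    show ?case
    proof (cases "x \<in> A \<and> \<kappa> x \<noteq> 0")
      case True
      then have "sg x \<noteq> top" using elim(1) exponents by (auto simp: ennreal_mult_top)
      have e: "(1 - pc) * (1 / pc) = - (1 / p)" "1 - pc < 0" using p_gr by (auto simp: pc_def field_simps)
      then have "v x \<noteq> 0" using \<open>sg x \<noteq> top\<close> by (auto simp: sg_def epow_def)
      then obtain y where y: "v x = ennreal y" "0 < y"
        using elim(2) True by (cases "v x") (auto simp: less_le)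
      have "sg x = ennreal (y powr (1 - pc))" using y e by (auto simp: sg_def epow_def ennreal_eq_0_iff)
      then have "epow (sg x) (1 / pc) = ennreal (y powr (- (1 / p)))"
        using exponents by (simp add: epow_ennreal powr_powr e del: times_divide_eq_right)
      moreover have "epow (v x) (1 / p) = ennreal (y powr (1 / p))"
        using exponents y by (simp add: epow_ennreal)
      ultimately have "epow (v x) (1 / p) * epow (sg x) (1 / pc) = 1"
        using y by (simp add: ennreal_mult[symmetric] powr_minus)
      then have "f x * \<kappa> x = (f x * epow (v x) (1 / p)) * (\<kappa> x * epow (sg x) (1 / pc))"
        by (simp add: mult.assoc mult.left_commute[of "epow (v x) (1 / p)"])
      then show ?thesis using True by simp
    qed (auto simp: indicator_def)
  qed
  then have "(\<integral>\<^sup>+x\<in>A. (f x * \<kappa> x) \<partial>lebesgue) \<le> (\<integral>\<^sup>+x. (f x * epow (v x) (1 / p) * indicator A x)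
     * (\<kappa> x * epow (sg x) (1 / pc) * indicator A x) \<partial>lebesgue)"
    by (rule nn_integral_mono_AE)
  also have "\<dots> \<le> epow (\<integral>\<^sup>+x. epow (f x * epow (v x) (1 / p) * indicator A x) p \<partial>lebesgue) (1 / p)
     * epow (\<integral>\<^sup>+x. epow (\<kappa> x * epow (sg x) (1 / pc) * indicator A x) pc \<partial>lebesgue) (1 / pc)"
    using exponents pc_eq p_gr by (intro nn_integral_Hoelder) auto
  also have "(\<integral>\<^sup>+x. epow (f x * epow (v x) (1 / p) * indicator A x) p \<partial>lebesgue)
     = (\<integral>\<^sup>+x\<in>A. (epow (f x) p * v x) \<partial>lebesgue)"
    using exponents by (intro nn_integral_cong) (auto simp: epow_mult epow_epow indicator_def)
  also have "(\<integral>\<^sup>+x. epow (\<kappa> x * epow (sg x) (1 / pc) * indicator A x) pc \<partial>lebesgue)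
     = (\<integral>\<^sup>+x\<in>A. (epow (\<kappa> x) pc * sg x) \<partial>lebesgue)"
    using exponents by (intro nn_integral_cong) (auto simp: epow_mult epow_epow indicator_def)
  finally show ?thesis .
qed

end

context halving begin

lemma integral_blocks:
  assumes [measurable]: "g \<in> borel_measurable lebesgue"
  shows "(\<integral>\<^sup>+x\<in>{0<..\<tau> n}. g x \<partial>lebesgue) = (\<Sum>m<n. \<integral>\<^sup>+x\<in>{\<tau> m<..\<tau> (Suc m)}. g x \<partial>lebesgue)"
proof (induction n)
  case (Suc n)
  have "(\<integral>\<^sup>+x\<in>{0<..\<tau> (Suc n)}. g x \<partial>lebesgue)
      = (\<integral>\<^sup>+x\<in>{0<..\<tau> n}. g x \<partial>lebesgue) + (\<integral>\<^sup>+x\<in>{\<tau> n<..\<tau> (Suc n)}. g x \<partial>lebesgue)"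
    using tau_nonneg[of n] tau_less[of n] by (intro set_nn_integral_split_Ioc) auto
  then show ?case using Suc by simp
qed (simp add: tau_0)

definition "block_int f n = (\<integral>\<^sup>+x\<in>{\<tau> n<..\<tau> (Suc n)}. f x \<partial>lebesgue)"
definition "block_kernel_int f n = (\<integral>\<^sup>+x\<in>{\<tau> n<..\<tau> (Suc n)}. (f x * k x (\<tau> (Suc n))) \<partial>lebesgue)"

text \<open>The series no longer depends on the block containing t, since its indicators select the
  earlier blocks. It can be integrated over all t at once, turning the indicators and kernels into
  \<open>W\<close> and \<open>om\<close> at \<open>\<tau> (Suc m)\<close>.\<close>

lemma operator_pointwise:
  assumes [measurable]: "f \<in> borel_measurable lebesgue" and t: "t \<in> {\<tau> n<..\<tau> (Suc n)}"
  shows "epow (Tf f t) q \<le> epow (\<integral>\<^sup>+x\<in>{\<tau> n<..t}. (f x * k x t) \<partial>lebesgue) q +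
     epow (ennreal (1 + th)) q * (\<Sum>m. (epow (block_kernel_int f m) q +
        epow (block_int f m) q * epow (k (\<tau> (Suc m)) t) q) * indicator {\<tau> (Suc m)<..} t)"
proof -
  define h where "h m = epow (block_kernel_int f m) q + epow (block_int f m) q * epow (k (\<tau> (Suc m)) t) q" for m
  have "Tf f t = (\<integral>\<^sup>+x\<in>{0<..\<tau> n}. (f x * k x t) \<partial>lebesgue) + (\<integral>\<^sup>+x\<in>{\<tau> n<..t}. (f x * k x t) \<partial>lebesgue)"
    unfolding Tf_def using t tau_nonneg[of n] by (intro set_nn_integral_split_Ioc) auto
  also have "(\<integral>\<^sup>+x\<in>{0<..\<tau> n}. (f x * k x t) \<partial>lebesgue)
      = (\<Sum>m<n. \<integral>\<^sup>+x\<in>{\<tau> m<..\<tau> (Suc m)}. (f x * k x t) \<partial>lebesgue)"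
    by (rule integral_blocks) measurable
  finally have "epow (Tf f t) q \<le> epow (\<Sum>m<n. \<integral>\<^sup>+x\<in>{\<tau> m<..\<tau> (Suc m)}. (f x * k x t) \<partial>lebesgue) q +
      epow (\<integral>\<^sup>+x\<in>{\<tau> n<..t}. (f x * k x t) \<partial>lebesgue) q"
    using q_pos q_less by (simp add: epow_subadd)
  also have "epow (\<Sum>m<n. \<integral>\<^sup>+x\<in>{\<tau> m<..\<tau> (Suc m)}. (f x * k x t) \<partial>lebesgue) q
      \<le> (\<Sum>m<n. epow (\<integral>\<^sup>+x\<in>{\<tau> m<..\<tau> (Suc m)}. (f x * k x t) \<partial>lebesgue) q)"
    using q_pos q_less by (intro epow_subadd_sum) auto
  also have "\<dots> \<le> (\<Sum>m<n. epow (ennreal (1 + th)) q * (h m * indicator {\<tau> (Suc m)<..} t))"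
  proof (intro sum_mono)
    fix m assume m: "m \<in> {..<n}"
    then have mt: "\<tau> (Suc m) < t" using tau_mono[of "Suc m" n] t by auto
    have "(\<integral>\<^sup>+x\<in>{\<tau> m<..\<tau> (Suc m)}. (f x * k x t) \<partial>lebesgue)
       \<le> (\<integral>\<^sup>+x\<in>{\<tau> m<..\<tau> (Suc m)}. (ennreal (1 + th) * (f x * k x (\<tau> (Suc m)) + f x * k (\<tau> (Suc m)) t)) \<partial>lebesgue)"
    proof (intro set_nn_integral_mono2 order_refl)
      fix x assume x: "x \<in> {\<tau> m<..\<tau> (Suc m)}"
      then have "f x * k x t \<le> f x * (ennreal (1 + th) * (k x (\<tau> (Suc m)) + k (\<tau> (Suc m)) t))"
        using mt tau_nonneg[of m] by (intro mult_left_mono k_tri') auto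
      then show "f x * k x t \<le> ennreal (1 + th) * (f x * k x (\<tau> (Suc m)) + f x * k (\<tau> (Suc m)) t)"
        by (simp add: algebra_simps)
    qed
    also have "\<dots> = ennreal (1 + th) * (block_kernel_int f m + block_int f m * k (\<tau> (Suc m)) t)"
      unfolding block_kernel_int_def block_int_def
      by (subst set_nn_integral_cmult) (simp_all add: set_nn_integral_add set_nn_integral_multc)
    finally have "epow (\<integral>\<^sup>+x\<in>{\<tau> m<..\<tau> (Suc m)}. (f x * k x t) \<partial>lebesgue) q
       \<le> epow (ennreal (1 + th)) q * epow (block_kernel_int f m + block_int f m * k (\<tau> (Suc m)) t) q"
      using q_pos by (simp only: epow_mult[symmetric] epow_mono)
    also have "\<dots> \<le> epow (ennreal (1 + th)) q * h m"
      unfolding h_def using q_pos q_less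
        epow_subadd[of q "block_kernel_int f m" "block_int f m * k (\<tau> (Suc m)) t"]
      by (intro mult_left_mono) (simp_all add: epow_mult)
    finally show "epow (\<integral>\<^sup>+x\<in>{\<tau> m<..\<tau> (Suc m)}. (f x * k x t) \<partial>lebesgue) q
       \<le> epow (ennreal (1 + th)) q * (h m * indicator {\<tau> (Suc m)<..} t)" using mt by simp
  qed
  also have "\<dots> \<le> (\<Sum>m. epow (ennreal (1 + th)) q * (h m * indicator {\<tau> (Suc m)<..} t))"
    by (intro sum_le_suminf) auto
  finally show ?thesis
    unfolding h_def by (simp add: add.commute add_right_mono)
qed

end

section \<open>Summation of the block estimates for the operator\<close>

context hardy_blocks begin

definition "block_term f n = epow (block_kernel_int f n) q * W (\<tau> (Suc n)) + epow (block_int f n) q * om (\<tau> (Suc n))"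

text \<open>If \<open>W\<close> halves, the kernel is frozen at the right end in its second variable
  and the mass is at most twice the next tail. Otherwise \<open>local_operator_bound\<close> gives
  \<open>om\<close> at the left end, which comparability moves to the right end.\<close>

lemma inner_block:
  assumes [measurable]: "f \<in> borel_measurable lebesgue"
  shows "(\<integral>\<^sup>+t\<in>{\<tau> n<..\<tau> (Suc n)}. epow (\<integral>\<^sup>+x\<in>{\<tau> n<..t}. (f x * k x t) \<partial>lebesgue) q \<partial>\<mu>)
    \<le> (2 + L * ennreal a) * block_term f n"
  using tau_type[of n]
proof (elim disjE conjE)
  assume n: "W (\<tau> n) = 2 * W (\<tau> (Suc n))"
  have "(\<integral>\<^sup>+t\<in>{\<tau> n<..\<tau> (Suc n)}. epow (\<integral>\<^sup>+x\<in>{\<tau> n<..t}. (f x * k x t) \<partial>lebesgue) q \<partial>\<mu>)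
    \<le> epow (block_kernel_int f n) q * emeasure \<mu> {\<tau> n<..\<tau> (Suc n)}"
    unfolding block_kernel_int_def using q_pos
    by (intro set_nn_integral_le_const epow_mono set_nn_integral_mono2 mult_left_mono k_mono) auto
  also have "\<dots> \<le> epow (block_kernel_int f n) q * W (\<tau> n)"
    unfolding W_def by (intro mult_left_mono emeasure_mono) auto
  also have "\<dots> = 2 * (epow (block_kernel_int f n) q * W (\<tau> (Suc n)))" using n by (simp add: ac_simps)
  also have "\<dots> \<le> (2 + L * ennreal a) * block_term f n"
    unfolding block_term_def by (intro mult_mono) auto
  finally show ?thesis .
next
  assume n: "om (\<tau> n) \<le> ennreal a * om (\<tau> (Suc n))"
  have "(\<integral>\<^sup>+t\<in>{\<tau> n<..\<tau> (Suc n)}. epow (\<integral>\<^sup>+x\<in>{\<tau> n<..t}. (f x * k x t) \<partial>lebesgue) q \<partial>\<mu>)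
    \<le> L * epow (block_int f n) q * om (\<tau> n)"
    unfolding L_def block_int_def by (rule local_operator_bound) simp
  also have "\<dots> \<le> L * epow (block_int f n) q * (ennreal a * om (\<tau> (Suc n)))"
    by (intro mult_left_mono n) auto
  also have "\<dots> = (L * ennreal a) * (epow (block_int f n) q * om (\<tau> (Suc n)))" by (simp add: ac_simps)
  also have "\<dots> \<le> (2 + L * ennreal a) * block_term f n"
    unfolding block_term_def by (intro mult_mono) auto
  finally show ?thesis .
qed

lemma operator_le_block_terms:
  assumes [measurable]: "f \<in> borel_measurable lebesgue"
  shows "(\<integral>\<^sup>+t. epow (Tf f t) q \<partial>\<mu>) \<le> K1 * (\<Sum>n. block_term f n)"
proof -
  define h where "h t = (\<Sum>m. (epow (block_kernel_int f m) q +
        epow (block_int f m) q * epow (k (\<tau> (Suc m)) t) q) * indicator {\<tau> (Suc m)<..} t)" for t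
  define g where "g n t = epow (\<integral>\<^sup>+x\<in>{\<tau> n<..t}. (f x * k x t) \<partial>lebesgue) q" for n t
  have [measurable]: "h \<in> borel_measurable lebesgue" unfolding h_def by measurable
  have [measurable]: "g n \<in> borel_measurable lebesgue" for n
    unfolding g_def using q_pos
    by (intro mono_lebesgue epow_mono set_nn_integral_mono2 mult_left_mono k_mono) auto
  have h_int: "(\<integral>\<^sup>+t. h t \<partial>\<mu>) = (\<Sum>n. block_term f n)"
  proof -
    have "(\<integral>\<^sup>+t. h t \<partial>\<mu>) = (\<Sum>m. \<integral>\<^sup>+t\<in>{\<tau> (Suc m)<..}. (epow (block_kernel_int f m) q +
        epow (block_int f m) q * epow (k (\<tau> (Suc m)) t) q) \<partial>\<mu>)"
      unfolding h_def by (rule nn_integral_suminf) simp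
    also have "\<dots> = (\<Sum>m. block_term f m)"
      unfolding block_term_def
      by (intro suminf_cong) (simp add: set_nn_integral_add set_nn_integral_const set_nn_integral_cmult W_def om_def)
    finally show ?thesis .
  qed
  have "(\<integral>\<^sup>+t. epow (Tf f t) q \<partial>\<mu>) = (\<Sum>n. \<integral>\<^sup>+t\<in>{\<tau> n<..\<tau> (Suc n)}. epow (Tf f t) q \<partial>\<mu>)"
    by (rule integral_partition) simp
  also have "\<dots> \<le> (\<Sum>n. \<integral>\<^sup>+t\<in>{\<tau> n<..\<tau> (Suc n)}. (g n t + epow (ennreal (1 + th)) q * h t) \<partial>\<mu>)"
    unfolding g_def h_def
    by (intro suminf_le set_nn_integral_mono2 order_refl operator_pointwise) auto
  also have "\<dots> = (\<Sum>n. (\<integral>\<^sup>+t\<in>{\<tau> n<..\<tau> (Suc n)}. g n t \<partial>\<mu>) + epow (ennreal (1 + th)) q * (\<integral>\<^sup>+t\<in>{\<tau> n<..\<tau> (Suc n)}. h t \<partial>\<mu>))"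
    by (intro suminf_cong) (simp add: set_nn_integral_add set_nn_integral_cmult)
  also have "\<dots> = (\<Sum>n. \<integral>\<^sup>+t\<in>{\<tau> n<..\<tau> (Suc n)}. g n t \<partial>\<mu>) + epow (ennreal (1 + th)) q * (\<Sum>n. \<integral>\<^sup>+t\<in>{\<tau> n<..\<tau> (Suc n)}. h t \<partial>\<mu>)"
    by (simp add: suminf_add[symmetric])
  also have "(\<Sum>n. \<integral>\<^sup>+t\<in>{\<tau> n<..\<tau> (Suc n)}. h t \<partial>\<mu>) = (\<Sum>n. block_term f n)"
    unfolding h_int[symmetric] by (rule integral_partition[symmetric]) simp
  also have "(\<Sum>n. \<integral>\<^sup>+t\<in>{\<tau> n<..\<tau> (Suc n)}. g n t \<partial>\<mu>) \<le> (\<Sum>n. (2 + L * ennreal a) * block_term f n)"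
    unfolding g_def by (intro suminf_le inner_block) auto
  also have "\<dots> = (2 + L * ennreal a) * (\<Sum>n. block_term f n)" by (rule ennreal_suminf_cmult)
  finally show ?thesis unfolding K1_def by (simp add: distrib_right add_right_mono)
qed

lemma block_term_le:
  assumes [measurable]: "f \<in> borel_measurable lebesgue"
    and v_fin: "AE x in lebesgue. 0 < x \<longrightarrow> v x < top"
    and fin: "q1 (Suc n) < top" "q2 (Suc n) < top"
  shows "block_term f n \<le> epow (\<integral>\<^sup>+x\<in>{\<tau> n<..\<tau> (Suc n)}. (epow (f x) p * v x) \<partial>lebesgue) (q / p)
     * epow (q1 (Suc n)) (1 / rq)
     + epow (\<integral>\<^sup>+x\<in>{\<tau> n<..\<tau> (Suc n)}. (epow (f x) p * v x) \<partial>lebesgue) (q / p) * epow (q2 (Suc n)) (1 / rq)"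
proof -
  define I where "I = {\<tau> n<..\<tau> (Suc n)}"
  define fp where "fp = (\<integral>\<^sup>+x\<in>I. (epow (f x) p * v x) \<partial>lebesgue)"
  have I: "I \<in> sets lebesgue" "I \<subseteq> {0<..\<tau> (Suc n)}"
    using tau_nonneg[of n] by (auto simp: I_def)
  have v_fin': "AE x in lebesgue. x \<in> I \<longrightarrow> v x < top"
    using v_fin by eventually_elim (use I in auto)
  \<comment> \<open>Used with \<open>c = W\<close>, \<open>B = Ph\<close> and with
    \<open>c = om\<close>, \<open>B = V\<close> at \<open>\<tau> (Suc n)\<close>. For nonzero
    \<open>c\<close>, finiteness of the product forces \<open>B < top\<close>, as Hoelder's
    inequality demands; for c = 0 the left side is 0.\<close>
  have Hoelder: "epow (\<integral>\<^sup>+x\<in>I. (f x * \<kappa> x) \<partial>lebesgue) q * c \<le> epow fp (q / p) * epow (epow c rq * epow B rpc) (1 / rq)"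
    if [measurable]: "\<kappa> \<in> borel_measurable lebesgue" and B: "(\<integral>\<^sup>+x\<in>{0<..\<tau> (Suc n)}. (epow (\<kappa> x) pc * sg x) \<partial>lebesgue) = B"
      and c: "epow c rq * epow B rpc < top" for \<kappa> c B
  proof (cases "c = 0")
    case False
    then have "B < top"
      using c exponents by (auto simp: ennreal_mult_less_top top.not_eq_extremum[symmetric])
    have le: "(\<integral>\<^sup>+x\<in>I. (epow (\<kappa> x) pc * sg x) \<partial>lebesgue) \<le> B"
      unfolding B[symmetric] using I by (intro set_nn_integral_mono2) auto
    have "(\<integral>\<^sup>+x\<in>I. (f x * \<kappa> x) \<partial>lebesgue) \<le> epow fp (1 / p) * epow (\<integral>\<^sup>+x\<in>I. (epow (\<kappa> x) pc * sg x) \<partial>lebesgue) (1 / pc)"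
      unfolding fp_def using I v_fin' le \<open>B < top\<close> by (intro weighted_Hoelder) auto
    also have "\<dots> \<le> epow fp (1 / p) * epow B (1 / pc)"
      using exponents by (intro mult_left_mono epow_mono le) auto
    finally have "epow (\<integral>\<^sup>+x\<in>I. (f x * \<kappa> x) \<partial>lebesgue) q \<le> epow (epow fp (1 / p) * epow B (1 / pc)) q"
      using q_pos by (intro epow_mono)
    also have "\<dots> = epow fp (q / p) * epow B (q / pc)"
      using q_pos exponents by (simp add: epow_mult epow_epow)
    finally have "epow (\<integral>\<^sup>+x\<in>I. (f x * \<kappa> x) \<partial>lebesgue) q * c \<le> epow fp (q / p) * epow B (q / pc) * c"
      by (rule mult_right_mono) simp
    also have "\<dots> = epow fp (q / p) * epow (epow c rq * epow B rpc) (1 / rq)"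
      using exponents rpc_eq by (simp add: epow_mult epow_epow ac_simps)
    finally show ?thesis .
  qed simp
  have "epow (block_kernel_int f n) q * W (\<tau> (Suc n)) \<le> epow fp (q / p) * epow (q1 (Suc n)) (1 / rq)"
    unfolding block_kernel_int_def I_def[symmetric] q1_def
    by (rule Hoelder) (use fin(1) in \<open>auto simp: q1_def Ph_def\<close>)
  moreover have "epow (block_int f n) q * om (\<tau> (Suc n)) \<le> epow fp (q / p) * epow (q2 (Suc n)) (1 / rq)"
    using Hoelder[of "\<lambda>_. 1" "V (\<tau> (Suc n))" "om (\<tau> (Suc n))"] fin(2)
    unfolding block_int_def I_def[symmetric] q2_def by (simp add: V_def)
  ultimately show ?thesis unfolding block_term_def fp_def I_def by (rule add_mono)
qed

text \<open>The exponents q/p and 1/rq add up to 1, so Hoelder's inequality for series separates the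
  norm of f from the sums of \<open>q1\<close> and \<open>q2\<close>.\<close>

lemma operator_bound_by_sums:
  assumes [measurable]: "f \<in> borel_measurable lebesgue"
    and v_fin: "AE x in lebesgue. 0 < x \<longrightarrow> v x < top"
    and fin: "(\<Sum>n. q1 n) < top" "(\<Sum>n. q2 n) < top"
  shows "(\<integral>\<^sup>+t. epow (Tf f t) q \<partial>\<mu>) \<le> K1 * (epow (\<integral>\<^sup>+x\<in>{0<..}. (epow (f x) p * v x) \<partial>lebesgue) (q / p) *
     (epow (\<Sum>n. q1 n) (1 / rq) + epow (\<Sum>n. q2 n) (1 / rq)))"
proof -
  define fp where "fp n = (\<integral>\<^sup>+x\<in>{\<tau> n<..\<tau> (Suc n)}. (epow (f x) p * v x) \<partial>lebesgue)" for n
  define F where "F = (\<integral>\<^sup>+x\<in>{0<..}. (epow (f x) p * v x) \<partial>lebesgue)"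
  have fp_sum: "(\<Sum>n. fp n) \<le> F"
    unfolding suminf_eq_SUP
  proof (rule SUP_least)
    fix n
    have "(\<Sum>m<n. fp m) = (\<integral>\<^sup>+x\<in>{0<..\<tau> n}. (epow (f x) p * v x) \<partial>lebesgue)"
      unfolding fp_def by (rule integral_blocks[symmetric]) simp
    also have "\<dots> \<le> F" unfolding F_def by (intro set_nn_integral_mono2) auto
    finally show "(\<Sum>m<n. fp m) \<le> F" .
  qed
  have e: "0 < q / p" "0 < 1 / rq" "q / p + 1 / rq = 1"
    using exponents q_pos rq_inv by auto
  have part: "(\<Sum>n. epow (fp n) (q / p) * epow (y (Suc n)) (1 / rq)) \<le> epow F (q / p) * epow (\<Sum>n. y n) (1 / rq)"
    for y :: "nat \<Rightarrow> ennreal"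
  proof -
    have "(\<Sum>n. epow (fp n) (q / p) * epow (y (Suc n)) (1 / rq)) \<le> epow (\<Sum>n. fp n) (q / p) * epow (\<Sum>n. y (Suc n)) (1 / rq)"
      by (rule suminf_Hoelder_powr[OF e])
    also have "\<dots> \<le> epow F (q / p) * epow (\<Sum>n. y n) (1 / rq)"
      using e suminf_offset[of y 1] by (intro mult_mono epow_mono fp_sum) auto
    finally show ?thesis .
  qed
  have "(\<Sum>n. block_term f n) \<le> (\<Sum>n. epow (fp n) (q / p) * epow (q1 (Suc n)) (1 / rq) + epow (fp n) (q / p) * epow (q2 (Suc n)) (1 / rq))"
    unfolding fp_def
    by (intro suminf_le block_term_le v_fin assms(1) summableI ennreal_suminf_lessD[OF fin(1)] ennreal_suminf_lessD[OF fin(2)])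
  also have "\<dots> = (\<Sum>n. epow (fp n) (q / p) * epow (q1 (Suc n)) (1 / rq)) + (\<Sum>n. epow (fp n) (q / p) * epow (q2 (Suc n)) (1 / rq))"
    by (rule suminf_add[symmetric]) auto
  also have "\<dots> \<le> epow F (q / p) * epow (\<Sum>n. q1 n) (1 / rq) + epow F (q / p) * epow (\<Sum>n. q2 n) (1 / rq)"
    by (intro add_mono part)
  finally have "K1 * (\<Sum>n. block_term f n) \<le> K1 * (epow F (q / p) * (epow (\<Sum>n. q1 n) (1 / rq) + epow (\<Sum>n. q2 n) (1 / rq)))"
    by (intro mult_left_mono) (auto simp: distrib_left)
  then show ?thesis
    unfolding F_def using operator_le_block_terms[OF assms(1)] by (rule order_trans[rotated])
qed

end

subsection \<open>Bounds for the two characteristic integrals\<close>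

text \<open>The mass bound is multiplied into each value of \<open>h\<close> before the supremum is
  taken, so only the product with the mass has to be estimated.\<close>

lemma set_nn_integral_le_of_mult:
  assumes A: "A \<in> sets M" "emeasure M A \<le> c" and h: "\<And>t. t \<in> A \<Longrightarrow> h t * c \<le> C"
  shows "(\<integral>\<^sup>+t\<in>A. h t \<partial>M) \<le> C"
proof -
  have "(\<integral>\<^sup>+t\<in>A. h t \<partial>M) \<le> (SUP t\<in>A. h t) * emeasure M A"
    by (intro set_nn_integral_le_const SUP_upper A)
  also have "\<dots> \<le> (SUP t\<in>A. h t) * c" by (intro mult_left_mono A) auto
  also have "\<dots> = (SUP t\<in>A. h t * c)" by (rule SUP_mult_right_ennreal)
  also have "\<dots> \<le> C" by (intro SUP_least h)
  finally show ?thesis .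
qed

context hardy_core begin

text \<open>Enlarging the last factor to \<open>Y + x\<close> completes the power, as
  \<open>rq = 1 + rp\<close>.\<close>

lemma epow_mixed_le: "epow (Y + x) rp * Y \<le> epow 2 rq * (epow Y rq + epow x rq)"
proof -
  have "epow (Y + x) rp * Y \<le> epow (Y + x) rp * (Y + x)" by (intro mult_left_mono) auto
  also have "\<dots> = epow (Y + x) rq"
    using epow_add[of rp 1 "Y + x"] exponents by (simp add: rq_eq add.commute)
  also have "\<dots> \<le> epow 2 rq * (epow Y rq + epow x rq)"
    using exponents by (intro epow_add_le) auto
  finally show ?thesis .
qed

end

context halving begin

text \<open>\<open>Ph\<close> is largest at the right end of a block and \<open>W\<close> at the
  left end; exact halving lets the two be taken at the same point for a factor 2.\<close>

lemma A1_le_q1: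
  assumes eq: "\<And>n. W (\<tau> n) = 2 * W (\<tau> (Suc n))"
  shows "A1 \<le> epow 2 rq * (\<Sum>n. q1 n)"
proof -
  have "A1 = (\<Sum>n. \<integral>\<^sup>+t\<in>{\<tau> n<..\<tau> (Suc n)}. (epow (W t) rp * epow (Ph t) rpc) \<partial>\<mu>)"
    unfolding A1_def by (rule integral_partition) simp
  also have "\<dots> \<le> (\<Sum>n. epow 2 rq * q1 (Suc n))"
  proof (intro suminf_le)
    fix n
    have "(\<integral>\<^sup>+t\<in>{\<tau> n<..\<tau> (Suc n)}. (epow (W t) rp * epow (Ph t) rpc) \<partial>\<mu>)
      \<le> epow (W (\<tau> n)) rp * epow (Ph (\<tau> (Suc n))) rpc * emeasure \<mu> {\<tau> n<..\<tau> (Suc n)}"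
      using exponents
      by (intro set_nn_integral_le_const mult_mono epow_mono W_anti Ph_mono) auto
    also have "\<dots> \<le> epow (W (\<tau> n)) rp * epow (Ph (\<tau> (Suc n))) rpc * W (\<tau> n)"
      unfolding W_def by (intro mult_left_mono emeasure_mono) auto
    also have "\<dots> = epow (W (\<tau> n)) rq * epow (Ph (\<tau> (Suc n))) rpc"
      using epow_add[of rp 1 "W (\<tau> n)"] exponents by (simp only: rq_eq) (simp add: add.commute ac_simps)
    also have "\<dots> = epow 2 rq * q1 (Suc n)"
      using exponents unfolding q1_def by (subst eq) (simp add: epow_mult mult.assoc)
    finally show "(\<integral>\<^sup>+t\<in>{\<tau> n<..\<tau> (Suc n)}. (epow (W t) rp * epow (Ph t) rpc) \<partial>\<mu>) \<le> epow 2 rq * q1 (Suc n)" .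
  qed auto
  also have "\<dots> \<le> epow 2 rq * (\<Sum>n. q1 n)"
    unfolding ennreal_suminf_cmult using suminf_offset[of q1 1] by (intro mult_left_mono) auto
  finally show ?thesis .
qed

end

context hardy_blocks begin

lemma q2_le_hardy:
  assumes "hardy_bound D"
  shows "(\<Sum>n. q2 n) \<le> Kq * (ennreal ((2 * D) powr rq) + 2 * (epow 2 rq * ennreal ((2 * D) powr rq)))"
proof -
  have "(\<Sum>n<M. epow (J n) rq * epow (V (\<tau> n)) rpc) \<le> ennreal ((2 * D) powr rq)" for M
  proof -
    have "(\<Sum>n<M. indicator {\<tau> n<..\<tau> (n + 2)} t :: ennreal) \<le> 2" for t
    proof -
      have "(\<Sum>n<M. indicator {\<tau> n<..\<tau> (n + 2)} t :: ennreal)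
        \<le> (\<Sum>n. indicator {\<tau> n<..\<tau> (Suc n)} t + indicator {\<tau> (Suc n)<..\<tau> (Suc (Suc n))} t)"
      proof (rule order_trans[OF sum_mono sum_le_suminf])
        show "indicator {\<tau> n<..\<tau> (n + 2)} t
          \<le> (indicator {\<tau> n<..\<tau> (Suc n)} t + indicator {\<tau> (Suc n)<..\<tau> (Suc (Suc n))} t :: ennreal)" for n
          by (auto simp: indicator_def)
      qed auto
      also have "\<dots> = (\<Sum>n. indicator {\<tau> n<..\<tau> (Suc n)} t) + (\<Sum>n. indicator {\<tau> (Suc n)<..\<tau> (Suc (Suc n))} t)"
        by (rule suminf_add[symmetric]) auto
      also have "\<dots> \<le> (\<Sum>n. indicator {\<tau> n<..\<tau> (Suc n)} t) + (\<Sum>n. indicator {\<tau> n<..\<tau> (Suc n)} t)"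
        using suminf_offset[of "\<lambda>n. indicator {\<tau> n<..\<tau> (Suc n)} t :: ennreal" 1] by (intro add_left_mono) auto
      also have "(\<Sum>n. indicator {\<tau> n<..\<tau> (Suc n)} t) = (indicator (\<Union>n. {\<tau> n<..\<tau> (Suc n)}) t :: ennreal)"
        by (rule suminf_indicator[OF tau_disjoint])
      also have "indicator (\<Union>n. {\<tau> n<..\<tau> (Suc n)}) t + indicator (\<Union>n. {\<tau> n<..\<tau> (Suc n)}) t \<le> (2 :: ennreal)"
        by (auto simp: indicator_def)
      finally show ?thesis .
    qed
    moreover have "(\<integral>\<^sup>+t\<in>{\<tau> n<..\<tau> (n + 2)}. epow (k (\<tau> n) t) q \<partial>\<mu>) < top" for n
    proof -
      have "(\<integral>\<^sup>+t\<in>{\<tau> n<..\<tau> (n + 2)}. epow (k (\<tau> n) t) q \<partial>\<mu>) \<le> om (\<tau> n)"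
        unfolding om_def by (intro set_nn_integral_mono2) auto
      then show ?thesis using om_tau_fin[of n] by (rule le_less_trans)
    qed
    ultimately show ?thesis
      using test_sum[OF assms, of "\<lambda>n x. 1" "\<lambda>n t. k (\<tau> n) t" "\<lambda>n. {\<tau> n<..\<tau> (n + 2)}" "\<lambda>n. 1" M \<tau>]
      by (simp add: J_def V_def k_anti)
  qed
  then have J: "(\<Sum>n. epow (J n) rq * epow (V (\<tau> n)) rpc) \<le> ennreal ((2 * D) powr rq)"
    unfolding suminf_eq_SUP by (rule SUP_least)
  have "(\<Sum>n. q2 n) \<le> Kq * ((\<Sum>n. epow (J n) rq * epow (V (\<tau> n)) rpc) + 2 * (\<Sum>n. q1 n))"
    by (rule suminf_q2_le[OF q2_bounds(2)])
  also have "\<dots> \<le> Kq * (ennreal ((2 * D) powr rq) + 2 * (epow 2 rq * ennreal ((2 * D) powr rq)))"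
    by (intro mult_left_mono add_mono J q1_le_hardy[OF assms]) auto
  finally show ?thesis .
qed


text \<open>With \<open>b\<close> the right end and z \<le> t \<le> b, both \<open>k t b\<close> and
  \<open>k z t\<close> are at most \<open>k z b\<close>. Hence \<open>om t\<close> is controlled by
  \<open>Y + om b\<close>, and the kernel factor times \<open>W b\<close> by \<open>Y\<close>, where
  \<open>Y = epow (k z b) q * W b\<close>; \<open>epow_mixed_le\<close> then separates
  \<open>q1\<close> from \<open>q2\<close>.\<close>

lemma A2_block_halving:
  assumes n: "W (\<tau> n) = 2 * W (\<tau> (Suc n))"
  shows "(\<integral>\<^sup>+t\<in>{\<tau> n<..\<tau> (Suc n)}. (epow (om t) rp * S t) \<partial>\<mu>) \<le> K5 * (q1 (Suc n) + q2 (Suc n))"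
proof (rule set_nn_integral_le_of_mult)
  define b where "b = \<tau> (Suc n)"
  show "{\<tau> n<..\<tau> (Suc n)} \<in> sets \<mu>" by simp
  show "emeasure \<mu> {\<tau> n<..\<tau> (Suc n)} \<le> W (\<tau> n)" unfolding W_def by (intro emeasure_mono) auto
  fix t assume t: "t \<in> {\<tau> n<..\<tau> (Suc n)}"
  then have tb: "\<tau> n < t" "t \<le> b" "0 < t" using tau_nonneg[of n] by (auto simp: b_def)
  have Wn: "W (\<tau> n) = 2 * W b" using n by (simp add: b_def)
  have om_t: "om t \<le> ennreal a * (epow (k t b) q * W b + om b)"
  proof (cases "t < b")
    case True
    have "om t \<le> epow (k t b) q * W t + ennreal TH * (epow (k t b) q * W b + om b)"
      using om_step[of t b] om_init[of t b] True tb by (auto intro: order_trans add_right_mono)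
    also have "\<dots> \<le> epow (k t b) q * (2 * W b) + ennreal TH * (epow (k t b) q * W b + om b)"
      using tb unfolding Wn[symmetric] by (intro add_right_mono mult_left_mono W_anti) auto
    also have "\<dots> \<le> 2 * (epow (k t b) q * W b + om b) + ennreal TH * (epow (k t b) q * W b + om b)"
      by (simp add: distrib_left ac_simps add_increasing2)
    also have "\<dots> = ennreal (2 + TH) * (epow (k t b) q * W b + om b)"
      using TH_pos by (simp add: distrib_right)
    also have "\<dots> \<le> ennreal a * (epow (k t b) q * W b + om b)"
      using TH_pos by (intro mult_right_mono ennreal_leI) (auto simp: a_def)
    finally show ?thesis .
  next
    case False
    then have "t = b" using tb by simp
    have "1 * om t \<le> ennreal a * (epow (k t b) q * W b + om b)"
      unfolding \<open>t = b\<close> using a_ge by (intro mult_mono) (auto intro: add_increasing)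
    then show ?thesis by simp
  qed
  have "epow (om t) rp * S t * W (\<tau> n)
     = (SUP z\<in>{0<..t}. epow (om t) rp * (epow (k z t) q * epow (V z) rpc) * W (\<tau> n))"
    unfolding S_def by (simp add: SUP_mult_left_ennreal SUP_mult_right_ennreal)
  also have "\<dots> \<le> K5 * (q1 (Suc n) + q2 (Suc n))"
  proof (rule SUP_least)
    fix z assume z: "z \<in> {0<..t}"
    define Y where "Y = epow (k z b) q * W b"
    have "om t \<le> ennreal a * (epow (k t b) q * W b + om b)" by (rule om_t)
    also have "\<dots> \<le> ennreal a * (Y + om b)"
      unfolding Y_def using z q_pos by (intro mult_left_mono add_right_mono mult_right_mono epow_mono k_anti) auto
    finally have "epow (om t) rp \<le> epow (ennreal a) rp * epow (Y + om b) rp"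
      using exponents by (simp add: epow_mult[symmetric] epow_mono)
    moreover have "epow (k z t) q * W b \<le> Y"
      unfolding Y_def using q_pos tb by (intro mult_right_mono epow_mono k_mono) auto
    ultimately have "epow (om t) rp * (epow (k z t) q * W b) \<le> epow (ennreal a) rp * epow (Y + om b) rp * Y"
      by (intro mult_mono) auto
    also have "\<dots> \<le> epow (ennreal a) rp * (epow 2 rq * (epow Y rq + epow (om b) rq))"
      unfolding mult.assoc by (intro mult_left_mono epow_mixed_le) auto
    finally have le: "epow (om t) rp * (epow (k z t) q * W b) \<le> epow (ennreal a) rp * epow 2 rq * (epow Y rq + epow (om b) rq)"
      by (simp add: mult.assoc)
    have "epow (om t) rp * (epow (k z t) q * epow (V z) rpc) * W (\<tau> n)
       = 2 * (epow (om t) rp * (epow (k z t) q * W b)) * epow (V z) rpc"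
      unfolding Wn by (simp add: ac_simps)
    also have "\<dots> \<le> 2 * (epow (ennreal a) rp * epow 2 rq * (epow Y rq + epow (om b) rq)) * epow (V z) rpc"
      by (intro mult_right_mono mult_left_mono le) auto
    also have "\<dots> = K5 * (epow Y rq * epow (V z) rpc + epow (om b) rq * epow (V z) rpc)"
      unfolding K5_def by (simp add: distrib_right distrib_left mult.assoc)
    also have "\<dots> \<le> K5 * (q1 (Suc n) + q2 (Suc n))"
    proof (intro mult_left_mono add_mono)
      show "epow Y rq * epow (V z) rpc \<le> q1 (Suc n)"
        unfolding Y_def q1_def b_def using z t by (intro kernel_weight_le) auto
      show "epow (om b) rq * epow (V z) rpc \<le> q2 (Suc n)"
        unfolding q2_def b_def using z t exponents by (intro mult_left_mono epow_mono V_mono) auto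
    qed auto
    finally show "epow (om t) rp * (epow (k z t) q * epow (V z) rpc) * W (\<tau> n) \<le> K5 * (q1 (Suc n) + q2 (Suc n))" .
  qed
  finally show "epow (om t) rp * S t * W (\<tau> n) \<le> K5 * (q1 (Suc n) + q2 (Suc n))" .
qed

lemma k_tri_epow:
  assumes "0 \<le> x" "x \<le> y" "y < z"
  shows "epow (k x z) q \<le> TM * (epow (k x y) q + epow (k y z) q)"
proof -
  have "k x z \<le> ennreal (1 + th) * (k x y + k y z)"
    using assms by (intro k_tri') auto
  then have "epow (k x z) q \<le> epow (ennreal (1 + th) * (k x y + k y z)) q"
    using q_pos by (intro epow_mono)
  also have "\<dots> \<le> TM * (epow (k x y) q + epow (k y z) q)"
    using q_pos q_less epow_subadd[of q "k x y" "k y z"] by (simp add: epow_mult TM_def mult_left_mono)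
  finally show ?thesis .
qed

text \<open>\<open>om t\<close> is replaced by its value at the left end \<open>b\<close>. The
  supremum \<open>S t\<close> is split at \<open>b\<close>: for z \<le> b the kernel is split by the
  triangle inequality, while z > b falls under \<open>local_sup_bound\<close>, and comparability of
  \<open>om\<close> then yields \<open>q2 (Suc n)\<close>.\<close>

lemma A2_block_comparable:
  assumes n: "om (\<tau> n) \<le> ennreal a * om (\<tau> (Suc n))"
  shows "(\<integral>\<^sup>+t\<in>{\<tau> n<..\<tau> (Suc n)}. (epow (om t) rp * S t) \<partial>\<mu>) \<le> K6 * (q1 n + q2 n + q2 (Suc n))"
proof -
  define b where "b = \<tau> n"
  define S' where "S' t = (SUP z\<in>{b<..t}. epow (k z t) q * epow (V z) rpc)" for t
  have [measurable]: "S' \<in> borel_measurable lebesgue"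
    unfolding S'_def using q_pos
    by (intro mono_lebesgue SUP_mono) (fastforce intro!: mult_right_mono epow_mono k_mono)
  have S_le: "S t \<le> TM * (S b + epow (k b t) q * epow (V b) rpc) + S' t" if t: "b < t" for t
    unfolding S_def[of t]
  proof (rule SUP_least)
    fix z assume z: "z \<in> {0<..t}"
    show "epow (k z t) q * epow (V z) rpc \<le> TM * (S b + epow (k b t) q * epow (V b) rpc) + S' t"
    proof (cases "z \<le> b")
      case True
      have "epow (k z t) q * epow (V z) rpc \<le> TM * (epow (k z b) q + epow (k b t) q) * epow (V z) rpc"
        using z True t by (intro mult_right_mono k_tri_epow) auto
      also have "\<dots> = TM * (epow (k z b) q * epow (V z) rpc + epow (k b t) q * epow (V z) rpc)"
        by (simp add: distrib_right distrib_left mult.assoc)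
      also have "\<dots> \<le> TM * (S b + epow (k b t) q * epow (V b) rpc)"
      proof (intro mult_left_mono add_mono)
        show "epow (k z b) q * epow (V z) rpc \<le> S b"
          unfolding S_def using z True by (intro SUP_upper) auto
        show "epow (V z) rpc \<le> epow (V b) rpc" using True exponents by (intro epow_mono V_mono) auto
      qed auto
      finally show ?thesis by (rule add_increasing2[rotated]) simp
    next
      case False
      then have "epow (k z t) q * epow (V z) rpc \<le> S' t"
        unfolding S'_def using z by (intro SUP_upper) auto
      then show ?thesis by (rule add_increasing[rotated]) simp
    qed
  qed
  define x where "x = epow (om b) rp"
  have x_om: "x * om b = epow (om b) rq"
    using epow_add[of rp 1 "om b"] exponents by (simp add: x_def rq_eq add.commute)
  have "(\<integral>\<^sup>+t\<in>{\<tau> n<..\<tau> (Suc n)}. (epow (om t) rp * S t) \<partial>\<mu>)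
    \<le> (\<integral>\<^sup>+t\<in>{b<..\<tau> (Suc n)}. (x * (TM * (S b + epow (k b t) q * epow (V b) rpc) + S' t)) \<partial>\<mu>)"
  proof (intro set_nn_integral_mono2)
    fix t assume t: "t \<in> {\<tau> n<..\<tau> (Suc n)}"
    then show "epow (om t) rp * S t \<le> x * (TM * (S b + epow (k b t) q * epow (V b) rpc) + S' t)"
      unfolding x_def using exponents by (intro mult_mono epow_mono om_anti S_le) (auto simp: b_def)
  qed (simp add: b_def)
  also have "\<dots> = x * (TM * (S b * emeasure \<mu> {b<..\<tau> (Suc n)}
      + (\<integral>\<^sup>+t\<in>{b<..\<tau> (Suc n)}. epow (k b t) q \<partial>\<mu>) * epow (V b) rpc) + (\<integral>\<^sup>+t\<in>{b<..\<tau> (Suc n)}. S' t \<partial>\<mu>))"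
    by (simp add: set_nn_integral_cmult set_nn_integral_add set_nn_integral_multc set_nn_integral_const)
  also have "\<dots> \<le> x * (TM * (S b * W b + om b * epow (V b) rpc) + 2 * epow (V (\<tau> (Suc n))) rpc * om b)"
  proof (intro mult_left_mono add_mono mult_right_mono)
    show "emeasure \<mu> {b<..\<tau> (Suc n)} \<le> W b" unfolding W_def by (intro emeasure_mono) auto
    show "(\<integral>\<^sup>+t\<in>{b<..\<tau> (Suc n)}. epow (k b t) q \<partial>\<mu>) \<le> om b"
      unfolding om_def by (intro set_nn_integral_mono2) auto
    show "(\<integral>\<^sup>+t\<in>{b<..\<tau> (Suc n)}. S' t \<partial>\<mu>) \<le> 2 * epow (V (\<tau> (Suc n))) rpc * om b"
      unfolding S'_def using exponents by (intro local_sup_bound epow_mono V_mono) auto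
  qed auto
  also have "\<dots> = TM * (x * S b * W b + x * om b * epow (V b) rpc) + 2 * (x * om b * epow (V (\<tau> (Suc n))) rpc)"
    by (simp add: distrib_left ac_simps)
  also have "x * om b * epow (V b) rpc = q2 n"
    by (simp only: x_om) (simp add: q2_def b_def)
  also have "x * om b * epow (V (\<tau> (Suc n))) rpc \<le> epow (ennreal a) rq * q2 (Suc n)"
  proof -
    have "epow (om b) rq \<le> epow (ennreal a) rq * epow (om (\<tau> (Suc n))) rq"
      using exponents n by (simp add: b_def epow_mult[symmetric] epow_mono)
    then show ?thesis unfolding x_om q2_def mult.assoc[symmetric] by (rule mult_right_mono) simp
  qed
  also have "x * S b * W b \<le> epow 2 rq * (q1 n + q2 n)"
  proof -
    have "x * S b * W b = (SUP z\<in>{0<..b}. x * (epow (k z b) q * epow (V z) rpc) * W b)"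
      unfolding S_def by (simp add: SUP_mult_left_ennreal SUP_mult_right_ennreal)
    also have "\<dots> \<le> epow 2 rq * (q1 n + q2 n)"
    proof (rule SUP_least)
      fix z assume z: "z \<in> {0<..b}"
      define Y where "Y = epow (k z b) q * W b"
      have "x * (epow (k z b) q * epow (V z) rpc) * W b = x * Y * epow (V z) rpc"
        by (simp add: Y_def ac_simps)
      also have "\<dots> \<le> epow (Y + om b) rp * Y * epow (V z) rpc"
        unfolding x_def using exponents by (intro mult_right_mono epow_mono) auto
      also have "\<dots> \<le> epow 2 rq * (epow Y rq + epow (om b) rq) * epow (V z) rpc"
        by (intro mult_right_mono epow_mixed_le) auto
      also have "\<dots> = epow 2 rq * (epow Y rq * epow (V z) rpc + epow (om b) rq * epow (V z) rpc)"
        by (simp add: distrib_right distrib_left mult.assoc)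
      also have "\<dots> \<le> epow 2 rq * (q1 n + q2 n)"
      proof (intro mult_left_mono add_mono)
        show "epow Y rq * epow (V z) rpc \<le> q1 n"
          unfolding Y_def q1_def using z by (simp add: kernel_weight_le flip: b_def)
        show "epow (om b) rq * epow (V z) rpc \<le> q2 n"
          unfolding q2_def b_def using z exponents by (intro mult_left_mono epow_mono V_mono) (auto simp: b_def)
      qed auto
      finally show "x * (epow (k z b) q * epow (V z) rpc) * W b \<le> epow 2 rq * (q1 n + q2 n)" .
    qed
    finally show ?thesis .
  qed
  finally have "(\<integral>\<^sup>+t\<in>{\<tau> n<..\<tau> (Suc n)}. (epow (om t) rp * S t) \<partial>\<mu>)
    \<le> TM * (epow 2 rq * (q1 n + q2 n) + q2 n) + 2 * (epow (ennreal a) rq * q2 (Suc n))"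
    by (auto simp: mult_left_mono add_mono)
  also have "\<dots> \<le> TM * (epow 2 rq * (q1 n + q2 n) + 1 * (q1 n + q2 n)) + 2 * epow (ennreal a) rq * q2 (Suc n)"
    by (intro add_mono mult_left_mono) (auto simp: mult.assoc)
  also have "\<dots> = TM * (epow 2 rq + 1) * (q1 n + q2 n) + 2 * epow (ennreal a) rq * q2 (Suc n)"
    by (simp only: distrib_right mult.assoc)
  also have "\<dots> \<le> K6 * (q1 n + q2 n) + K6 * q2 (Suc n)"
    unfolding K6_def by (intro add_mono mult_right_mono) auto
  finally show ?thesis by (simp add: distrib_left)
qed

lemma A2_le_sums: "A2 \<le> (K5 + K6) * (2 * (\<Sum>n. q1 n) + 2 * (\<Sum>n. q2 n))"
proof -
  have "A2 = (\<Sum>n. \<integral>\<^sup>+t\<in>{\<tau> n<..\<tau> (Suc n)}. (epow (om t) rp * S t) \<partial>\<mu>)"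
    unfolding A2_def by (rule integral_partition) simp
  also have "\<dots> \<le> (\<Sum>n. (K5 + K6) * ((q1 n + q2 n) + (q1 (Suc n) + q2 (Suc n))))"
  proof (intro suminf_le)
    fix n
    show "(\<integral>\<^sup>+t\<in>{\<tau> n<..\<tau> (Suc n)}. (epow (om t) rp * S t) \<partial>\<mu>)
      \<le> (K5 + K6) * ((q1 n + q2 n) + (q1 (Suc n) + q2 (Suc n)))"
      using tau_type[of n]
    proof (elim disjE conjE)
      assume "W (\<tau> n) = 2 * W (\<tau> (Suc n))"
      then have "(\<integral>\<^sup>+t\<in>{\<tau> n<..\<tau> (Suc n)}. (epow (om t) rp * S t) \<partial>\<mu>) \<le> K5 * (q1 (Suc n) + q2 (Suc n))"
        by (rule A2_block_halving)
      also have "\<dots> \<le> (K5 + K6) * ((q1 n + q2 n) + (q1 (Suc n) + q2 (Suc n)))"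
        by (intro mult_mono) auto
      finally show ?thesis .
    next
      assume "om (\<tau> n) \<le> ennreal a * om (\<tau> (Suc n))"
      then have "(\<integral>\<^sup>+t\<in>{\<tau> n<..\<tau> (Suc n)}. (epow (om t) rp * S t) \<partial>\<mu>) \<le> K6 * (q1 n + q2 n + q2 (Suc n))"
        by (rule A2_block_comparable)
      also have "\<dots> \<le> (K5 + K6) * ((q1 n + q2 n) + (q1 (Suc n) + q2 (Suc n)))"
        by (intro mult_mono add_mono) auto
      finally show ?thesis .
    qed
  qed auto
  also have "\<dots> = (K5 + K6) * (((\<Sum>n. q1 n) + (\<Sum>n. q2 n)) + ((\<Sum>n. q1 (Suc n)) + (\<Sum>n. q2 (Suc n))))"
    by (simp add: suminf_add[symmetric])
  also have "\<dots> \<le> (K5 + K6) * (((\<Sum>n. q1 n) + (\<Sum>n. q2 n)) + ((\<Sum>n. q1 n) + (\<Sum>n. q2 n)))"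
    using suminf_offset[of q1 1] suminf_offset[of q2 1] by (intro mult_left_mono add_mono) auto
  finally show ?thesis by (simp add: mult_2 ac_simps)
qed

end

section \<open>Two-sided bounds for a finite weight of bounded support\<close>

context hardy_core begin

text \<open>\<open>Kc\<close>, \<open>Cs\<close> and \<open>Cn\<close> are built from p, q and
  \<open>th\<close> alone; outside the locale the last two are
  \<open>hardy_core.Cs p q \<theta>\<close> and \<open>hardy_core.Cn p q \<theta>\<close>, common to
  all weights, kernels and truncations.\<close>

definition "Kc = epow 2 rq + Kq * (2 * epow (ennreal (a * a)) rp + 2 * epow 2 rq)"
definition "Cs = K1 * (2 * epow Kc (1 / rq))"
definition "Cn = (epow 2 rq + (K5 + K6) * (2 + 6 * Kq)) * (epow 2 rq * epow 2 rq)"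

lemma constants_fin: "Cs < top" "Cn < top"
proof -
  have "epow 2 rq < top" "epow (ennreal (a * a)) rp < top" "epow (ennreal a) rp < top" "epow (ennreal a) rq < top"
    "TM < top" "Kq < top"
    unfolding TM_def Kq_def
    by (rule epow_less_top, use exponents q_pos in \<open>simp_all add: ennreal_mult_less_top\<close>)+
  moreover from this have "epow Kc (1 / rq) < top"
    using exponents by (intro epow_less_top) (auto simp: Kc_def ennreal_mult_less_top)
  ultimately show "Cs < top" "Cn < top"
    by (auto simp: Cs_def Cn_def K1_def K5_def K6_def TM_def[symmetric] L_def ennreal_mult_less_top)
qed

lemma upper_bound:
  assumes f [measurable]: "f \<in> borel_measurable lebesgue"
    and v_fin: "AE x in lebesgue. 0 < x \<longrightarrow> v x < top" and fin: "A1 < top" "A2 < top"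
  shows "(\<integral>\<^sup>+t. epow (Tf f t) q \<partial>\<mu>) \<le> Cs * epow (A1 + A2) (1 / rq) *
     epow (\<integral>\<^sup>+x\<in>{0<..}. (epow (f x) p * v x) \<partial>lebesgue) (q / p)"
proof -
  obtain \<tau> where "hardy_blocks p q th N k v \<mu> \<tau>" using blocks_exist by blast
  then interpret hardy_blocks p q th N k v \<mu> \<tau> .
  have q1: "(\<Sum>n. q1 n) \<le> Kc * (A1 + A2)"
    using q1_le_A1 unfolding Kc_def by (rule order_trans) (intro mult_mono, auto)
  have step: "2 * epow (ennreal (a * a)) rp * A2 + 2 * (epow 2 rq * A1)
     \<le> (2 * epow (ennreal (a * a)) rp + 2 * epow 2 rq) * (A1 + A2)"
    unfolding distrib_right mult.assoc by (intro add_mono mult_left_mono) auto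
  have "(\<Sum>n. q2 n) \<le> Kq * ((2 * epow (ennreal (a * a)) rp + 2 * epow 2 rq) * (A1 + A2))"
    using q2_le_A by (rule order_trans) (intro mult_left_mono step zero_le)
  also have "\<dots> = (Kq * (2 * epow (ennreal (a * a)) rp + 2 * epow 2 rq)) * (A1 + A2)"
    by (simp only: mult.assoc)
  also have "\<dots> \<le> Kc * (A1 + A2)"
    unfolding Kc_def by (intro mult_right_mono) auto
  finally have q2: "(\<Sum>n. q2 n) \<le> Kc * (A1 + A2)" .
  have Kc_fin: "Kc < top"
    using exponents unfolding Kc_def Kq_def
    by (auto simp: ennreal_mult_less_top intro!: epow_less_top)
  then have "Kc * (A1 + A2) < top" using fin by (simp add: ennreal_mult_less_top)
  then have fin_sums: "(\<Sum>n. q1 n) < top" "(\<Sum>n. q2 n) < top" using q1 q2 by (auto intro: le_less_trans)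
  define F where "F = epow (\<integral>\<^sup>+x\<in>{0<..}. (epow (f x) p * v x) \<partial>lebesgue) (q / p)"
  have "epow (\<Sum>n. q1 n) (1 / rq) + epow (\<Sum>n. q2 n) (1 / rq)
    \<le> epow (Kc * (A1 + A2)) (1 / rq) + epow (Kc * (A1 + A2)) (1 / rq)"
    using exponents by (intro add_mono epow_mono q1 q2) auto
  also have "\<dots> = 2 * epow Kc (1 / rq) * epow (A1 + A2) (1 / rq)"
    using exponents by (simp add: epow_mult mult_2 distrib_right)
  finally have "K1 * (F * (epow (\<Sum>n. q1 n) (1 / rq) + epow (\<Sum>n. q2 n) (1 / rq)))
    \<le> K1 * (F * (2 * epow Kc (1 / rq) * epow (A1 + A2) (1 / rq)))"
    by (intro mult_left_mono) auto
  also have "\<dots> = Cs * epow (A1 + A2) (1 / rq) * F" by (simp add: Cs_def ac_simps)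
  finally show ?thesis
    using operator_bound_by_sums[OF f v_fin fin_sums] unfolding F_def by (rule order_trans[rotated])
qed

lemma lower_bound:
  assumes D: "hardy_bound D"
  shows "A1 + A2 \<le> Cn * ennreal (D powr rq)"
proof -
  have D0: "0 \<le> D" using D by (simp add: hardy_bound_def)
  define E where "E = epow 2 rq * epow 2 rq * ennreal (D powr rq)"
  have two: "ennreal ((2 * D) powr rq) = epow 2 rq * ennreal (D powr rq)"
    using D0 exponents epow_ennreal[of rq 2] by (simp add: powr_mult ennreal_mult)
  then have E1: "epow 2 rq * ennreal ((2 * D) powr rq) = E" by (simp add: E_def mult.assoc)
  have "1 \<le> epow 2 rq" using epow_mono[of rq 1 2] exponents by simp
  then have E2: "ennreal ((2 * D) powr rq) \<le> E"
    using mult_right_mono[of 1 "epow 2 rq" "ennreal ((2 * D) powr rq)"] by (simp add: E1)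
  \<comment> \<open>\<open>A1\<close> needs exact halving, which \<tau> does not provide on every
    block.\<close>
  obtain \<sigma> where s: "halving p q th N k v \<mu> \<sigma>" "\<And>n. W (\<sigma> n) = 2 * W (\<sigma> (Suc n))"
    using dyadic_halving_exists by blast
  interpret S: halving p q th N k v \<mu> \<sigma> by (rule s)
  have A1: "A1 \<le> epow 2 rq * E"
    using S.A1_le_q1[OF s(2)] S.q1_le_hardy[OF D] unfolding E1 by (meson mult_left_mono order_trans zero_le)
  obtain \<tau> where "hardy_blocks p q th N k v \<mu> \<tau>" using blocks_exist by blast
  then interpret hardy_blocks p q th N k v \<mu> \<tau> .
  have q1: "(\<Sum>n. q1 n) \<le> E" using q1_le_hardy[OF D] by (simp add: E1)
  have "(\<Sum>n. q2 n) \<le> Kq * (E + 2 * E)"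
    using q2_le_hardy[OF D] E2 unfolding E1 by (elim order_trans) (intro mult_left_mono add_right_mono, auto)
  also have "E + 2 * E = (1 + 2) * E" by (simp only: distrib_right mult_1)
  finally have q2: "(\<Sum>n. q2 n) \<le> 3 * Kq * E" by (simp add: ac_simps)
  have "A2 \<le> (K5 + K6) * (2 * E + 2 * (3 * Kq * E))"
    using A2_le_sums by (rule order_trans) (intro mult_left_mono add_mono q1 q2 zero_le)
  also have "2 * E + 2 * (3 * Kq * E) = (2 + 6 * Kq) * E"
    by (simp add: distrib_right mult.assoc[symmetric])
  finally have "A1 + A2 \<le> epow 2 rq * E + (K5 + K6) * ((2 + 6 * Kq) * E)" using A1 by (rule add_mono[rotated])
  also have "\<dots> = Cn * ennreal (D powr rq)" unfolding Cn_def E_def by (simp add: distrib_right mult.assoc)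
  finally show ?thesis .
qed

end

subsection \<open>Removing the truncation of the weight\<close>

lemma set_nn_integral_Ioc_Ioo:
  fixes f :: "real \<Rightarrow> ennreal"
  shows "(\<integral>\<^sup>+x\<in>{a<..b}. f x \<partial>lebesgue) = (\<integral>\<^sup>+x\<in>{a<..<b}. f x \<partial>lebesgue)"
proof (rule nn_integral_cong_AE)
  have "AE x in lebesgue. x \<notin> {b}" by (intro AE_not_in) (auto simp: null_sets_def)
  then show "AE x in lebesgue. f x * indicator {a<..b} x = f x * indicator {a<..<b} x"
    by eventually_elim (auto simp: indicator_def)
qed

text \<open>The integrand and the range grow simultaneously; by monotonicity the diagonal supremum
  equals the iterated one.\<close>

lemma set_nn_integral_exhaust:
  fixes X :: "nat \<Rightarrow> real \<Rightarrow> ennreal"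
  assumes [measurable]: "\<And>n. X n \<in> borel_measurable lebesgue" "c \<in> borel_measurable lebesgue"
    and inc: "\<And>t. incseq (\<lambda>n. X n t)"
  shows "(SUP n. \<integral>\<^sup>+t\<in>{0<..real (Suc n)}. (X n t * c t) \<partial>lebesgue)
      = (\<integral>\<^sup>+t\<in>{0<..}. ((SUP n. X n t) * c t) \<partial>lebesgue)"
proof -
  have inc': "m \<le> n \<Longrightarrow> X m t \<le> X n t" for m n t using inc[of t] by (auto simp: incseq_def)
  have "(SUP n. \<integral>\<^sup>+t\<in>{0<..real (Suc n)}. (X n t * c t) \<partial>lebesgue)
     = (\<integral>\<^sup>+t. (SUP n. X n t * c t * indicator {0<..real (Suc n)} t) \<partial>lebesgue)"
    by (rule nn_integral_monotone_convergence_SUP[symmetric])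
       (auto simp: incseq_def le_fun_def indicator_def intro!: mult_right_mono inc')
  also have "\<dots> = (\<integral>\<^sup>+t\<in>{0<..}. ((SUP n. X n t) * c t) \<partial>lebesgue)"
  proof (intro nn_integral_cong antisym)
    fix t
    show "(SUP n. X n t * c t * indicator {0<..real (Suc n)} t) \<le> (SUP n. X n t) * c t * indicator {0<..} t"
      by (intro SUP_least mult_mono SUP_upper) (auto simp: indicator_def)
    show "(SUP n. X n t) * c t * indicator {0<..} t \<le> (SUP n. X n t * c t * indicator {0<..real (Suc n)} t)"
    proof (cases "0 < t")
      case True
      obtain M :: nat where M: "t \<le> real M" using real_arch_simple by blast
      have "X n t * c t \<le> (SUP n. X n t * c t * indicator {0<..real (Suc n)} t)" for n
      proof -
        have "X n t * c t \<le> X (max n M) t * c t * indicator {0<..real (Suc (max n M))} t"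
          using True M by (auto intro!: mult_right_mono inc' simp: of_nat_max)
        then show ?thesis by (rule SUP_upper2[rotated]) simp
      qed
      then show ?thesis using True by (simp add: SUP_mult_right_ennreal SUP_least)
    qed simp
  qed
  finally show ?thesis .
qed

locale hardy_setting =
  fixes p q \<theta> :: real and v w :: "real \<Rightarrow> ennreal" and U :: "real \<Rightarrow> real \<Rightarrow> real"
  assumes q: "0 < q" "q < 1" "1 < p" and \<theta>: "0 < \<theta>"
    and v: "weight v" and w: "weight w" and U: "regular_kernel \<theta> U"
begin

definition "v0 x = v x * indicator {0<..} x"
definition "w0 x = w x * indicator {0<..} x"
text \<open>Clamping both arguments at 0 makes the monotonicity valid on the whole plane, as
  \<open>hardy_core\<close> demands.\<close>

definition "kk x y = ennreal (U (max 0 x) (max 0 y))"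
definition "mu n = density lebesgue (\<lambda>t. w0 t * indicator {0<..real (Suc n)} t)"

lemma Mplus_zero_extension:
  assumes "f \<in> Mplus" shows "(\<lambda>x. f x * indicator {0<..} x) \<in> borel_measurable lebesgue"
  using assms unfolding Mplus_def by (subst (asm) borel_measurable_restrict_space_iff_ennreal) auto

lemma v0_meas [measurable]: "v0 \<in> borel_measurable lebesgue"
  unfolding v0_def using v by (intro Mplus_zero_extension) (simp add: weight_def)

lemma w0_meas [measurable]: "w0 \<in> borel_measurable lebesgue"
  unfolding w0_def using w by (intro Mplus_zero_extension) (simp add: weight_def)

lemma mu_integral:
  assumes [measurable]: "h \<in> borel_measurable lebesgue"
  shows "(\<integral>\<^sup>+t. h t \<partial>mu n) = (\<integral>\<^sup>+t\<in>{0<..real (Suc n)}. (h t * w t) \<partial>lebesgue)"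
proof -
  have "(\<integral>\<^sup>+t. h t \<partial>mu n) = (\<integral>\<^sup>+t. w0 t * indicator {0<..real (Suc n)} t * h t \<partial>lebesgue)"
    unfolding mu_def by (rule nn_integral_density) measurable
  also have "\<dots> = (\<integral>\<^sup>+t\<in>{0<..real (Suc n)}. (h t * w t) \<partial>lebesgue)"
    by (intro nn_integral_cong) (auto simp: w0_def indicator_def ac_simps)
  finally show ?thesis .
qed

lemma mu_emeasure:
  assumes [measurable]: "A \<in> sets lebesgue"
  shows "emeasure (mu n) A = (\<integral>\<^sup>+t\<in>A. (w0 t * indicator {0<..real (Suc n)} t) \<partial>lebesgue)"
  unfolding mu_def by (rule emeasure_density) auto

lemma core: "hardy_core p q \<theta> (real (Suc n)) kk v0 (mu n)"
proof
  show "0 < q" "q < 1" "1 < p" "0 < \<theta>" using q \<theta> by auto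
  show "sets (mu n) = sets lebesgue" by (simp add: mu_def)
  show "emeasure (mu n) {x} = 0" for x
  proof -
    have "AE t in lebesgue. t \<notin> {x}" by (intro AE_not_in) (auto simp: null_sets_def)
    then have ae: "AE t in lebesgue. w0 t * indicator {0<..real (Suc n)} t * indicator {x} t = 0"
      by (auto elim!: eventually_mono)
    have "emeasure (mu n) {x} = nn_integral lebesgue (\<lambda>t :: real. 0)"
      unfolding mu_emeasure[OF interval_sets_lebesgue(9)] by (rule nn_integral_cong_AE[OF ae])
    then show ?thesis by simp
  qed
  have "emeasure (mu n) {..0} = nn_integral lebesgue (\<lambda>t :: real. 0)"
    unfolding mu_emeasure[OF interval_sets_lebesgue(3)] by (intro nn_integral_cong) (auto simp: indicator_def)
  then show "emeasure (mu n) {..0} = 0" by simp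
  have "emeasure (mu n) {real (Suc n)<..} = nn_integral lebesgue (\<lambda>t :: real. 0)"
    unfolding mu_emeasure[OF interval_sets_lebesgue(1)] by (intro nn_integral_cong) (auto simp: indicator_def)
  then show "emeasure (mu n) {real (Suc n)<..} = 0" by simp
  have mu_eq: "emeasure (mu n) {0<..} = (\<integral>\<^sup>+t\<in>{0<..<real (Suc n)}. w t \<partial>lebesgue)"
    unfolding mu_emeasure[OF interval_sets_lebesgue(1)] set_nn_integral_Ioc_Ioo[symmetric]
    by (intro nn_integral_cong) (auto simp: indicator_def w0_def)
  show "0 < emeasure (mu n) {0<..}" "emeasure (mu n) {0<..} < top"
    using w unfolding mu_eq weight_def by auto
  have Un: "0 \<le> x \<Longrightarrow> 0 \<le> y \<Longrightarrow> 0 \<le> U x y" for x y using U by (simp add: regular_kernel_def)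
  show "kk x y < top" for x y by (simp add: kk_def)
  show "kk x' y \<le> kk x y" if "x \<le> x'" for x x' y
    using U that unfolding kk_def regular_kernel_def by (intro ennreal_leI) auto
  show "kk x y \<le> kk x y'" if "y \<le> y'" for x y y'
    using U that unfolding kk_def regular_kernel_def by (intro ennreal_leI) auto
  show "kk x z \<le> ennreal \<theta> * (kk x y + kk y z)" if "0 \<le> x" "x < y" "y < z" for x y z
  proof -
    have "U x z \<le> \<theta> * (U x y + U y z)" using U that by (auto simp: regular_kernel_def)
    then have "ennreal (U x z) \<le> ennreal (\<theta> * (U x y + U y z))" by (rule ennreal_leI)
    also have "\<dots> = ennreal \<theta> * (ennreal (U x y) + ennreal (U y z))"
      using \<theta> Un that by (simp add: ennreal_mult)
    finally show ?thesis using that by (simp add: kk_def)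
  qed
qed simp

text \<open>Local integrability of the weight on countably many intervals; this is the finiteness
  that \<open>weighted_Hoelder\<close> assumes.\<close>

lemma v_fin: "AE x in lebesgue. 0 < x \<longrightarrow> v0 x < top"
proof -
  have "AE x in lebesgue. v0 x * indicator {0<..<real (Suc n)} x \<noteq> \<infinity>" for n
  proof (rule nn_integral_noteq_infinite)
    have "(\<integral>\<^sup>+x\<in>{0<..<real (Suc n)}. v0 x \<partial>lebesgue) = (\<integral>\<^sup>+x\<in>{0<..<real (Suc n)}. v x \<partial>lebesgue)"
      by (intro nn_integral_cong) (auto simp: indicator_def v0_def)
    then show "(\<integral>\<^sup>+x\<in>{0<..<real (Suc n)}. v0 x \<partial>lebesgue) \<noteq> \<infinity>"
      using v by (simp add: weight_def less_top)
  qed simp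
  then have "AE x in lebesgue. \<forall>n. v0 x * indicator {0<..<real (Suc n)} x \<noteq> \<infinity>"
    by (simp add: AE_all_countable)
  then show ?thesis
  proof eventually_elim
    case (elim x)
    obtain n :: nat where "x < real n" using reals_Archimedean2 by blast
    then show ?case using elim[rule_format, of n] by (auto simp: less_top[symmetric] indicator_def)
  qed
qed

definition "T f t = (\<integral>\<^sup>+x\<in>{0<..<t}. (f x * ennreal (U x t)) \<partial>lebesgue)"
definition "Nf f = (\<integral>\<^sup>+t\<in>{0<..}. (epow (f t) p * v t) \<partial>lebesgue)"

lemma Tf_eq: "hardy_core.Tf kk (\<lambda>x. f x * indicator {0<..} x) t = T f t"
proof -
  interpret hardy_core p q \<theta> "real (Suc 0)" kk v0 "mu 0" by (rule core)
  show ?thesis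
    unfolding Tf_def T_def set_nn_integral_Ioc_Ioo
    by (intro nn_integral_cong) (auto simp: indicator_def kk_def)
qed

lemma T_meas [measurable]: "T f \<in> borel_measurable lebesgue"
proof -
  interpret hardy_core p q \<theta> "real (Suc 0)" kk v0 "mu 0" by (rule core)
  have "T f = Tf (\<lambda>x. f x * indicator {0<..} x)" by (simp add: Tf_eq fun_eq_iff)
  then show ?thesis by simp
qed

lemma Nf_eq: "(\<integral>\<^sup>+x\<in>{0<..}. (epow (f x * indicator {0<..} x) p * v0 x) \<partial>lebesgue) = Nf f"
  unfolding Nf_def by (intro nn_integral_cong) (auto simp: indicator_def v0_def)

lemma hardy_iff:
  "hardy_ineq p q U v w C \<longleftrightarrow> (\<forall>f\<in>Mplus. (\<integral>\<^sup>+t\<in>{0<..}. (epow (T f t) q * w t) \<partial>lebesgue) \<le> epow C q * epow (Nf f) (q / p))"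
proof -
  have "epow I (1 / q) \<le> C * epow N (1 / p) \<longleftrightarrow> I \<le> epow C q * epow N (q / p)" for I N
    using q by (simp add: epow_le_swap epow_mult epow_epow)
  then show ?thesis by (simp add: hardy_ineq_def T_def Nf_def)
qed

lemma T_integral_SUP:
  "(\<integral>\<^sup>+t\<in>{0<..}. (epow (T f t) q * w t) \<partial>lebesgue) = (SUP n. \<integral>\<^sup>+t. epow (T f t) q \<partial>mu n)"
proof -
  have "(\<integral>\<^sup>+t. epow (T f t) q \<partial>mu n) = (\<integral>\<^sup>+t\<in>{0<..real (Suc n)}. (epow (T f t) q * w0 t) \<partial>lebesgue)" for n
    by (subst mu_integral) (auto intro!: nn_integral_cong simp: w0_def indicator_def)
  then have "(SUP n. \<integral>\<^sup>+t. epow (T f t) q \<partial>mu n) = (\<integral>\<^sup>+t\<in>{0<..}. (epow (T f t) q * w0 t) \<partial>lebesgue)"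
    using set_nn_integral_exhaust[of "\<lambda>n t. epow (T f t) q" w0] by (simp add: incseq_def)
  also have "\<dots> = (\<integral>\<^sup>+t\<in>{0<..}. (epow (T f t) q * w t) \<partial>lebesgue)"
    by (intro nn_integral_cong) (auto simp: w0_def indicator_def)
  finally show ?thesis by simp
qed

section \<open>Monotone convergence of the truncated characteristic integrals\<close>

abbreviation "A1n n \<equiv> hardy_core.A1 p q kk v0 (mu n)"
abbreviation "A2n n \<equiv> hardy_core.A2 p q kk v0 (mu n)"

lemma rq_r: "0 < r_exp p q" "r_exp p q / p = q / (p - q)" "r_exp p q / conj_exp p = q * (p - 1) / (p - q)"
  "q * (p / (p - q)) = r_exp p q"
  using q by (auto simp: r_exp_def conj_exp_def field_simps)

lemma mu_mono: "m \<le> n \<Longrightarrow> (\<integral>\<^sup>+t\<in>A. h t \<partial>mu m) \<le> (\<integral>\<^sup>+t\<in>A. h t \<partial>mu n)"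
  if [measurable]: "A \<in> sets lebesgue" "h \<in> borel_measurable lebesgue" for A h
  by (subst (1 2) mu_integral) (auto intro!: nn_integral_mono simp: indicator_def)

text \<open>Truncation affects only the outer range and the factor \<open>W\<close>;
  \<open>Ph\<close> involves v alone. Both affected pieces increase with n.\<close>

lemma A1_SUP: "A1_star p q U v w = (SUP n. A1n n)" and A1_inc: "incseq A1n"
proof -
  interpret C: hardy_core p q \<theta> "real (Suc 0)" kk v0 "mu 0" by (rule core)
  define X where "X n t = epow (hardy_core.W (mu n) t) C.rp" for n t
  define c where "c t = epow (C.Ph t) C.rpc * w0 t" for t
  have [measurable]: "X n \<in> borel_measurable lebesgue" for n
  proof -
    interpret hardy_core p q \<theta> "real (Suc n)" kk v0 "mu n" by (rule core)
    show ?thesis unfolding X_def by measurable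
  qed
  have W_eq: "hardy_core.W (mu n) t = (\<integral>\<^sup>+x\<in>{t<..}. 1 \<partial>mu n)" for n t
  proof -
    interpret hardy_core p q \<theta> "real (Suc n)" kk v0 "mu n" by (rule core)
    show ?thesis unfolding W_def by simp
  qed
  have W_inc: "hardy_core.W (mu m) t \<le> hardy_core.W (mu n) t" if "m \<le> n" for m n t
    unfolding W_eq using that by (intro mu_mono) auto
  have X_inc: "incseq (\<lambda>n. X n t)" for t
    unfolding X_def incseq_def using W_inc C.exponents by (auto intro: epow_mono)
  have A1n_eq: "A1n n = (\<integral>\<^sup>+t\<in>{0<..real (Suc n)}. (X n t * c t) \<partial>lebesgue)" for n
  proof -
    interpret hardy_core p q \<theta> "real (Suc n)" kk v0 "mu n" by (rule core)
    show ?thesis unfolding A1_def X_def c_def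
      by (subst mu_integral) (auto intro!: nn_integral_cong simp: w0_def indicator_def ac_simps)
  qed
  show "incseq A1n"
    unfolding A1n_eq incseq_def using X_inc
    by (auto intro!: set_nn_integral_mono2 mult_right_mono simp: incseq_def)
  have W_SUP: "(SUP n. hardy_core.W (mu n) t) = (\<integral>\<^sup>+x\<in>{t<..}. w x \<partial>lebesgue)" if "0 < t" for t
  proof -
    have "hardy_core.W (mu n) t = (\<integral>\<^sup>+x\<in>{0<..real (Suc n)}. (indicator {t<..} x * w0 x) \<partial>lebesgue)" for n
      unfolding W_eq by (subst mu_integral) (auto intro!: nn_integral_cong simp: w0_def indicator_def)
    then have "(SUP n. hardy_core.W (mu n) t) = (\<integral>\<^sup>+x\<in>{0<..}. (indicator {t<..} x * w0 x) \<partial>lebesgue)"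
      using set_nn_integral_exhaust[of "\<lambda>n x. indicator {t<..} x" w0] by (simp add: incseq_def)
    also have "\<dots> = (\<integral>\<^sup>+x\<in>{t<..}. w x \<partial>lebesgue)"
      using that by (intro nn_integral_cong) (auto simp: w0_def indicator_def)
    finally show ?thesis .
  qed
  have Ph: "C.Ph t = (\<integral>\<^sup>+z\<in>{0<..<t}. (epow (ennreal (U z t)) (conj_exp p) * epow (v z) (1 - conj_exp p)) \<partial>lebesgue)" for t
    unfolding C.Ph_def C.sg_def C.pc_def conj_exp_def set_nn_integral_Ioc_Ioo
    by (intro nn_integral_cong) (auto simp: indicator_def v0_def kk_def)
  have "(SUP n. A1n n) = (\<integral>\<^sup>+t\<in>{0<..}. ((SUP n. X n t) * c t) \<partial>lebesgue)"
    unfolding A1n_eq by (rule set_nn_integral_exhaust) (use X_inc in \<open>auto simp: c_def\<close>)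
  also have "\<dots> = A1_star p q U v w"
    unfolding A1_star_def Let_def rq_r
  proof (intro nn_integral_cong)
    fix t
    show "(SUP n. X n t) * c t * indicator {0<..} t = epow (\<integral>\<^sup>+x\<in>{t<..}. w x \<partial>lebesgue) (q / (p - q)) * w t *
        epow (\<integral>\<^sup>+z\<in>{0<..<t}. (epow (ennreal (U z t)) (conj_exp p) * epow (v z) (1 - conj_exp p)) \<partial>lebesgue) (q * (p - 1) / (p - q))
        * indicator {0<..} t"
    proof (cases "0 < t")
      case True
      have "(SUP n. X n t) = epow (\<integral>\<^sup>+x\<in>{t<..}. w x \<partial>lebesgue) C.rp"
        unfolding X_def W_SUP[OF True, symmetric] using C.exponents by (intro epow_SUP[symmetric]) auto
      then show ?thesis using True by (simp add: c_def Ph C.rp_def C.rpc_def w0_def ac_simps)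
    qed simp
  qed
  finally show "A1_star p q U v w = (SUP n. A1n n)" by simp
qed

lemma A2_SUP: "A2_star p q U v w = (SUP n. A2n n)" and A2_inc: "incseq A2n"
proof -
  interpret C: hardy_core p q \<theta> "real (Suc 0)" kk v0 "mu 0" by (rule core)
  define X where "X n t = epow (hardy_core.om q kk (mu n) t) C.rp" for n t
  define c where "c t = C.S t * w0 t" for t
  have [measurable]: "X n \<in> borel_measurable lebesgue" for n
  proof -
    interpret hardy_core p q \<theta> "real (Suc n)" kk v0 "mu n" by (rule core)
    show ?thesis unfolding X_def by measurable
  qed
  have om_eq: "hardy_core.om q kk (mu n) t = (\<integral>\<^sup>+x\<in>{t<..}. epow (kk t x) q \<partial>mu n)" for n t
  proof -
    interpret hardy_core p q \<theta> "real (Suc n)" kk v0 "mu n" by (rule core)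
    show ?thesis unfolding om_def by simp
  qed
  have om_inc: "hardy_core.om q kk (mu m) t \<le> hardy_core.om q kk (mu n) t" if "m \<le> n" for m n t
    unfolding om_eq using that by (intro mu_mono) auto
  have X_inc: "incseq (\<lambda>n. X n t)" for t
    unfolding X_def incseq_def using om_inc C.exponents by (auto intro: epow_mono)
  have A2n_eq: "A2n n = (\<integral>\<^sup>+t\<in>{0<..real (Suc n)}. (X n t * c t) \<partial>lebesgue)" for n
  proof -
    interpret hardy_core p q \<theta> "real (Suc n)" kk v0 "mu n" by (rule core)
    show ?thesis unfolding A2_def X_def c_def
      by (subst mu_integral) (auto intro!: nn_integral_cong simp: w0_def indicator_def ac_simps)
  qed
  show "incseq A2n"
    unfolding A2n_eq incseq_def using X_inc
    by (auto intro!: set_nn_integral_mono2 mult_right_mono simp: incseq_def)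
  have om_SUP: "(SUP n. hardy_core.om q kk (mu n) t) = (\<integral>\<^sup>+x\<in>{t<..}. (w x * epow (ennreal (U t x)) q) \<partial>lebesgue)" if "0 < t" for t
  proof -
    have "hardy_core.om q kk (mu n) t = (\<integral>\<^sup>+x\<in>{0<..real (Suc n)}. (epow (kk t x) q * indicator {t<..} x * w0 x) \<partial>lebesgue)" for n
      unfolding om_eq by (subst mu_integral) (auto intro!: nn_integral_cong simp: w0_def indicator_def)
    then have "(SUP n. hardy_core.om q kk (mu n) t) = (\<integral>\<^sup>+x\<in>{0<..}. (epow (kk t x) q * indicator {t<..} x * w0 x) \<partial>lebesgue)"
      using set_nn_integral_exhaust[of "\<lambda>n x. epow (kk t x) q * indicator {t<..} x" w0] by (simp add: incseq_def)
    also have "\<dots> = (\<integral>\<^sup>+x\<in>{t<..}. (w x * epow (ennreal (U t x)) q) \<partial>lebesgue)"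
      using that by (intro nn_integral_cong) (auto simp: w0_def indicator_def kk_def ac_simps)
    finally show ?thesis .
  qed
  have V: "C.V z = (\<integral>\<^sup>+s\<in>{0<..<z}. epow (v s) (1 - conj_exp p) \<partial>lebesgue)" for z
    unfolding C.V_def C.sg_def C.pc_def conj_exp_def set_nn_integral_Ioc_Ioo
    by (intro nn_integral_cong) (auto simp: indicator_def v0_def)
  have "(SUP n. A2n n) = (\<integral>\<^sup>+t\<in>{0<..}. ((SUP n. X n t) * c t) \<partial>lebesgue)"
    unfolding A2n_eq by (rule set_nn_integral_exhaust) (use X_inc in \<open>auto simp: c_def\<close>)
  also have "\<dots> = A2_star p q U v w"
    unfolding A2_star_def Let_def rq_r
  proof (intro nn_integral_cong)
    fix t
    show "(SUP n. X n t) * c t * indicator {0<..} t =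
        epow (\<integral>\<^sup>+x\<in>{t<..}. (w x * epow (ennreal (U t x)) q) \<partial>lebesgue) (q / (p - q)) * w t *
         (SUP z\<in>{0<..t}. epow (ennreal (U z t)) q *
            epow (\<integral>\<^sup>+s\<in>{0<..<z}. epow (v s) (1 - conj_exp p) \<partial>lebesgue) (q * (p - 1) / (p - q))) * indicator {0<..} t"
    proof (cases "0 < t")
      case True
      have "(SUP n. X n t) = epow (\<integral>\<^sup>+x\<in>{t<..}. (w x * epow (ennreal (U t x)) q) \<partial>lebesgue) C.rp"
        unfolding X_def om_SUP[OF True, symmetric] using C.exponents by (intro epow_SUP[symmetric]) auto
      moreover have "C.S t = (SUP z\<in>{0<..t}. epow (ennreal (U z t)) q *
            epow (\<integral>\<^sup>+s\<in>{0<..<z}. epow (v s) (1 - conj_exp p) \<partial>lebesgue) (q * (p - 1) / (p - q)))"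
        unfolding C.S_def V C.rpc_def using True by (intro SUP_cong) (auto simp: kk_def)
      ultimately show ?thesis using True by (simp add: c_def C.rp_def w0_def ac_simps)
    qed simp
  qed
  finally show "A2_star p q U v w = (SUP n. A2n n)" by simp
qed

lemma A_SUP: "A1_star p q U v w + A2_star p q U v w = (SUP n. A1n n + A2n n)"
  unfolding A1_SUP A2_SUP by (rule ennreal_SUP_add[symmetric, OF A1_inc A2_inc])

lemma hardy_upper:
  assumes fin: "A1_star p q U v w < top" "A2_star p q U v w < top"
  shows "hardy_ineq p q U v w (epow (hardy_core.Cs p q \<theta>) (1 / q) * epow (A1_star p q U v w + A2_star p q U v w) (1 / r_exp p q))"
  unfolding hardy_iff
proof
  fix f assume f: "f \<in> Mplus"
  define A where "A = A1_star p q U v w + A2_star p q U v w"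
  have bound: "(\<integral>\<^sup>+t. epow (T f t) q \<partial>mu n) \<le> hardy_core.Cs p q \<theta> * epow A (1 / (p / (p - q))) * epow (Nf f) (q / p)" for n
  proof -
    interpret hardy_core p q \<theta> "real (Suc n)" kk v0 "mu n" by (rule core)
    have le: "A1 + A2 \<le> A" unfolding A_def A_SUP by (rule SUP_upper) simp
    have "A1 < top" "A2 < top"
      using fin SUP_upper[of n UNIV A1n] SUP_upper[of n UNIV A2n] unfolding A1_SUP A2_SUP by (auto intro: le_less_trans)
    then have "(\<integral>\<^sup>+t. epow (T f t) q \<partial>mu n) \<le> Cs * epow (A1 + A2) (1 / rq) * epow (Nf f) (q / p)"
      using upper_bound[OF Mplus_zero_extension[OF f] v_fin] by (simp add: Tf_eq Nf_eq)
    also have "\<dots> \<le> Cs * epow A (1 / rq) * epow (Nf f) (q / p)"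
      using exponents by (intro mult_right_mono mult_left_mono epow_mono le) auto
    finally show ?thesis by (simp add: rq_def)
  qed
  have E: "epow (epow (hardy_core.Cs p q \<theta>) (1 / q) * epow A (1 / r_exp p q)) q = hardy_core.Cs p q \<theta> * epow A (1 / (p / (p - q)))"
  proof -
    have e: "1 / r_exp p q * q = 1 / (p / (p - q))" using q by (simp add: r_exp_def field_simps)
    have "epow (epow A (1 / r_exp p q)) q = epow A (1 / (p / (p - q)))"
      using epow_epow[of "1 / r_exp p q" q A] q rq_r(1) unfolding e by simp
    then show ?thesis using q by (simp add: epow_mult epow_epow)
  qed
  show "(\<integral>\<^sup>+t\<in>{0<..}. (epow (T f t) q * w t) \<partial>lebesgue) \<le>
     epow (epow (hardy_core.Cs p q \<theta>) (1 / q) * epow (A1_star p q U v w + A2_star p q U v w) (1 / r_exp p q)) q * epow (Nf f) (q / p)"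
    unfolding T_integral_SUP A_def[symmetric] E by (rule SUP_least) (rule bound)
qed

lemma hardy_lower:
  assumes C: "hardy_ineq p q U v w C" "C < top"
  shows "A1_star p q U v w + A2_star p q U v w \<le> hardy_core.Cn p q \<theta> * epow C (r_exp p q)"
  unfolding A_SUP
proof (rule SUP_least)
  fix n
  interpret hardy_core p q \<theta> "real (Suc n)" kk v0 "mu n" by (rule core)
  obtain c where c: "C = ennreal c" "0 \<le> c" using C(2) by (cases C) auto
  have "hardy_bound (c powr q)"
    unfolding hardy_bound_def
  proof (intro conjI ballI)
    fix f :: "real \<Rightarrow> ennreal" assume f: "f \<in> borel_measurable lebesgue"
    then have fM: "f \<in> Mplus" unfolding Mplus_def by (rule measurable_restrict_space1)
    have Tf: "Tf f t = T f t" for t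
      unfolding Tf_def T_def set_nn_integral_Ioc_Ioo
      by (intro nn_integral_cong) (auto simp: indicator_def kk_def)
    have "(\<integral>\<^sup>+t. epow (Tf f t) q \<partial>mu n) \<le> (\<integral>\<^sup>+t\<in>{0<..}. (epow (T f t) q * w t) \<partial>lebesgue)"
      unfolding Tf T_integral_SUP by (rule SUP_upper) simp
    also have "\<dots> \<le> epow C q * epow (Nf f) (q / p)" using C(1) fM unfolding hardy_iff by blast
    also have "epow C q = ennreal (c powr q)" using q c by (simp add: epow_ennreal)
    also have "Nf f = (\<integral>\<^sup>+x\<in>{0<..}. (epow (f x) p * v0 x) \<partial>lebesgue)"
      unfolding Nf_def by (intro nn_integral_cong) (auto simp: indicator_def v0_def)
    finally show "(\<integral>\<^sup>+t. epow (Tf f t) q \<partial>mu n) \<le> ennreal (c powr q) * epow (\<integral>\<^sup>+x\<in>{0<..}. (epow (f x) p * v0 x) \<partial>lebesgue) (q / p)" .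
  qed simp
  then have "A1 + A2 \<le> Cn * ennreal ((c powr q) powr rq)" by (rule lower_bound)
  also have "ennreal ((c powr q) powr rq) = epow C (r_exp p q)"
    using c rq_r by (simp add: epow_ennreal powr_powr rq_def)
  finally show "A1n n + A2n n \<le> hardy_core.Cn p q \<theta> * epow C (r_exp p q)" .
qed

section \<open>The least constant and the equivalence\<close>

lemma constants_finite: "hardy_core.Cs p q \<theta> < top" "hardy_core.Cn p q \<theta> < top"
  using hardy_core.constants_fin[OF core] by auto

text \<open>The constant \<open>Cs\<close> enters C through its power 1/q and hence C^r through r/q
  = p/(p - q), which explains the condition on \<open>c\<close>. If one of the integrals is
  infinite, so is the right side, because c > 0.\<close>

lemma best_const_upper:
  assumes c: "hardy_core.Cs p q \<theta> \<le> ennreal b" "0 < b" "ennreal (b powr (p / (p - q))) \<le> ennreal c" "0 < c"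
  shows "epow (best_const p q U v w) (r_exp p q) \<le> ennreal c * (A1_star p q U v w + A2_star p q U v w)"
proof (cases "A1_star p q U v w < top \<and> A2_star p q U v w < top")
  case True
  define A where "A = A1_star p q U v w + A2_star p q U v w"
  have "best_const p q U v w \<le> epow (hardy_core.Cs p q \<theta>) (1 / q) * epow A (1 / r_exp p q)"
    unfolding best_const_def A_def by (rule Inf_lower) (use hardy_upper True in simp)
  also have "\<dots> \<le> epow (ennreal b) (1 / q) * epow A (1 / r_exp p q)"
    using q c by (intro mult_right_mono epow_mono) auto
  finally have "epow (best_const p q U v w) (r_exp p q) \<le> epow (epow (ennreal b) (1 / q) * epow A (1 / r_exp p q)) (r_exp p q)"
    using rq_r by (intro epow_mono) auto
  also have "\<dots> = epow (ennreal b) (p / (p - q)) * A"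
  proof -
    have e: "1 / q * r_exp p q = p / (p - q)" using q by (simp add: r_exp_def)
    have "epow (epow (ennreal b) (1 / q)) (r_exp p q) = epow (ennreal b) (p / (p - q))"
      using epow_epow[of "1 / q" "r_exp p q" "ennreal b"] q rq_r(1) unfolding e by simp
    then show ?thesis using rq_r(1) by (simp add: epow_mult epow_epow)
  qed
  also have "\<dots> \<le> ennreal c * A"
    using c q by (intro mult_right_mono) (auto simp: epow_ennreal)
  finally show ?thesis by (simp add: A_def)
next
  case False
  then have "A1_star p q U v w + A2_star p q U v w = top" by (auto simp: not_less top_unique)
  then show ?thesis using c by (auto simp: ennreal_mult_top)
qed

text \<open>Solved for C, the lower bound says that the power 1/r of \<open>A / ennreal c\<close>
  lies below every admissible constant, finite or not, and so below the infimum.\<close>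

lemma best_const_lower:
  assumes c: "hardy_core.Cn p q \<theta> \<le> ennreal c" "0 < c"
  shows "A1_star p q U v w + A2_star p q U v w \<le> ennreal c * epow (best_const p q U v w) (r_exp p q)"
proof -
  define A where "A = A1_star p q U v w + A2_star p q U v w"
  have "epow (A / ennreal c) (1 / r_exp p q) \<le> best_const p q U v w"
    unfolding best_const_def
  proof (rule Inf_greatest)
    fix C assume "C \<in> {C. hardy_ineq p q U v w C}"
    then have C: "hardy_ineq p q U v w C" by simp
    show "epow (A / ennreal c) (1 / r_exp p q) \<le> C"
    proof (cases "C < top")
      case True
      have "A \<le> ennreal c * epow C (r_exp p q)"
        using hardy_lower[OF C True] unfolding A_def by (rule order_trans) (intro mult_right_mono c zero_le)
      then have "A / ennreal c \<le> epow C (r_exp p q)"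
        using c by (intro divide_le_posI_ennreal) (auto simp: mult.commute)
      then show ?thesis using rq_r by (simp add: epow_le_swap)
    qed (simp add: not_less top_unique)
  qed
  then have "A / ennreal c \<le> epow (best_const p q U v w) (r_exp p q)"
    using rq_r by (simp add: epow_le_swap)
  then have "ennreal c * (A / ennreal c) \<le> ennreal c * epow (best_const p q U v w) (r_exp p q)"
    by (rule mult_left_mono) simp
  moreover have "ennreal c * (A / ennreal c) = A"
    using c by (simp add: ennreal_times_divide mult.commute[of "ennreal c"] mult_divide_eq_ennreal)
  ultimately show ?thesis by (simp add: A_def)
qed

lemma hardy_iff_finite:
  "(\<exists>C. 0 < C \<and> C < \<infinity> \<and> hardy_ineq p q U v w C) \<longleftrightarrow> A1_star p q U v w < \<infinity> \<and> A2_star p q U v w < \<infinity>"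
proof
  assume "\<exists>C. 0 < C \<and> C < \<infinity> \<and> hardy_ineq p q U v w C"
  then obtain C where C: "hardy_ineq p q U v w C" "C < top" by auto
  have "A1_star p q U v w + A2_star p q U v w < top"
    using hardy_lower[OF C] constants_finite epow_less_top[OF rq_r(1) C(2)]
    by (elim le_less_trans) (simp add: ennreal_mult_less_top)
  then show "A1_star p q U v w < \<infinity> \<and> A2_star p q U v w < \<infinity>" by simp
next
  assume fin: "A1_star p q U v w < \<infinity> \<and> A2_star p q U v w < \<infinity>"
  define C where "C = epow (hardy_core.Cs p q \<theta>) (1 / q) * epow (A1_star p q U v w + A2_star p q U v w) (1 / r_exp p q)"
  have C: "hardy_ineq p q U v w C" unfolding C_def using fin by (intro hardy_upper) auto
  have "epow (hardy_core.Cs p q \<theta>) (1 / q) < top" "epow (A1_star p q U v w + A2_star p q U v w) (1 / r_exp p q) < top"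
    using q rq_r constants_finite fin by (auto intro!: epow_less_top)
  then have "C < top" unfolding C_def by (simp add: ennreal_mult_less_top)
  \<comment> \<open>Enlarging the constant by 1 secures positivity without inspecting the two
    integrals.\<close>
  moreover have "hardy_ineq p q U v w (C + 1)"
    unfolding hardy_iff
  proof
    fix f assume "f \<in> Mplus"
    then have "(\<integral>\<^sup>+t\<in>{0<..}. (epow (T f t) q * w t) \<partial>lebesgue) \<le> epow C q * epow (Nf f) (q / p)"
      using C unfolding hardy_iff by blast
    also have "\<dots> \<le> epow (C + 1) q * epow (Nf f) (q / p)"
      using q by (intro mult_right_mono epow_mono) auto
    finally show "(\<integral>\<^sup>+t\<in>{0<..}. (epow (T f t) q * w t) \<partial>lebesgue) \<le> epow (C + 1) q * epow (Nf f) (q / p)" .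
  qed
  ultimately show "\<exists>C. 0 < C \<and> C < \<infinity> \<and> hardy_ineq p q U v w C"
    by (intro exI[of _ "C + 1"]) (auto simp: add_pos_nonneg zero_less_iff_neq_zero)
qed

end

theorem corollary9:
  fixes p q \<theta> :: real
  assumes "0 < q" and "q < 1" and "1 < p" and "0 < \<theta>"
  shows "(\<forall>v w U. weight v \<and> weight w \<and> regular_kernel \<theta> U \<longrightarrow>
            ((\<exists>C. 0 < C \<and> C < \<infinity> \<and> hardy_ineq p q U v w C) \<longleftrightarrow>
            (A1_star p q U v w < \<infinity> \<and> A2_star p q U v w < \<infinity>)))
       \<and> (\<exists>c>0. \<forall>v w U. weight v \<and> weight w \<and> regular_kernel \<theta> U \<longrightarrow>
            epow (best_const p q U v w) (r_exp p q)
              \<le> ennreal c * (A1_star p q U v w + A2_star p q U v w) \<and>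
            A1_star p q U v w + A2_star p q U v w
              \<le> ennreal c * epow (best_const p q U v w) (r_exp p q))"
proof (intro conjI allI impI)
  fix v w :: "real \<Rightarrow> ennreal" and U :: "real \<Rightarrow> real \<Rightarrow> real"
  assume "weight v \<and> weight w \<and> regular_kernel \<theta> U"
  then interpret hardy_setting p q \<theta> v w U using assms by unfold_locales auto
  show "(\<exists>C. 0 < C \<and> C < \<infinity> \<and> hardy_ineq p q U v w C) \<longleftrightarrow>
            (A1_star p q U v w < \<infinity> \<and> A2_star p q U v w < \<infinity>)"
    by (rule hardy_iff_finite)
next
  define b where "b = enn2real (hardy_core.Cs p q \<theta>) + 1"
  \<comment> \<open>One constant for both directions: the first summand serves
    \<open>best_const_upper\<close>, the second \<open>best_const_lower\<close>. The 1 added in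
    \<open>b\<close> makes \<open>b\<close> and \<open>c\<close> positive.\<close>
  define c where "c = b powr (p / (p - q)) + enn2real (hardy_core.Cn p q \<theta>)"
  have b: "0 < b" unfolding b_def by (simp add: add_nonneg_pos)
  then have c: "0 < c" unfolding c_def by (simp add: add_pos_nonneg)
  show "\<exists>c>0. \<forall>v w U. weight v \<and> weight w \<and> regular_kernel \<theta> U \<longrightarrow>
            epow (best_const p q U v w) (r_exp p q)
              \<le> ennreal c * (A1_star p q U v w + A2_star p q U v w) \<and>
            A1_star p q U v w + A2_star p q U v w
              \<le> ennreal c * epow (best_const p q U v w) (r_exp p q)"
  proof (rule exI[of _ c], intro conjI[OF c] allI impI)
    fix v w :: "real \<Rightarrow> ennreal" and U :: "real \<Rightarrow> real \<Rightarrow> real"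
    assume "weight v \<and> weight w \<and> regular_kernel \<theta> U"
    then interpret hardy_setting p q \<theta> v w U using assms by unfold_locales auto
    have "hardy_core.Cs p q \<theta> = ennreal (enn2real (hardy_core.Cs p q \<theta>))"
      "hardy_core.Cn p q \<theta> = ennreal (enn2real (hardy_core.Cn p q \<theta>))"
      using constants_finite by simp_all
    then have "hardy_core.Cs p q \<theta> \<le> ennreal b" "hardy_core.Cn p q \<theta> \<le> ennreal c"
      unfolding b_def c_def by (metis ennreal_leI le_add_same_cancel1 zero_le_one, metis ennreal_leI le_add_same_cancel2 powr_ge_zero)
    then show "epow (best_const p q U v w) (r_exp p q)
              \<le> ennreal c * (A1_star p q U v w + A2_star p q U v w) \<and>
            A1_star p q U v w + A2_star p q U v w
              \<le> ennreal c * epow (best_const p q U v w) (r_exp p q)"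
      using b c by (intro conjI best_const_upper[of b] best_const_lower) (auto simp: c_def intro!: ennreal_leI)
  qed
qed

end
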